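(* Consider the $D$-dimensional dynamical system $\frac{d}{dt}y(t)=f(y(t))$, $y(0)=x$, with $f:\mathbb{R}^D\to\mathbb{R}^D$ smooth, and a weakly stable and consistent linear multistep method of order $p$ with coefficients $\alpha_m,\beta_m$ ($0\le m\le M$), $\sum_{m=0}^M\beta_m=1$. Let $Q,R,r>0$ and let $\mathcal{K}\subset\mathbb{R}^D$ be a bounded domain. Then there are constants $\gamma,h_0,c_0,c_1,c_2>0$, depending on $r/Q$, $R/Q$, the dimension $D$, the volume of the domain $\mathcal{B}(\mathcal{K},R)$ and the coefficients $\alpha_m,\beta_m$, and integers $K=K(h)$, $I=I(h)$, such that the following holds for $0<h<h_0$. Let $f_{\theta^*}$ be the network learned by optimizing the training loss $\mathcal{L}_{h,N}$ and denote $$\mathcal{L}=\int_{\mathcal{B}(\mathcal{K},R)}\Big\|\sum_{m=0}^M h^{-1}\alpha_m\phi_{mh,f}(x)-\sum_{m=0}^M\beta_m f_{\theta^*}(\phi_{mh,f}(x))\Big\|_2^2\,dx .$$ Suppose the target governing function $f$ is $(Q,r)$-analytic on $\mathcal{B}(\mathcal{K},R)$ and the learned vector field $f_{\theta^*}$ is $(Q,r,I)$-analytic on $\mathcal{B}(\mathcal{K},R)$. Then the uniquely defined vector field $f_h^K$ (the truncated inverse modified differential equation) satisfies $$\int_{\mathcal{K}}\|f_{\theta^*}(x)-f_h^K(x)\|\,dx\le c_1e^{-\gamma/h^{2/5}}+c_0\mathcal{L}^{1/2},$$ $$\int_{\mathcal{K}}\|f_{\theta^*}(x)-f(x)\|\,dx\le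 c_2h^p+c_0\mathcal{L}^{1/2}.$$
   Context: Norms. $\|\cdot\|=\|\cdot\|_1$ is the $\ell_1$-norm on $\mathbb{C}^D$ (and the induced operator norm of multilinear maps/tensors); $\|\cdot\|_2$ is the $\ell_2$-norm; $\|g\|_\Omega=\sup_{x\in\Omega}\|g(x)\|_1$. Neighborhoods. $\mathcal{B}(x,r)=\{y\in\mathbb{R}^D:\|y-x\|_1\le r\}$, $\mathcal{B}(\Omega,r)=\bigcup_{x\in\Omega}\mathcal{B}(x,r)$; $\mathcal{CB}(x,r)=\{y\in\mathbb{C}^D:\|y-x\|_1\le r\}$, $\mathcal{CB}(\Omega,r)=\bigcup_{x\in\Omega}\mathcal{CB}(x,r)$. Analyticity. $g$ is $(Q,r)$-analytic on $\Omega\subset\mathbb{R}^D$ if $g$ is (extends to be) analytic on $\mathcal{CB}(\Omega,r)$ and $\|g\|_{\mathcal{CB}(\Omega,r)}\le Q$. $g$ is $(Q,r,I)$-analytic on $\Omega$ if its derivatives $g^{(i)}$ satisfy $\|g^{(i)}\|_\Omega\le i!\,Q\,r^{-i}$ for $i=0,\dots,I$. Flow. $\phi_{t,f}(x)=y(t)$ is the time-$t$ flow of $\frac{d}{dt}y=f(y)$, $y(0)=x$. Linear multistep method (LMM): $\sum_{m=0}^M\alpha_my_m-h\sum_{m=0}^M\beta_mf(y_m)=0$ with $\alpha_M\ne0$, $|\alpha_0|+|\beta_0|>0$. Weakly stable: $\sum_m m\alpha_m\ne0$. Consistent: $\sum_m\alpha_m=0$ and $\sum_m m\alpha_m=\sum_m\beta_m$.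 Of order $p\ge1$: $\sum_m\alpha_m=0$ and $\sum_m\frac{m^{k+1}}{(k+1)!}\alpha_m=\sum_m\frac{m^k}{k!}\beta_m$ for $k=0,\dots,p-1$ (with $0^0=1$). Truncated inverse modified differential equation (IMDE): with the Lie derivative $\mathbf{D}g(y)=g'(y)f(y)$, define recursively for $k\ge0$ $$f_k(y)=\sum_{m=0}^M\alpha_m\frac{m^{k+1}}{(k+1)!}(\mathbf{D}^kf)(y)-\sum_{m=0}^M\beta_m\sum_{j=1}^k\frac{m^j}{j!}(\mathbf{D}^jf_{k-j})(y),\qquad f_h^K=\sum_{k=0}^Kh^kf_k .$$ Learning. $f_{\theta^*}:\mathbb{R}^D\to\mathbb{R}^D$ is an element of a hypothesis class $\mathcal{M}$ of feedforward neural networks, obtained by optimizing over $f_\theta\in\mathcal{M}$ the training loss $$\mathcal{L}_{h,N}(f_\theta)=\frac1N\sum_{n=1}^N\Big\|\sum_{m=0}^Mh^{-1}\alpha_m\phi_{mh,f}(x_n)-\sum_{m=0}^M\beta_mf_\theta(\phi_{mh,f}(x_n))\Big\|_2^2$$ for given points $x_1,\dots,x_N$. "Learned by optimizing" only names the network returned by training; it is not required to be an exact minimizer. *)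

theory Defs
  imports "HOL-Analysis.Analysis"
begin

section \<open>Norms and neighbourhoods\<close>

text \<open>The standard \<^const>\<open>norm\<close> on \<^typ>\<open>real^'n\<close> is the Euclidean one, so the \<open>\<ell>\<^sub>1\<close>-norm
  gets its own constant; it is used for both real and complex vectors.\<close>

definition l1_norm :: "'a::real_normed_vector ^ 'n \<Rightarrow> real" where
  "l1_norm x = (\<Sum>i\<in>UNIV. norm (x $ i))"

definition complex_vec :: "real ^ 'n \<Rightarrow> complex ^ 'n" where
  "complex_vec x = (\<chi> i. complex_of_real (x $ i))"

definition nbhd :: "(real ^ 'n) set \<Rightarrow> real \<Rightarrow> (real ^ 'n) set" where
  "nbhd \<Omega> r = (\<Union>x\<in>\<Omega>. {y. l1_norm (y - x) \<le> r})"

definition complex_nbhd :: "(real ^ 'n) set \<Rightarrow> real \<Rightarrow> (complex ^ 'n) set" where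
  "complex_nbhd \<Omega> r = (\<Union>x\<in>\<Omega>. {y. l1_norm (y - complex_vec x) \<le> r})"

text \<open>Suprema are taken in \<^typ>\<open>ennreal\<close>, so that an unbounded supremum is \<open>\<infinity>\<close> rather than an
  unspecified real number.\<close>

definition sup_norm :: "'c set \<Rightarrow> ('c \<Rightarrow> 'a::real_normed_vector ^ 'n) \<Rightarrow> ennreal" where
  "sup_norm \<Omega> g = (SUP x\<in>\<Omega>. ennreal (l1_norm (g x)))"

section \<open>Higher derivatives\<close>

text \<open>\<open>iterated_deriv g [v\<^sub>1, \<dots>, v\<^sub>i] x\<close> is the value \<open>g\<^sup>(\<^sup>i\<^sup>)(x)[v\<^sub>1, \<dots>, v\<^sub>i]\<close> of the \<open>i\<close>-th Frechet
  derivative as a multilinear map.\<close>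

fun iterated_deriv ::
  "('a::real_normed_vector \<Rightarrow> 'b::real_normed_vector) \<Rightarrow> 'a list \<Rightarrow> 'a \<Rightarrow> 'b" where
  "iterated_deriv g [] = g"
| "iterated_deriv g (v # vs) = (\<lambda>x. frechet_derivative (iterated_deriv g vs) (at x) v)"

definition times_differentiable_on ::
  "nat \<Rightarrow> 'a set \<Rightarrow> ('a::real_normed_vector \<Rightarrow> 'b::real_normed_vector) \<Rightarrow> bool" where
  "times_differentiable_on n \<Omega> g \<longleftrightarrow>
     (\<forall>vs. length vs < n \<longrightarrow> (\<forall>x\<in>\<Omega>. iterated_deriv g vs differentiable (at x)))"

definition smooth_map :: "('a::real_normed_vector \<Rightarrow> 'b::real_normed_vector) \<Rightarrow> bool" where
  "smooth_map g \<longleftrightarrow> (\<forall>n. times_differentiable_on n UNIV g)"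

definition deriv_norm :: "(real ^ 'n \<Rightarrow> real ^ 'm) \<Rightarrow> nat \<Rightarrow> real ^ 'n \<Rightarrow> ennreal" where
  "deriv_norm g i x =
     (SUP vs\<in>{vs. length vs = i \<and> (\<forall>v\<in>set vs. l1_norm v \<le> 1)}.
        ennreal (l1_norm (iterated_deriv g vs x)))"

section \<open>Analyticity\<close>

text \<open>Analyticity in several complex variables on a not necessarily open set, following the
  convention of \<^const>\<open>analytic_on\<close>: complex differentiability in a ball around each point.\<close>

definition complex_analytic_on ::
  "(complex ^ 'n \<Rightarrow> complex ^ 'm) \<Rightarrow> (complex ^ 'n) set \<Rightarrow> bool" where
  "complex_analytic_on G S \<longleftrightarrow>
     (\<forall>z\<in>S. \<exists>e>0. \<forall>w\<in>ball z e.
        \<exists>G'. (G has_derivative G') (at w) \<and> (\<forall>c v. G' (c *s v) = c *s G' v))"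

text \<open>\<open>(Q, r)\<close>-analyticity. The extension \<open>G\<close> agrees with \<open>g\<close> at every real point of the complex
  neighbourhood, not merely on \<open>\<Omega>\<close>.\<close>

definition analytic_bounded ::
  "real \<Rightarrow> real \<Rightarrow> (real ^ 'n) set \<Rightarrow> (real ^ 'n \<Rightarrow> real ^ 'm) \<Rightarrow> bool" where
  "analytic_bounded Q r \<Omega> g \<longleftrightarrow>
     (\<exists>G. complex_analytic_on G (complex_nbhd \<Omega> r)
        \<and> (\<forall>x. complex_vec x \<in> complex_nbhd \<Omega> r \<longrightarrow> G (complex_vec x) = complex_vec (g x))
        \<and> sup_norm (complex_nbhd \<Omega> r) G \<le> ennreal Q)"

text \<open>\<open>(Q, r, I)\<close>-analyticity, intended for open \<open>\<Omega>\<close>.\<close>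

definition analytic_bounded_upto ::
  "real \<Rightarrow> real \<Rightarrow> nat \<Rightarrow> (real ^ 'n) set \<Rightarrow> (real ^ 'n \<Rightarrow> real ^ 'm) \<Rightarrow> bool" where
  "analytic_bounded_upto Q r I \<Omega> g \<longleftrightarrow>
     times_differentiable_on I \<Omega> g
     \<and> (\<forall>i\<le>I. (SUP x\<in>\<Omega>. deriv_norm g i x) \<le> ennreal (fact i * Q / r ^ i))"

section \<open>Flows and linear multistep methods\<close>

definition flow :: "('a::real_normed_vector \<Rightarrow> 'a) \<Rightarrow> real \<Rightarrow> 'a \<Rightarrow> 'a" where
  "flow f t x = (THE z. \<exists>y. y 0 = x
     \<and> (\<forall>s\<in>closed_segment 0 t. (y has_vector_derivative f (y s)) (at s within closed_segment 0 t))
     \<and> y t = z)"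

text \<open>A method with \<open>M\<close> steps is given by its coefficients \<open>\<alpha> m\<close>, \<open>\<beta> m\<close> for \<open>m \<le> M\<close>; their values
  for \<open>m > M\<close> are irrelevant.\<close>

definition multistep_method :: "nat \<Rightarrow> (nat \<Rightarrow> real) \<Rightarrow> (nat \<Rightarrow> real) \<Rightarrow> bool" where
  "multistep_method M \<alpha> \<beta> \<longleftrightarrow> \<alpha> M \<noteq> 0 \<and> \<bar>\<alpha> 0\<bar> + \<bar>\<beta> 0\<bar> > 0"

definition weakly_stable :: "nat \<Rightarrow> (nat \<Rightarrow> real) \<Rightarrow> bool" where
  "weakly_stable M \<alpha> \<longleftrightarrow> (\<Sum>m\<le>M. real m * \<alpha> m) \<noteq> 0"

definition consistent :: "nat \<Rightarrow> (nat \<Rightarrow> real) \<Rightarrow> (nat \<Rightarrow> real) \<Rightarrow> bool" where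
  "consistent M \<alpha> \<beta> \<longleftrightarrow>
     (\<Sum>m\<le>M. \<alpha> m) = 0 \<and> (\<Sum>m\<le>M. real m * \<alpha> m) = (\<Sum>m\<le>M. \<beta> m)"

definition has_order :: "nat \<Rightarrow> (nat \<Rightarrow> real) \<Rightarrow> (nat \<Rightarrow> real) \<Rightarrow> nat \<Rightarrow> bool" where
  "has_order M \<alpha> \<beta> p \<longleftrightarrow> p \<ge> 1 \<and> (\<Sum>m\<le>M. \<alpha> m) = 0 \<and>
     (\<forall>k<p. (\<Sum>m\<le>M. real m ^ (k + 1) / fact (k + 1) * \<alpha> m) = (\<Sum>m\<le>M. real m ^ k / fact k * \<beta> m))"

section \<open>Inverse modified differential equation\<close>

definition lie_deriv ::
  "('a::real_normed_vector \<Rightarrow> 'a) \<Rightarrow> ('a \<Rightarrow> 'b::real_normed_vector) \<Rightarrow> 'a \<Rightarrow> 'b" where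
  "lie_deriv f g y = frechet_derivative g (at y) (f y)"

fun imde_term :: "nat \<Rightarrow> (nat \<Rightarrow> real) \<Rightarrow> (nat \<Rightarrow> real) \<Rightarrow>
    ('a::real_normed_vector \<Rightarrow> 'a) \<Rightarrow> nat \<Rightarrow> 'a \<Rightarrow> 'a" where
  "imde_term M \<alpha> \<beta> f k = (\<lambda>y.
     (\<Sum>m\<le>M. (\<alpha> m * (real m ^ (k + 1) / fact (k + 1))) *\<^sub>R (lie_deriv f ^^ k) f y)
     - (\<Sum>m\<le>M. \<beta> m *\<^sub>R
          (\<Sum>j\<in>{1..k}. (real m ^ j / fact j) *\<^sub>R (lie_deriv f ^^ j) (imde_term M \<alpha> \<beta> f (k - j)) y)))"

declare imde_term.simps [simp del]

definition truncated_imde :: "nat \<Rightarrow> (nat \<Rightarrow> real) \<Rightarrow> (nat \<Rightarrow> real) \<Rightarrow>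
    ('a::real_normed_vector \<Rightarrow> 'a) \<Rightarrow> nat \<Rightarrow> real \<Rightarrow> 'a \<Rightarrow> 'a" where
  "truncated_imde M \<alpha> \<beta> f K h y = (\<Sum>k\<le>K. h ^ k *\<^sub>R imde_term M \<alpha> \<beta> f k y)"

section \<open>Feedforward networks and the loss\<close>

text \<open>\<open>hidden_layer w z\<close>: the components \<open>z x i\<close> with \<open>i < w\<close> are the outputs of a hidden layer of
  width \<open>w\<close> for the input \<open>x\<close>. Each layer may have its own continuous activation function.\<close>

inductive hidden_layer :: "nat \<Rightarrow> (real ^ 'n \<Rightarrow> nat \<Rightarrow> real) \<Rightarrow> bool" where
  first_layer: "continuous_on UNIV \<sigma> \<Longrightarrow>
     hidden_layer w (\<lambda>x i. \<sigma> ((\<Sum>j\<in>UNIV. W i j * x $ j) + b i))"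
| deeper_layer: "hidden_layer v z \<Longrightarrow> continuous_on UNIV \<sigma> \<Longrightarrow>
     hidden_layer w (\<lambda>x i. \<sigma> ((\<Sum>j<v. W i j * z x j) + b i))"

definition feedforward_networks :: "(real ^ 'n \<Rightarrow> real ^ 'm) set" where
  "feedforward_networks =
     {g. \<exists>w z W b. hidden_layer w z \<and> g = (\<lambda>x. \<chi> i. (\<Sum>j<w. W i j * z x j) + b i)}"

definition lmm_residual :: "nat \<Rightarrow> (nat \<Rightarrow> real) \<Rightarrow> (nat \<Rightarrow> real) \<Rightarrow> real \<Rightarrow>
    (real ^ 'n \<Rightarrow> real ^ 'n) \<Rightarrow> (real ^ 'n \<Rightarrow> real ^ 'n) \<Rightarrow> real ^ 'n \<Rightarrow> real ^ 'n" where
  "lmm_residual M \<alpha> \<beta> h f g x =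
     (\<Sum>m\<le>M. (\<alpha> m / h) *\<^sub>R flow f (real m * h) x)
     - (\<Sum>m\<le>M. \<beta> m *\<^sub>R g (flow f (real m * h) x))"

definition lmm_loss :: "nat \<Rightarrow> (nat \<Rightarrow> real) \<Rightarrow> (nat \<Rightarrow> real) \<Rightarrow> real \<Rightarrow>
    (real ^ 'n \<Rightarrow> real ^ 'n) \<Rightarrow> (real ^ 'n \<Rightarrow> real ^ 'n) \<Rightarrow> (real ^ 'n) set \<Rightarrow> real" where
  "lmm_loss M \<alpha> \<beta> h f g \<Omega> = (LINT x:\<Omega>|lborel. (norm (lmm_residual M \<alpha> \<beta> h f g x))\<^sup>2)"

end

theory Submission
  imports
    Defs
    "HOL-Complex_Analysis.Complex_Analysis"
    "HOL-Library.Discrete_Functions"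
begin

text \<open>
  Along a trajectory \<open>Y(t)\<close> of \<open>f\<close> put \<open>G(t) = f\<^sub>\<theta>(Y(t))\<close>. The residual of the method at \<open>Y(t)\<close> is
  \<open>h\<inverse> \<alpha>(S) Y - \<beta>(S) G\<close>, where \<open>S\<close> is the shift by \<open>h\<close>. Since \<open>\<beta>\<close> may vanish on the unit circle, \<open>\<beta>(S)\<close> has
  no bounded inverse; but it only has to be inverted on functions that are analytic on the scale \<open>1\<close>. For every
  \<open>n\<close> there is a Laurent polynomial \<open>P\<close> of degree \<open>O(n\<^bsup>5/2\<^esup>)\<close> whose coefficients are absolutely summable
  with a bound independent of \<open>n\<close>, such that \<open>P \<beta> - 1\<close> vanishes to order \<open>2n\<close> at \<open>1\<close>. It is a combination of
  the truncated Neumann series of \<open>1/\<beta>\<close>, damped by high powers of averaging filters of widths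
  \<open>s\<^sub>l \<approx> \<sigma> l\<^bsup>3/2\<^esup>\<close>; the central moments of these filters are polynomials in \<open>s\<^sub>l\<^sup>2\<close>, and the combination
  extrapolates them to width \<open>1\<close>, that is, to the identity.

  Applying \<open>P(S)\<close> to the residual reproduces \<open>f\<^sub>h\<^sup>K - f\<^sub>\<theta>\<close> at the point \<open>Y(0)\<close> up to the Taylor remainders of order
  \<open>2n\<close> of \<open>Y\<close> and \<open>G\<close>, because \<open>f\<^sub>k\<close> is a multiple \<open>c\<^sub>k \<^bold>D\<^sup>k f\<close> with \<open>\<Sum> c\<^sub>k z\<^sup>k = \<alpha>(e\<^sup>z) / (z \<beta>(e\<^sup>z))\<close>. A majorant
  argument bounds \<open>\<^bold>D\<^sup>k f\<close> and \<open>\<^bold>D\<^sup>k f\<^sub>\<theta>\<close> by \<open>k! (6Q/r)\<^sup>k Q\<close>, so the remainders are at most \<open>O(2\<^bsup>-2n\<^esup>)\<close> as long as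
  the window \<open>n\<^bsup>5/2\<^esup> h\<close> is small, which permits \<open>n \<approx> h\<^bsup>-2/5\<^esup>\<close>.
\<close>

text \<open>The Neumann series of 1/\<beta> need not be bounded in coefficient norm, since 1 -
  \<beta> may be large on the unit circle away from 1. But it vanishes at 1, so its product with an
  average over s shifts is O(1/s). Each of the up to 2n - 1 factors 1 - \<beta> is paired with one
  of 2n averages, which makes the series geometric. The price is a changed jet at 1, and this is
  what the extrapolation repairs: centred averages are even, so a moment of order k < 2n is a
  polynomial of degree below n in the squared width, and n widths suffice. The longest filter has 2n
  averages of width about n^(3/2); hence n^(5/2), and the exponent 2/5.

  The constants may not depend on \<open>Q\<close>, \<open>r\<close>, \<open>R\<close> separately.
  All time scales involve only the ratios, and the linear factor \<open>Q\<close> left in the errors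
  is bounded because a given volume bounds \<open>R\<close>.

  The residual is needed at shifted points of a trajectory, but the loss integrates over unshifted
  ones. The shift is undone by a measure estimate for maps with a Lipschitz inverse.\<close>

no_notation fps_nth (infixl \<open>$\<close> 75)

subsection \<open>The coefficient norm of polynomials\<close>

text \<open>Bounds the effect of a polynomial in a shift in every norm in which the shifts are
  uniformly bounded, such as the sup norm or the integral norm; the maximum on the unit circle would
  not.\<close>

definition poly_l1 :: "real poly \<Rightarrow> real" where
  "poly_l1 p = (\<Sum>i\<le>degree p. \<bar>coeff p i\<bar>)"

lemma poly_l1_eq: "degree p \<le> m \<Longrightarrow> poly_l1 p = (\<Sum>i\<le>m. \<bar>coeff p i\<bar>)"
  unfolding poly_l1_def by (rule sum.mono_neutral_left) (auto simp: coeff_eq_0)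

lemma poly_l1_nonneg [simp]: "poly_l1 p \<ge> 0"
  by (simp add: poly_l1_def sum_nonneg)

lemma poly_l1_add: "poly_l1 (p + q) \<le> poly_l1 p + poly_l1 q"
proof -
  define m where "m = max (degree p) (degree q)"
  have "poly_l1 (p + q) = (\<Sum>i\<le>m. \<bar>coeff (p + q) i\<bar>)"
    by (rule poly_l1_eq) (simp add: m_def degree_add_le_max)
  also have "\<dots> \<le> (\<Sum>i\<le>m. \<bar>coeff p i\<bar>) + (\<Sum>i\<le>m. \<bar>coeff q i\<bar>)"
    unfolding sum.distrib[symmetric] by (rule sum_mono) simp
  also have "\<dots> = poly_l1 p + poly_l1 q"
    by (subst (1 2) poly_l1_eq[where m = m]) (auto simp: m_def)
  finally show ?thesis .
qed

lemma poly_l1_0 [simp]: "poly_l1 0 = 0"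
  by (simp add: poly_l1_def)

lemma poly_l1_sum: "poly_l1 (\<Sum>i\<in>A. f i) \<le> (\<Sum>i\<in>A. poly_l1 (f i))"
proof (induction A rule: infinite_finite_induct)
  case (insert x F)
  then show ?case
    using poly_l1_add[of "f x" "\<Sum>i\<in>F. f i"] by simp
qed auto

lemma poly_l1_smult: "poly_l1 (smult c p) = \<bar>c\<bar> * poly_l1 p"
  by (subst poly_l1_eq[where m = "degree p"])
     (auto simp: degree_smult_le abs_mult poly_l1_def sum_distrib_left)

lemma poly_l1_monom [simp]: "poly_l1 (monom c n) = \<bar>c\<bar>"
proof -
  have "poly_l1 (monom c n) = (\<Sum>i\<le>n. \<bar>coeff (monom c n) i\<bar>)"
    by (rule poly_l1_eq) (rule degree_monom_le)
  also have "\<dots> = (\<Sum>i\<le>n. if n = i then \<bar>c\<bar> else 0)"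
    by (rule sum.cong) auto
  finally show ?thesis by simp
qed

lemma poly_l1_1 [simp]: "poly_l1 1 = 1"
  by (simp add: poly_l1_def)

lemma poly_at_1: "degree p \<le> m \<Longrightarrow> poly p 1 = (\<Sum>i\<le>m. coeff p i)" for p :: "real poly"
  by (simp add: poly_altdef, rule sum.mono_neutral_left) (auto simp: coeff_eq_0)

text \<open>\<open>p'\<close> and \<open>q'\<close> carry the absolute values of the coefficients.
  Their product dominates \<open>p * q\<close> coefficientwise, and for nonnegative coefficients the
  sum is the value at 1, which is multiplicative.\<close>

lemma poly_l1_mult: "poly_l1 (p * q) \<le> poly_l1 p * poly_l1 q"
proof -
  define p' q' where "p' = map_poly abs p" and "q' = map_poly abs q"
  have c: "coeff p' i = \<bar>coeff p i\<bar>" "coeff q' i = \<bar>coeff q i\<bar>" for i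
    by (auto simp: p'_def q'_def coeff_map_poly)
  have d: "degree p' = degree p" "degree q' = degree q"
    by (auto simp: p'_def q'_def degree_map_poly)
  define m where "m = degree p + degree q"
  have "poly_l1 (p * q) = (\<Sum>k\<le>m. \<bar>coeff (p * q) k\<bar>)"
    by (rule poly_l1_eq) (simp add: m_def degree_mult_le)
  also have "\<dots> \<le> (\<Sum>k\<le>m. coeff (p' * q') k)"
  proof (rule sum_mono)
    fix k
    have "\<bar>coeff (p * q) k\<bar> \<le> (\<Sum>i\<le>k. \<bar>coeff p i * coeff q (k - i)\<bar>)"
      unfolding coeff_mult by (rule sum_abs)
    then show "\<bar>coeff (p * q) k\<bar> \<le> coeff (p' * q') k"
      by (simp add: coeff_mult c abs_mult)
  qed
  also have "\<dots> = poly (p' * q') 1"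
    by (rule poly_at_1[symmetric]) (metis d m_def degree_mult_le)
  also have "\<dots> = poly_l1 p * poly_l1 q"
    by (simp add: poly_at_1[of p' "degree p"] poly_at_1[of q' "degree q"] d c poly_l1_def)
  finally show ?thesis .
qed

lemma poly_l1_power: "poly_l1 (p ^ n) \<le> poly_l1 p ^ n"
proof (induction n)
  case (Suc n)
  have "poly_l1 (p * p ^ n) \<le> poly_l1 p * poly_l1 (p ^ n)" by (rule poly_l1_mult)
  also have "\<dots> \<le> poly_l1 p * poly_l1 p ^ n" by (intro mult_left_mono Suc) auto
  finally show ?case by simp
qed auto

subsection \<open>Polynomials in the exponential\<close>

text \<open>The shift by one time unit is the exponential of d/dt, so this is the symbol of
  \<open>p\<close> as a shift operator. Its coefficient of order k is the moment \<Sum> p_j j^k /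
  k!, the value at 0 of \<open>p\<close> applied to t^k / k!.\<close>

definition poly_exp :: "real poly \<Rightarrow> real fps" where
  "poly_exp p = poly (map_poly fps_const p) (fps_exp 1)"

lemma poly_exp_pCons [simp]: "poly_exp (pCons a p) = fps_const a + fps_exp 1 * poly_exp p"
  by (simp add: poly_exp_def map_poly_pCons)

lemma poly_exp_0 [simp]: "poly_exp 0 = 0"
  by (simp add: poly_exp_def)

lemma poly_exp_1 [simp]: "poly_exp 1 = 1"
  by (simp add: poly_exp_def)

lemma poly_exp_add [simp]: "poly_exp (p + q) = poly_exp p + poly_exp q"
proof -
  have "map_poly fps_const (p + q) = map_poly fps_const p + map_poly fps_const q"
    by (rule poly_eqI) (simp add: coeff_map_poly)
  then show ?thesis by (simp add: poly_exp_def)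
qed

lemma poly_exp_smult [simp]: "poly_exp (smult c p) = fps_const c * poly_exp p"
proof -
  have "map_poly fps_const (smult c p) = smult (fps_const c) (map_poly fps_const p)"
    by (rule poly_eqI) (simp add: coeff_map_poly)
  then show ?thesis by (simp add: poly_exp_def)
qed

lemma poly_exp_diff [simp]: "poly_exp (p - q) = poly_exp p - poly_exp q"
proof -
  have "poly_exp (p + smult (-1) q) = poly_exp p + fps_const (-1) * poly_exp q"
    by (simp only: poly_exp_add poly_exp_smult)
  moreover have "fps_const (-1 :: real) = -1"
    by (simp add: fps_const_neg[symmetric] del: fps_const_neg)
  ultimately show ?thesis by simp
qed

lemma poly_exp_mult [simp]: "poly_exp (p * q) = poly_exp p * poly_exp q"
proof (induction p)
  case (pCons a p)
  have "poly_exp (pCons a p * q) = fps_const a * poly_exp q + fps_exp 1 * (poly_exp p * poly_exp q)"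
    by (simp add: mult_pCons_left pCons.IH)
  then show ?case by (simp add: algebra_simps)
qed auto

lemma poly_exp_power [simp]: "poly_exp (p ^ n) = poly_exp p ^ n"
  by (induction n) auto

lemma poly_exp_sum [simp]: "poly_exp (\<Sum>i\<in>A. f i) = (\<Sum>i\<in>A. poly_exp (f i))"
  by (induction A rule: infinite_finite_induct) auto

lemma poly_exp_monom [simp]: "poly_exp (monom c n) = fps_const c * fps_exp (real n)"
proof (induction n)
  case (Suc n)
  have "poly_exp (monom c (Suc n)) = fps_const c * (fps_exp 1 * fps_exp (real n))"
    by (simp add: monom_Suc Suc.IH algebra_simps)
  also have "fps_exp 1 * fps_exp (real n) = fps_exp (real (Suc n))"
    by (simp add: fps_exp_add_mult[symmetric] add.commute)
  finally show ?case .
qed (simp add: monom_0)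

lemma poly_exp_altdef: "poly_exp p = (\<Sum>j\<le>degree p. fps_const (coeff p j) * fps_exp (real j))"
  using poly_exp_sum[of "\<lambda>j. monom (coeff p j) j" "{..degree p}"]
  by (simp only: poly_as_sum_of_monoms poly_exp_monom)

lemma poly_exp_nth_0: "fps_nth (poly_exp p) 0 = poly p 1"
  by (induction p) auto

subsection \<open>Averaging filters\<close>

definition avg :: "nat \<Rightarrow> real poly" where
  "avg s = smult (1 / real s) (\<Sum>i<s. monom 1 i)"

lemma degree_avg: "degree (avg s) \<le> s - 1"
proof -
  have "degree (\<Sum>i<s. monom (1::real) i) \<le> s - 1"
    by (rule degree_sum_le) (auto intro: order.trans[OF degree_monom_le])
  then show ?thesis
    unfolding avg_def using degree_smult_le order.trans by blast
qed

lemma poly_l1_avg: "poly_l1 (avg s) \<le> 1"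
proof -
  have "poly_l1 (\<Sum>i<s. monom (1::real) i) \<le> (\<Sum>i<s. poly_l1 (monom 1 i))" by (rule poly_l1_sum)
  then have "poly_l1 (\<Sum>i<s. monom (1::real) i) \<le> real s" by simp
  then show ?thesis
    by (cases "s = 0") (auto simp: avg_def poly_l1_smult field_simps)
qed

lemma avg_difference: "[:-1, 1:] * avg s = smult (1 / real s) (monom 1 s - 1)"
proof -
  have m: "monom (1::real) i = [:0, 1:] ^ i" for i
    by (simp add: monom_altdef)
  have "[:0, 1:] ^ s - (1::real poly) = ([:0, 1:] - 1) * (\<Sum>i<s. [:0, 1:] ^ i)"
    by (rule power_diff_1_eq)
  also have "[:0, 1:] - 1 = [:-1, 1::real:]" by (simp add: one_pCons)
  finally show ?thesis by (simp add: avg_def m)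
qed

text \<open>The product telescopes to (x^s - 1) / s. This gain of 1/s is the only source of
  smallness in the damped Neumann series.\<close>

lemma poly_l1_avg_difference: "poly_l1 ([:-1, 1:] * avg s) \<le> 2 / real s"
proof -
  have "poly_l1 (monom 1 s + smult (-1) 1) \<le> poly_l1 (monom 1 s) + poly_l1 (smult (-1) 1)"
    by (rule poly_l1_add)
  moreover have "monom 1 s + smult (-1) 1 = monom 1 s - (1 :: real poly)"
    by (simp add: one_pCons)
  moreover have "poly_l1 (smult (-1) 1) = 1" unfolding poly_l1_smult by simp
  ultimately have "poly_l1 (monom 1 s - 1) \<le> 2" by simp
  then show ?thesis unfolding avg_difference poly_l1_smult
    by (simp add: divide_right_mono)
qed

text \<open>The power series of \<open>sinh (s\<tau>/2) / (s\<tau>/2)\<close>.\<close>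

definition fps_sinhc :: "real \<Rightarrow> real fps" where
  "fps_sinhc s = Abs_fps (\<lambda>k. if even k then (s / 2) ^ k / fact (k + 1) else 0)"

lemma fps_sinhc_exp: "fps_const s * (fps_X * fps_sinhc s) = fps_exp (s / 2) - fps_exp (- (s / 2))"
proof (rule fps_ext)
  fix k show "fps_nth (fps_const s * (fps_X * fps_sinhc s)) k
    = fps_nth (fps_exp (s / 2) - fps_exp (- (s / 2))) k"
  proof (cases k)
    case (Suc n)
    define X F :: real where "X = (s / 2) ^ n" and "F = fact (Suc n)"
    have 1: "(- (s / 2)) ^ Suc n = (if even n then - (s / 2 * X) else s / 2 * X)"
      by (simp add: X_def)
    have 2: "(s / 2) ^ Suc n = s / 2 * X" by (simp add: X_def)
    have "fps_nth (fps_exp (s / 2) - fps_exp (- (s / 2))) k = (s / 2) ^ Suc n / F - (- (s / 2)) ^ Suc n / F"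
      by (simp only: Suc fps_sub_nth fps_exp_def fps_nth_Abs_fps F_def of_nat_fact)
    also have "\<dots> = (if even n then s * (X / F) else 0)"
      unfolding 1 2 by simp
    finally show ?thesis by (simp add: Suc fps_sinhc_def X_def F_def)
  qed simp
qed

text \<open>Recentred at the mean position (s - 1) / 2, which makes the series even. For even s this
  is a half-integral shift, meaningful for power series but not for polynomials in the
  shift.\<close>

definition centred_avg :: "nat \<Rightarrow> real fps" where
  "centred_avg s = fps_exp (- ((real s - 1) / 2)) * poly_exp (avg s)"

text \<open>The recentred geometric sum is sinh(sz/2) / (s sinh(z/2)), a quotient of two sinhc
  series. The identity is checked after multiplication by \<open>s\<close> and \<open>fps_X\<close>,
  which are then cancelled.\<close>

lemma centred_avg_sinhc:
  assumes "s > 0"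
  shows "centred_avg s * fps_sinhc 1 = fps_sinhc (real s)"
proof -
  define E where "E = (\<Sum>i<s. fps_exp (real i))"
  have pe: "poly_exp (avg s) = fps_const (1 / real s) * E"
    by (simp add: avg_def E_def)
  have ee: "fps_exp (1::real) ^ i = fps_exp (real i)" for i
    by (simp add: fps_exp_power_mult)
  have E: "(fps_exp 1 - 1) * E = fps_exp (real s) - 1"
    unfolding E_def using power_diff_1_eq[of "fps_exp (1::real)" s] by (simp add: ee)
  have s: "fps_const (real s) * fps_const (1 / real s) = 1"
    using assms by simp
  have "(fps_const (real s) * fps_X) * (centred_avg s * fps_sinhc 1)
      = (fps_const (real s) * fps_const (1 / real s)) * fps_exp (- ((real s - 1) / 2)) * E
          * (fps_const 1 * (fps_X * fps_sinhc 1))"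
    by (simp only: centred_avg_def pe) (simp add: mult_ac)
  also have "\<dots> = fps_exp (- ((real s - 1) / 2)) * E * (fps_exp (1 / 2) - fps_exp (- (1 / 2)))"
    by (simp only: s fps_sinhc_exp) simp
  also have "fps_exp (1 / 2) - fps_exp (- (1 / 2)) = fps_exp (- (1 / 2)) * (fps_exp (1::real) - 1)"
    by (simp add: algebra_simps fps_exp_add_mult[symmetric])
  also have "fps_exp (- ((real s - 1) / 2)) * E * (fps_exp (- (1 / 2)) * (fps_exp 1 - 1))
      = (fps_exp (- ((real s - 1) / 2)) * fps_exp (- (1 / 2))) * ((fps_exp 1 - 1) * E)"
    by (simp only: mult_ac)
  also have "fps_exp (- ((real s - 1) / 2)) * fps_exp (- (1 / 2)) = fps_exp (- (real s / 2))"
    by (simp add: fps_exp_add_mult[symmetric] field_simps)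
  also have "fps_exp (- (real s / 2)) * ((fps_exp 1 - 1) * E)
      = fps_exp (- (real s / 2)) * fps_exp (real s) - fps_exp (- (real s / 2))"
    by (simp only: E right_diff_distrib mult_1_right)
  also have "fps_exp (- (real s / 2)) * fps_exp (real s) = fps_exp (real s / 2)"
    by (simp add: fps_exp_add_mult[symmetric])
  also have "fps_exp (real s / 2) - fps_exp (- (real s / 2))
      = (fps_const (real s) * fps_X) * fps_sinhc (real s)"
    by (simp only: fps_sinhc_exp[symmetric]) (simp add: mult_ac)
  finally show ?thesis
    using assms by (simp add: fps_const_eq_0_iff)
qed

lemma centred_avg_1: "centred_avg (Suc 0) = 1"
  by (simp add: centred_avg_def avg_def)

text \<open>One polynomial \<open>q\<close> serves all widths \<open>s\<close> at once. Its degree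
  bound k/2 is the point: orders k < 2n give degree below n, so n nodes determine it.\<close>

definition even_family :: "(nat \<Rightarrow> real fps) \<Rightarrow> bool" where
  "even_family F \<longleftrightarrow>
     (\<forall>k. \<exists>q. 2 * degree q \<le> k \<and> (\<forall>s>0. fps_nth (F s) k = poly q ((real s)\<^sup>2)))"

lemma even_family_const: "even_family (\<lambda>s. c)"
  unfolding even_family_def
proof
  fix k show "\<exists>q. 2 * degree q \<le> k \<and> (\<forall>s>0::nat. fps_nth c k = poly q ((real s)\<^sup>2))"
    by (rule exI[of _ "[:fps_nth c k:]"]) simp
qed

lemma even_family_mult:
  assumes "even_family F" "even_family G"
  shows "even_family (\<lambda>s. F s * G s)"
proof -
  obtain p q where p: "\<And>k. 2 * degree (p k) \<le> k" "\<And>k s. s > 0 \<Longrightarrow> fps_nth (F s) k = poly (p k) ((real s)\<^sup>2)"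
    and q: "\<And>k. 2 * degree (q k) \<le> k" "\<And>k s. s > 0 \<Longrightarrow> fps_nth (G s) k = poly (q k) ((real s)\<^sup>2)"
    using assms unfolding even_family_def by metis
  show ?thesis unfolding even_family_def
  proof
    fix k
    define u where "u = (\<Sum>i=0..k. p i * q (k - i))"
    have "degree u \<le> k div 2" unfolding u_def
    proof (rule degree_sum_le)
      fix i assume "i \<in> {0..k}"
      then have "2 * (degree (p i) + degree (q (k - i))) \<le> k"
        using p(1)[of i] q(1)[of "k - i"] by auto
      then have "2 * degree (p i * q (k - i)) \<le> k"
        using degree_mult_le[of "p i" "q (k - i)"] by (meson le_trans mult_le_mono2)
      then show "degree (p i * q (k - i)) \<le> k div 2"
        by (metis div_le_mono nonzero_mult_div_cancel_left zero_neq_numeral)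
    qed auto
    moreover have "\<forall>s>0. fps_nth (F s * G s) k = poly u ((real s)\<^sup>2)"
      by (auto simp: fps_mult_nth u_def poly_sum p(2) q(2))
    ultimately show "\<exists>q. 2 * degree q \<le> k \<and> (\<forall>s>0. fps_nth (F s * G s) k = poly q ((real s)\<^sup>2))"
      by (intro exI[of _ u]) auto
  qed
qed

lemma even_family_power: "even_family F \<Longrightarrow> even_family (\<lambda>s. F s ^ n)"
  by (induction n) (auto intro: even_family_mult even_family_const[of 1, simplified])

lemma even_family_sinhc: "even_family (\<lambda>s. fps_sinhc (real s))"
  unfolding even_family_def
proof
  fix k show "\<exists>q. 2 * degree q \<le> k \<and> (\<forall>s>0. fps_nth (fps_sinhc (real s)) k = poly q ((real s)\<^sup>2))"
  proof (cases "even k")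
    case True
    then obtain j where k: "k = 2 * j" by blast
    have "fps_nth (fps_sinhc (real s)) k = poly (monom (1 / (2 ^ k * fact (k + 1))) j) ((real s)\<^sup>2)" for s
      by (simp add: fps_sinhc_def k poly_monom power_divide power_mult)
    then show ?thesis
      by (intro exI[of _ "monom (1 / (2 ^ k * fact (k + 1))) j"])
         (auto simp: k degree_monom_eq)
  next
    case False
    then show ?thesis by (intro exI[of _ 0]) (simp add: fps_sinhc_def)
  qed
qed

text \<open>By \<open>centred_avg_sinhc\<close> the width enters only through
  \<open>fps_sinhc (real s)\<close>, whose coefficients are monomials in the squared width; the
  denominator \<open>fps_sinhc 1\<close> has constant term 1 and does not vary with
  \<open>s\<close>.\<close>

lemma even_family_centred_avg: "even_family (\<lambda>s. centred_avg s ^ n)"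
proof -
  have nz: "fps_nth (fps_sinhc 1) 0 \<noteq> 0" by (simp add: fps_sinhc_def)
  have "even_family (\<lambda>s. fps_sinhc (real s) * inverse (fps_sinhc 1))"
    by (intro even_family_mult even_family_sinhc even_family_const)
  moreover have "centred_avg s = fps_sinhc (real s) * inverse (fps_sinhc 1)" if "s > 0" for s
  proof -
    have "centred_avg s * (fps_sinhc 1 * inverse (fps_sinhc 1)) = fps_sinhc (real s) * inverse (fps_sinhc 1)"
      by (simp only: centred_avg_sinhc[OF that, symmetric] mult.assoc)
    then show ?thesis using nz by (simp add: inverse_mult_eq_1')
  qed
  ultimately have "even_family centred_avg" unfolding even_family_def by auto
  then show ?thesis by (rule even_family_power)
qed

subsection \<open>Extrapolation weights\<close>

lemma Lagrange_interpolation: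
  fixes x :: "nat \<Rightarrow> real"
  assumes "finite A" "inj_on x A" "degree q < card A"
  shows "poly q z = (\<Sum>l\<in>A. (\<Prod>j\<in>A-{l}. (z - x j) / (x l - x j)) * poly q (x l))"
proof -
  define L where "L = (\<Sum>l\<in>A. smult (poly q (x l)) (\<Prod>j\<in>A-{l}. smult (1 / (x l - x j)) [:- x j, 1:]))"
  have pL: "poly L z = (\<Sum>l\<in>A. (\<Prod>j\<in>A-{l}. (z - x j) / (x l - x j)) * poly q (x l))" for z
    unfolding L_def
    by (auto simp: poly_sum poly_prod mult.commute diff_divide_distrib intro!: sum.cong prod.cong)
  have "q = L"
  proof (rule poly_eqI_degree[of "x ` A"])
    fix y assume "y \<in> x ` A"
    then obtain k where k: "k \<in> A" "y = x k" by auto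
    have "poly L y = (\<Sum>l\<in>A. if l = k then poly q (x k) else 0)"
      unfolding pL
    proof (rule sum.cong)
      fix l assume l: "l \<in> A"
      show "(\<Prod>j\<in>A-{l}. (y - x j) / (x l - x j)) * poly q (x l) = (if l = k then poly q (x k) else 0)"
      proof (cases "l = k")
        case True
        have "(\<Prod>j\<in>A-{l}. (y - x j) / (x l - x j)) = 1"
          by (rule prod.neutral) (use True k l assms(2) in \<open>auto dest: inj_onD\<close>)
        then show ?thesis using True by simp
      next
        case False
        then have "(\<Prod>j\<in>A-{l}. (y - x j) / (x l - x j)) = 0"
          using k assms(1) by (intro prod_zero) auto
        then show ?thesis using False by simp
      qed
    qed simp
    also have "\<dots> = poly q y" using k assms(1) by simp
    finally show "poly q y = poly L y" by simp
  next
    show "degree q < card (x ` A)" using assms by (simp add: card_image)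
  next
    have "degree L \<le> card A - 1" unfolding L_def
    proof (rule degree_sum_le)
      fix l assume l: "l \<in> A"
      have "degree (\<Prod>j\<in>A-{l}. smult (1 / (x l - x j)) [:- x j, 1:])
          \<le> sum (degree \<circ> (\<lambda>j. smult (1 / (x l - x j)) [:- x j, 1:])) (A - {l})"
        by (rule degree_prod_sum_le) (use assms in auto)
      also have "\<dots> \<le> (\<Sum>j\<in>A-{l}. 1)"
        by (rule sum_mono) auto
      also have "\<dots> = card A - 1" using l assms by simp
      finally show "degree (smult (poly q (x l)) (\<Prod>j\<in>A-{l}. smult (1 / (x l - x j)) [:- x j, 1:])) \<le> card A - 1"
        using degree_smult_le order.trans by blast
    qed (use assms in auto)
    then show "degree L < card (x ` A)" using assms by (simp add: card_image)
  qed
  then have "poly q z = poly L z" by (rule arg_cong)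
  then show ?thesis unfolding pL .
qed

text \<open>The central binomial coefficient is the largest: binomial(2n, n + l) is at most
  binomial(2n, n). The inductive step compares n - l with n + l + 1.\<close>

lemma fact_square_le: "l \<le> n \<Longrightarrow> (fact n)\<^sup>2 \<le> (fact (n - l) * fact (n + l) :: real)"
proof (induction l)
  case (Suc l)
  have e: "fact (n - l) = real (n - l) * fact (n - Suc l)"
    using Suc.prems by (simp add: Suc_diff_Suc fact_reduce)
  have "(fact n)\<^sup>2 \<le> (fact (n - l) * fact (n + l) :: real)" using Suc by simp
  also have "\<dots> = fact (n - Suc l) * (real (n - l) * fact (n + l))" by (simp add: e)
  also have "\<dots> \<le> fact (n - Suc l) * (real (Suc (n + l)) * fact (n + l))"
    by (intro mult_left_mono mult_right_mono) auto
  finally show ?case by simp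
qed (simp add: power2_eq_square)

text \<open>Each factor splits as (l - j)(l + j); the two products are (l - 1)! / (l - 1 - i)! and
  (l + i)! / l!, with denominators cleared.\<close>

lemma prod_square_ratio_aux:
  assumes "i < l"
  shows "(\<Prod>j=1..i. (real l)\<^sup>2 - (real j)\<^sup>2) * (fact (l - 1 - i) * fact l) = fact (l - 1) * (fact (l + i) :: real)"
  using assms
proof (induction i)
  case (Suc i)
  have e: "fact (l - 1 - i) = real (l - Suc i) * fact (l - 1 - Suc i)"
    using Suc.prems by (subst fact_reduce) (auto simp: )
  have r: "(real l)\<^sup>2 - (real (Suc i))\<^sup>2 = real (l - Suc i) * real (Suc (l + i))"
    using Suc.prems by (simp add: power2_eq_square algebra_simps of_nat_diff)
  have "(\<Prod>j=1..Suc i. (real l)\<^sup>2 - (real j)\<^sup>2) * (fact (l - 1 - Suc i) * fact l)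
     = ((\<Prod>j=1..i. (real l)\<^sup>2 - (real j)\<^sup>2) * (fact (l - 1 - i) * fact l)) * real (Suc (l + i))"
    by (simp only: prod.nat_ivl_Suc' r e) (simp add: r)
  also have "\<dots> = fact (l - 1) * fact (l + Suc i)"
    using Suc by simp
  finally show ?case .
qed simp

text \<open>The product is the absolute value at 0 of a Lagrange basis polynomial for the nodes j^2.
  The induction starts at n = l, where only indices below l occur; each later index m contributes
  m^2 / D with D = (m - l)(m + l), while the factorials gain exactly D.\<close>

lemma prod_square_ratio_eq:
  assumes "1 \<le> l" "l \<le> n"
  shows "(\<Prod>j\<in>{1..n}-{l}. (real j)\<^sup>2 / \<bar>(real j)\<^sup>2 - (real l)\<^sup>2\<bar>) * (fact (n - l) * fact (n + l)) = 2 * (fact n)\<^sup>2"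
  using assms(2)
proof (induction n rule: dec_induct)
  case base
  have pos: "(real j)\<^sup>2 < (real l)\<^sup>2" if "j \<in> {1..l-1}" for j
    using that assms by (intro power_strict_mono) auto
  have s: "{1..l} - {l} = {1..l-1}" using assms by auto
  have "(\<Prod>j\<in>{1..l-1}. (real j)\<^sup>2 / \<bar>(real j)\<^sup>2 - (real l)\<^sup>2\<bar>)
      = (\<Prod>j\<in>{1..l-1}. (real j)\<^sup>2 / ((real l)\<^sup>2 - (real j)\<^sup>2))"
    using pos by (intro prod.cong) (auto simp: abs_if)
  also have "\<dots> = (\<Prod>j\<in>{1..l-1}. real j)\<^sup>2 / (\<Prod>j\<in>{1..l-1}. (real l)\<^sup>2 - (real j)\<^sup>2)"
    by (simp add: prod_dividef prod_power_distrib)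
  also have "(\<Prod>j\<in>{1..l-1}. real j) = fact (l - 1)" by (simp add: fact_prod)
  finally have 1: "(\<Prod>j\<in>{1..l-1}. (real j)\<^sup>2 / \<bar>(real j)\<^sup>2 - (real l)\<^sup>2\<bar>)
      = (fact (l - 1))\<^sup>2 / (\<Prod>j\<in>{1..l-1}. (real l)\<^sup>2 - (real j)\<^sup>2)" .
  have 2: "(\<Prod>j=1..l-1. (real l)\<^sup>2 - (real j)\<^sup>2) * fact l = fact (l - 1) * fact (2 * l - 1)"
    using prod_square_ratio_aux[of "l - 1" l] assms by (simp add: mult_2[of l])
  have 3: "(\<Prod>j=1..l-1. (real l)\<^sup>2 - (real j)\<^sup>2) \<noteq> 0"
    using pos by (auto simp: prod_zero_iff)
  have 4: "fact (2 * l) = (2 * real l) * fact (2 * l - 1)" "fact l = real l * fact (l - 1)"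
    using assms by (subst fact_reduce; simp)+
  let ?P = "\<Prod>j=1..l-1. (real l)\<^sup>2 - (real j)\<^sup>2"
  have "(fact (l - 1))\<^sup>2 / ?P * fact (2 * l) = (fact (l - 1) * (fact (l - 1) * fact (2 * l - 1))) * (2 * real l) / ?P"
    by (simp add: 4 power2_eq_square)
  also have "\<dots> = fact (l - 1) * fact l * (2 * real l)"
    unfolding 2[symmetric] using 3 by simp
  also have "\<dots> = 2 * (fact l)\<^sup>2" by (simp add: 4(2) power2_eq_square)
  finally show ?case unfolding s 1 mult_2[of l] by simp
next
  case (step n)
  have s: "{1..Suc n} - {l} = insert (Suc n) ({1..n} - {l})" using step.hyps by auto
  have ln: "l \<le> n" using step.hyps by simp
  have lt: "(real l)\<^sup>2 < (real (Suc n))\<^sup>2"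
    by (rule power_strict_mono) (use ln in auto)
  have d: "(real (Suc n))\<^sup>2 - (real l)\<^sup>2 = real (Suc n - l) * real (Suc n + l)"
    using ln by (simp add: power2_eq_square algebra_simps of_nat_diff)
  have f: "fact (Suc n - l) = real (Suc n - l) * fact (n - l)" "fact (Suc n + l) = real (Suc n + l) * fact (n + l)"
    using ln by (auto simp: Suc_diff_le)
  define X where "X = (\<Prod>j\<in>{1..n}-{l}. (real j)\<^sup>2 / \<bar>(real j)\<^sup>2 - (real l)\<^sup>2\<bar>)"
  define D where "D = (real (Suc n))\<^sup>2 - (real l)\<^sup>2"
  have Dpos: "D > 0" unfolding D_def using lt by simp
  have De: "D = real (Suc n - l) * real (Suc n + l)" unfolding D_def by (rule d)
  have "(\<Prod>j\<in>{1..Suc n}-{l}. (real j)\<^sup>2 / \<bar>(real j)\<^sup>2 - (real l)\<^sup>2\<bar>) * (fact (Suc n - l) * fact (Suc n + l))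
    = (real (Suc n))\<^sup>2 / D * X * (D * (fact (n - l) * fact (n + l)))"
  proof -
    have "fact (Suc n - l) * fact (Suc n + l) = D * (fact (n - l) * fact (n + l))"
      unfolding f De by (simp only: mult_ac)
    moreover have "(\<Prod>j\<in>{1..Suc n}-{l}. (real j)\<^sup>2 / \<bar>(real j)\<^sup>2 - (real l)\<^sup>2\<bar>) = (real (Suc n))\<^sup>2 / D * X"
    proof -
      have "(\<Prod>j\<in>insert (Suc n) ({1..n}-{l}). (real j)\<^sup>2 / \<bar>(real j)\<^sup>2 - (real l)\<^sup>2\<bar>)
          = (real (Suc n))\<^sup>2 / \<bar>D\<bar> * X"
        unfolding X_def D_def by (rule prod.insert; simp)
      then show ?thesis unfolding s abs_of_pos[OF Dpos] .
    qed
    ultimately show ?thesis by (simp only:)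
  qed
  also have "\<dots> = (real (Suc n))\<^sup>2 * (X * (fact (n - l) * fact (n + l)))"
  proof -
    have "c / D * X * (D * F) = c * (X * F)" if "D \<noteq> 0" for c D X F :: real
      using that by (simp add: field_simps)
    from this[of D "(real (Suc n))\<^sup>2" X] show ?thesis using Dpos by blast
  qed
  also have "\<dots> = 2 * (fact (Suc n))\<^sup>2"
  proof -
    have "X * (fact (n - l) * fact (n + l)) = 2 * (fact n)\<^sup>2"
      using step.IH unfolding X_def .
    moreover have "a\<^sup>2 * (2 * b\<^sup>2) = 2 * (a * b)\<^sup>2" for a b :: real
      by (simp add: power_mult_distrib)
    moreover have "fact (Suc n) = real (Suc n) * fact n" by (rule fact_Suc)
    ultimately show ?thesis by metis
  qed
  finally show ?case .
qed

lemma prod_square_ratio_le: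
  assumes "1 \<le> l" "l \<le> n"
  shows "(\<Prod>j\<in>{1..n}-{l}. (real j)\<^sup>2 / \<bar>(real j)\<^sup>2 - (real l)\<^sup>2\<bar>) \<le> 2"
proof -
  define F :: real where "F = fact (n - l) * fact (n + l)"
  define X where "X = (\<Prod>j\<in>{1..n}-{l}. (real j)\<^sup>2 / \<bar>(real j)\<^sup>2 - (real l)\<^sup>2\<bar>)"
  have "X * F \<le> 2 * F"
    using prod_square_ratio_eq[OF assms] fact_square_le[OF assms(2)] by (simp add: X_def F_def)
  moreover have "F > 0" by (simp add: F_def)
  ultimately show ?thesis unfolding X_def by simp
qed

lemma exp_ge_power_div: "y \<ge> 0 \<Longrightarrow> k > 0 \<Longrightarrow> (y / real k) ^ k \<le> exp y"
proof -
  assume y: "y \<ge> 0" and k: "k > 0"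
  have "(y / real k) ^ k \<le> exp (y / real k) ^ k"
    by (rule power_mono) (use y exp_ge_add_one_self[of "y / real k"] in \<open>linarith, simp\<close>)
  also have "\<dots> = exp y" using k by (simp add: exp_of_nat_mult[symmetric])
  finally show ?thesis .
qed

text \<open>With \<open>v\<close> the integer square root of \<open>l\<close>, every j below v^2 has
  root at most v - 1. These v^2 - 1 factors, each at most exp(-2/v), multiply to at most exp(4 - 2(v
  + 1)), which decays faster than any power of l. The constant 16 comes from exp(y) \<ge> (y/4)^4 at
  y = 2(v + 1).\<close>

lemma prod_floor_sqrt_le:
  assumes "1 \<le> l"
  shows "(\<Prod>j=1..<l. (real (floor_sqrt j) / real (floor_sqrt l))\<^sup>2) \<le> 16 * exp 4 / (real l)\<^sup>2"
proof -
  define v where "v = floor_sqrt l"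
  have v: "v \<ge> 1" "v\<^sup>2 \<le> l" "l < (v + 1)\<^sup>2"
    using assms Suc_floor_sqrt_power2_gt[of l] floor_sqrt_power2_le[of l]
    by (auto simp: v_def Suc_le_eq simp del: floor_sqrt_power2_le)
  have "(\<Prod>j=1..<l. (real (floor_sqrt j) / real v)\<^sup>2) \<le> (\<Prod>j=1..<l. if j < v\<^sup>2 then ((real v - 1) / real v)\<^sup>2 else 1)"
  proof (rule prod_mono, safe)
    fix j assume j: "j \<in> {1..<l}"
    show "(real (floor_sqrt j) / real v)\<^sup>2 \<le> (if j < v\<^sup>2 then ((real v - 1) / real v)\<^sup>2 else 1)"
    proof (cases "j < v\<^sup>2")
      case True
      then have "floor_sqrt j < v" using le_floor_sqrt_iff[of v j] by linarith
      then show ?thesis using True v by (auto intro!: power_mono divide_right_mono)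
    next
      case False
      have "floor_sqrt j \<le> v" unfolding v_def using j by (intro mono_floor_sqrt') auto
      then show ?thesis using False v by (auto intro!: power_le_one)
    qed
  qed auto
  also have "\<dots> = (\<Prod>j\<in>{1..<v\<^sup>2}. ((real v - 1) / real v)\<^sup>2)"
    by (rule prod.mono_neutral_cong_right) (use v in auto)
  also have "\<dots> = (((real v - 1) / real v)\<^sup>2) ^ (v\<^sup>2 - 1)" by simp
  also have "\<dots> \<le> (exp (- 2 / real v)) ^ (v\<^sup>2 - 1)"
  proof (rule power_mono)
    have "(real v - 1) / real v \<le> exp (- 1 / real v)"
      using exp_ge_add_one_self[of "- 1 / real v"] v by (simp add: field_simps)
    then have "((real v - 1) / real v)\<^sup>2 \<le> (exp (- 1 / real v))\<^sup>2"
      using v by (intro power_mono) auto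
    also have "\<dots> = exp (- 2 / real v)" by (simp add: power2_eq_square exp_add[symmetric])
    finally show "((real v - 1) / real v)\<^sup>2 \<le> exp (- 2 / real v)" .
  qed auto
  also have "\<dots> = exp (- 2 * (real (v\<^sup>2 - 1) / real v))" by (simp add: exp_of_nat_mult[symmetric])
  also have "\<dots> \<le> exp (4 - 2 * (real v + 1))"
  proof -
    have "real (v\<^sup>2 - 1) = (real v)\<^sup>2 - 1" using v by (simp add: of_nat_diff Suc_le_eq)
    then have "real (v\<^sup>2 - 1) / real v \<ge> real v - 1"
      using v by (simp add: field_simps power2_eq_square)
    then show ?thesis by simp
  qed
  also have "\<dots> = exp 4 / exp (2 * (real v + 1))" by (rule exp_diff)
  also have "\<dots> \<le> exp 4 / ((real v + 1) ^ 4 / 16)"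
  proof (rule divide_left_mono)
    have "(2 * (real v + 1) / real 4) ^ 4 \<le> exp (2 * (real v + 1))"
      by (rule exp_ge_power_div) auto
    moreover have "(2 * (real v + 1) / real 4) = (real v + 1) / 2" by simp
    moreover have "((real v + 1) / 2) ^ 4 = (real v + 1) ^ 4 / 16" by (simp add: power_divide)
    ultimately show "(real v + 1) ^ 4 / 16 \<le> exp (2 * (real v + 1))" by (simp only:)
  qed auto
  also have "\<dots> = 16 * exp 4 / (real v + 1) ^ 4" by simp
  also have "\<dots> \<le> 16 * exp 4 / (real l)\<^sup>2"
  proof (rule divide_left_mono)
    have "real l \<le> (real v + 1)\<^sup>2" using v(3) by (metis less_imp_le of_nat_1 of_nat_add of_nat_le_iff of_nat_power)
    then have "(real l)\<^sup>2 \<le> ((real v + 1)\<^sup>2)\<^sup>2" by (rule power_mono) auto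
    then show "(real l)\<^sup>2 \<le> (real v + 1) ^ 4" by simp
    show "0 < (real v + 1) ^ 4 * (real l)\<^sup>2" using assms by simp
  qed auto
  finally show ?thesis by (simp add: v_def)
qed

lemma sum_inverse_squares_le: "(\<Sum>l=1..n. 1 / (real l)\<^sup>2) \<le> 2"
proof -
  have "(\<Sum>l=1..n. 1 / (real l)\<^sup>2) \<le> 2 - 1 / real n" if "n \<ge> 1" for n
    using that
  proof (induction n rule: dec_induct)
    case (step n)
    have "1 / (real (Suc n))\<^sup>2 \<le> 1 / (real n * real (Suc n))"
      using step by (intro divide_left_mono) (auto simp: power2_eq_square)
    also have "\<dots> = 1 / real n - 1 / real (Suc n)" using step by (simp add: field_simps)
    finally show ?case using step by simp
  qed simp
  then have "n \<ge> 1 \<Longrightarrow> ?thesis" by (smt (verit) divide_nonneg_nonneg of_nat_0_le_iff)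
  then show ?thesis by (cases "n = 0") auto
qed

text \<open>Nodes growing like \<open>l\<^sup>2\<close> would only give weights of total size \<open>\<surd>n\<close>; the growth
  \<open>l\<^sup>3\<close> of \<open>(node \<sigma> l)\<^sup>2\<close> makes the extrapolation weights summable.\<close>

definition node :: "nat \<Rightarrow> nat \<Rightarrow> nat" where
  "node \<sigma> l = \<sigma> * (l * floor_sqrt l)"

text \<open>The Lagrange basis polynomial of the squared nodes, evaluated at 1, the squared width of
  the identity filter.\<close>

definition extrapolation_weight :: "nat \<Rightarrow> nat \<Rightarrow> nat \<Rightarrow> real" where
  "extrapolation_weight \<sigma> n l =
     (\<Prod>j\<in>{1..n}-{l}. (1 - (real (node \<sigma> j))\<^sup>2) / ((real (node \<sigma> l))\<^sup>2 - (real (node \<sigma> j))\<^sup>2))"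

lemma node_strict_mono: "\<sigma> > 0 \<Longrightarrow> j < l \<Longrightarrow> node \<sigma> j < node \<sigma> l"
proof -
  assume s: "\<sigma> > 0" and jl: "j < l"
  have "j * floor_sqrt j \<le> j * floor_sqrt l"
    using jl by (intro mult_le_mono2 mono_floor_sqrt') simp
  also have "\<dots> < l * floor_sqrt l"
    using jl floor_sqrt_greater_zero_iff[of l] by (intro mult_strict_right_mono) auto
  finally show ?thesis using s by (simp add: node_def)
qed

lemma node_ge: "l \<ge> 1 \<Longrightarrow> node \<sigma> l \<ge> \<sigma>"
proof -
  assume "l \<ge> 1"
  moreover from this have "floor_sqrt l \<ge> 1" using floor_sqrt_greater_zero_iff[of l] by linarith
  ultimately have "l * floor_sqrt l \<ge> 1" by simp
  then show ?thesis by (simp add: node_def)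
qed

text \<open>The first factor is what nodes proportional to j would give. The integer square roots
  improve it by the square of their ratio for j < l; for j > l they also help, but that gain is
  dropped. The 1 in the numerator only lowers its absolute value, because all nodes exceed
  1.\<close>

lemma extrapolation_factor_le:
  assumes "\<sigma> \<ge> 2" "1 \<le> l" "1 \<le> j" "j \<noteq> l"
  shows "\<bar>(1 - (real (node \<sigma> j))\<^sup>2) / ((real (node \<sigma> l))\<^sup>2 - (real (node \<sigma> j))\<^sup>2)\<bar>
    \<le> (real j)\<^sup>2 / \<bar>(real j)\<^sup>2 - (real l)\<^sup>2\<bar>
       * (if j < l then (real (floor_sqrt j) / real (floor_sqrt l))\<^sup>2 else 1)"
proof -
  have ge: "node \<sigma> i \<ge> 2" if "i \<ge> 1" for i using node_ge[OF that, of \<sigma>] assms by linarith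
  have ge1: "(real (node \<sigma> i))\<^sup>2 \<ge> 1" if "i \<ge> 1" for i
    using ge[OF that] by (intro one_le_power) linarith
  define a b where "a = real (floor_sqrt j)" and "b = real (floor_sqrt l)"
  define sg x y where "sg = real \<sigma>" and "x = real j" and "y = real l"
  have pos: "a > 0" "b > 0" "sg > 0" "x > 0" "y > 0"
    using assms by (auto simp: a_def b_def sg_def x_def y_def)
  have nj: "(real (node \<sigma> j))\<^sup>2 = sg\<^sup>2 * (x\<^sup>2 * a\<^sup>2)" and nl: "(real (node \<sigma> l))\<^sup>2 = sg\<^sup>2 * (y\<^sup>2 * b\<^sup>2)"
    by (auto simp: node_def a_def b_def sg_def x_def y_def power_mult_distrib)
  show ?thesis
  proof (cases "j < l")
    case True
    have ab: "a \<le> b" using True mono_floor_sqrt'[of j l] by (simp add: a_def b_def)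
    have xy: "x\<^sup>2 < y\<^sup>2" using True by (auto simp: x_def y_def intro!: power_strict_mono)
    have lt: "(real (node \<sigma> j))\<^sup>2 < (real (node \<sigma> l))\<^sup>2"
      using node_strict_mono[OF _ True, of \<sigma>] assms by (intro power_strict_mono) auto
    have "\<bar>(1 - (real (node \<sigma> j))\<^sup>2) / ((real (node \<sigma> l))\<^sup>2 - (real (node \<sigma> j))\<^sup>2)\<bar>
        = ((real (node \<sigma> j))\<^sup>2 - 1) / ((real (node \<sigma> l))\<^sup>2 - (real (node \<sigma> j))\<^sup>2)"
    proof -
      have "\<bar>1 - (real (node \<sigma> j))\<^sup>2\<bar> = (real (node \<sigma> j))\<^sup>2 - 1"
        "\<bar>(real (node \<sigma> l))\<^sup>2 - (real (node \<sigma> j))\<^sup>2\<bar> = (real (node \<sigma> l))\<^sup>2 - (real (node \<sigma> j))\<^sup>2"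
        using ge1[OF assms(3)] lt by auto
      then show ?thesis by (simp only: abs_divide)
    qed
    also have "\<dots> \<le> (real (node \<sigma> j))\<^sup>2 / ((real (node \<sigma> l))\<^sup>2 - (real (node \<sigma> j))\<^sup>2)"
      by (intro divide_right_mono) (use lt in linarith)+
    also have "\<dots> = (x\<^sup>2 * a\<^sup>2) / (y\<^sup>2 * b\<^sup>2 - x\<^sup>2 * a\<^sup>2)"
      using pos unfolding nj nl right_diff_distrib[symmetric] by simp
    also have "\<dots> \<le> (x\<^sup>2 * a\<^sup>2) / (y\<^sup>2 * b\<^sup>2 - x\<^sup>2 * b\<^sup>2)"
    proof (rule divide_left_mono)
      have "x\<^sup>2 * a\<^sup>2 \<le> x\<^sup>2 * b\<^sup>2" using ab pos by (intro mult_left_mono power_mono) auto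
      then show "y\<^sup>2 * b\<^sup>2 - x\<^sup>2 * b\<^sup>2 \<le> y\<^sup>2 * b\<^sup>2 - x\<^sup>2 * a\<^sup>2" by simp
      have p: "y\<^sup>2 * b\<^sup>2 - x\<^sup>2 * b\<^sup>2 > 0" using xy pos by simp
      then show "0 < (y\<^sup>2 * b\<^sup>2 - x\<^sup>2 * a\<^sup>2) * (y\<^sup>2 * b\<^sup>2 - x\<^sup>2 * b\<^sup>2)"
        using \<open>x\<^sup>2 * a\<^sup>2 \<le> x\<^sup>2 * b\<^sup>2\<close> by (intro mult_pos_pos) linarith+
    qed auto
    also have "\<dots> = x\<^sup>2 / \<bar>x\<^sup>2 - y\<^sup>2\<bar> * (a / b)\<^sup>2"
    proof -
      have "y\<^sup>2 * b\<^sup>2 - x\<^sup>2 * b\<^sup>2 = (y\<^sup>2 - x\<^sup>2) * b\<^sup>2" by (simp add: left_diff_distrib)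
      then show ?thesis using xy by (simp add: power_divide)
    qed
    finally show ?thesis using True by (simp add: a_def b_def x_def y_def)
  next
    case False
    then have lj: "l < j" using assms by simp
    have ab: "b \<le> a" using lj mono_floor_sqrt'[of l j] by (simp add: a_def b_def)
    have xy: "y\<^sup>2 < x\<^sup>2" using lj by (auto simp: x_def y_def intro!: power_strict_mono)
    have lt: "(real (node \<sigma> l))\<^sup>2 < (real (node \<sigma> j))\<^sup>2"
      using node_strict_mono[OF _ lj, of \<sigma>] assms by (intro power_strict_mono) auto
    have "\<bar>(1 - (real (node \<sigma> j))\<^sup>2) / ((real (node \<sigma> l))\<^sup>2 - (real (node \<sigma> j))\<^sup>2)\<bar>
        = ((real (node \<sigma> j))\<^sup>2 - 1) / ((real (node \<sigma> j))\<^sup>2 - (real (node \<sigma> l))\<^sup>2)"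
    proof -
      have "\<bar>1 - (real (node \<sigma> j))\<^sup>2\<bar> = (real (node \<sigma> j))\<^sup>2 - 1"
        "\<bar>(real (node \<sigma> l))\<^sup>2 - (real (node \<sigma> j))\<^sup>2\<bar> = (real (node \<sigma> j))\<^sup>2 - (real (node \<sigma> l))\<^sup>2"
        using ge1[OF assms(3)] lt by auto
      then show ?thesis by (simp only: abs_divide)
    qed
    also have "\<dots> \<le> x\<^sup>2 / (x\<^sup>2 - y\<^sup>2)"
    proof -
      have "x\<^sup>2 * (sg\<^sup>2 * (y\<^sup>2 * b\<^sup>2)) \<le> y\<^sup>2 * (sg\<^sup>2 * (x\<^sup>2 * a\<^sup>2))"
      proof -
        have "sg\<^sup>2 * (x\<^sup>2 * y\<^sup>2) * b\<^sup>2 \<le> sg\<^sup>2 * (x\<^sup>2 * y\<^sup>2) * a\<^sup>2"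
          using ab pos by (intro mult_left_mono power_mono) auto
        then show ?thesis by (simp only: mult_ac)
      qed
      then have "((real (node \<sigma> j))\<^sup>2 - 1) * (x\<^sup>2 - y\<^sup>2) \<le> x\<^sup>2 * ((real (node \<sigma> j))\<^sup>2 - (real (node \<sigma> l))\<^sup>2)"
        using xy unfolding nj nl by (simp add: algebra_simps)
      then show ?thesis using xy lt by (simp add: divide_le_eq pos_le_divide_eq mult.commute)
    qed
    finally show ?thesis using False xy by (simp add: x_def y_def abs_if)
  qed
qed

lemma extrapolation_weight_le:
  assumes "\<sigma> \<ge> 2" "1 \<le> l" "l \<le> n"
  shows "\<bar>extrapolation_weight \<sigma> n l\<bar> \<le> 32 * exp 4 / (real l)\<^sup>2"
proof -
  define g where "g j = (if j < l then (real (floor_sqrt j) / real (floor_sqrt l))\<^sup>2 else 1)" for j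
  have "\<bar>extrapolation_weight \<sigma> n l\<bar>
      \<le> (\<Prod>j\<in>{1..n}-{l}. (real j)\<^sup>2 / \<bar>(real j)\<^sup>2 - (real l)\<^sup>2\<bar> * g j)"
    unfolding extrapolation_weight_def abs_prod g_def
    by (intro prod_mono conjI extrapolation_factor_le) (use assms in auto)
  also have "\<dots> = (\<Prod>j\<in>{1..n}-{l}. (real j)\<^sup>2 / \<bar>(real j)\<^sup>2 - (real l)\<^sup>2\<bar>) * (\<Prod>j\<in>{1..n}-{l}. g j)"
    by (rule prod.distrib)
  also have "(\<Prod>j\<in>{1..n}-{l}. g j) = (\<Prod>j=1..<l. (real (floor_sqrt j) / real (floor_sqrt l))\<^sup>2)"
    unfolding g_def by (rule prod.mono_neutral_cong_right) (use assms in auto)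
  also have "(\<Prod>j\<in>{1..n}-{l}. (real j)\<^sup>2 / \<bar>(real j)\<^sup>2 - (real l)\<^sup>2\<bar>)
       * (\<Prod>j=1..<l. (real (floor_sqrt j) / real (floor_sqrt l))\<^sup>2) \<le> 2 * (16 * exp 4 / (real l)\<^sup>2)"
    by (intro mult_mono prod_square_ratio_le prod_floor_sqrt_le assms prod_nonneg) auto
  finally show ?thesis by simp
qed

lemma sum_extrapolation_weight_le:
  assumes "\<sigma> \<ge> 2"
  shows "(\<Sum>l=1..n. \<bar>extrapolation_weight \<sigma> n l\<bar>) \<le> 64 * exp 4"
proof -
  have "(\<Sum>l=1..n. \<bar>extrapolation_weight \<sigma> n l\<bar>) \<le> (\<Sum>l=1..n. 32 * exp 4 * (1 / (real l)\<^sup>2))"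
    using extrapolation_weight_le[OF assms] by (intro sum_mono) auto
  also have "\<dots> \<le> 32 * exp 4 * 2"
    unfolding sum_distrib_left[symmetric] by (intro mult_left_mono sum_inverse_squares_le) auto
  finally show ?thesis by simp
qed

text \<open>The coefficient of order \<open>k\<close> is a polynomial of degree at most k/2 < n in
  the squared width, so interpolation at the n nodes is exact; at width 1 it is the coefficient of
  the constant series 1.\<close>

lemma extrapolation_centred_avg:
  assumes "\<sigma> \<ge> 2" "k < 2 * n"
  shows "(\<Sum>l=1..n. extrapolation_weight \<sigma> n l * fps_nth (centred_avg (node \<sigma> l) ^ N) k) = of_bool (k = 0)"
proof -
  obtain q where q: "2 * degree q \<le> k" "\<And>s. s > 0 \<Longrightarrow> fps_nth (centred_avg s ^ N) k = poly q ((real s)\<^sup>2)"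
    using even_family_centred_avg[of N] unfolding even_family_def by blast
  have inj: "inj_on (\<lambda>l. (real (node \<sigma> l))\<^sup>2) {1..n}"
  proof (rule linorder_inj_onI)
    fix a b :: nat assume "a < b"
    then have "real (node \<sigma> a) < real (node \<sigma> b)" using node_strict_mono[of \<sigma> a b] assms by simp
    then show "(real (node \<sigma> a))\<^sup>2 \<noteq> (real (node \<sigma> b))\<^sup>2" by simp
  qed auto
  have "of_bool (k = 0) = fps_nth (centred_avg 1 ^ N) k"
    by (simp add: centred_avg_1)
  also have "\<dots> = poly q 1" using q(2)[of 1] by simp
  also have "\<dots> = (\<Sum>l=1..n. extrapolation_weight \<sigma> n l * poly q ((real (node \<sigma> l))\<^sup>2))"
    unfolding extrapolation_weight_def
    by (rule Lagrange_interpolation[OF _ inj]) (use q assms in auto)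
  also have "\<dots> = (\<Sum>l=1..n. extrapolation_weight \<sigma> n l * fps_nth (centred_avg (node \<sigma> l) ^ N) k)"
  proof (rule sum.cong)
    fix l assume "l \<in> {1..n}"
    then have "node \<sigma> l > 0" using node_ge[of l \<sigma>] assms by auto
    then show "extrapolation_weight \<sigma> n l * poly q ((real (node \<sigma> l))\<^sup>2)
      = extrapolation_weight \<sigma> n l * fps_nth (centred_avg (node \<sigma> l) ^ N) k" using q(2) by simp
  qed simp
  finally show ?thesis by simp
qed

subsection \<open>Inverting the second characteristic polynomial\<close>

lemma floor_sqrt_le_sqrt: "real (floor_sqrt n) \<le> sqrt (real n)"
proof (rule real_le_rsqrt)
  have "real ((floor_sqrt n)\<^sup>2) \<le> real n" by (simp only: of_nat_le_iff floor_sqrt_power2_le)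
  then show "(real (floor_sqrt n))\<^sup>2 \<le> real n" by simp
qed

lemma fps_power_nth_less: "fps_nth f 0 = 0 \<Longrightarrow> k < n \<Longrightarrow> fps_nth (f ^ n) k = 0" for f :: "real fps"
  using startsby_zero_power_prefix by blast

lemma sum_half_powers_le: "(\<Sum>k<n. (1 / 2 :: real) ^ k) \<le> 2"
proof -
  have "(\<Sum>k<n. (1 / 2 :: real) ^ k) = 2 - 2 * (1 / 2) ^ n" by (induction n) auto
  then show ?thesis by simp
qed

text \<open>The coefficient \<open>P j\<close> belongs to the shift j - J, so \<open>J\<close>
  admits shifts into the past. \<open>C\<close> bounds the amplification of the residual and
  \<open>S\<close> the length of the time window; neither may depend on \<open>n\<close>, which
  grows as the step size shrinks.\<close>

lemma local_inverse_filter: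
  fixes \<beta> :: "nat \<Rightarrow> real"
  assumes \<beta>: "(\<Sum>m\<le>M. \<beta> m) = 1"
  obtains C S :: real where "C > 0" "S > 0"
    "\<And>n. n \<ge> 1 \<Longrightarrow> \<exists>P J d. real d \<le> S * (real n ^ 2 * sqrt (real n)) \<and> real J \<le> S * (real n ^ 2 * sqrt (real n)) \<and>
       (\<Sum>j\<le>d. \<bar>P j\<bar>) \<le> C \<and>
       (\<forall>k<2*n. fps_nth ((\<Sum>j\<le>d. fps_const (P j) * fps_exp (real j - real J)) *
           (\<Sum>m\<le>M. fps_const (\<beta> m) * fps_exp (real m))) k = of_bool (k = 0))"
proof -
  define b where "b = (\<Sum>m\<le>M. monom (\<beta> m) m)"
  have "poly (1 - b) 1 = 0" using \<beta> by (simp add: b_def poly_sum poly_monom)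
  then obtain c where c: "1 - b = [:-1, 1:] * c"
    by (metis poly_eq_0_iff_dvd dvdE)
  obtain s0 :: nat where s0: "poly_l1 c < real s0" using reals_Archimedean2 by blast
  \<comment> \<open>For every s \<ge> \<sigma> this makes (2 / s) \<open>s0\<close> at most 1/2, the
    ratio of the geometric series in \<open>filt_l1\<close>; the summand 2 keeps all nodes above
    1.\<close>
  define \<sigma> where "\<sigma> = 4 * s0 + 2"
  have \<sigma>: "\<sigma> \<ge> 2" by (simp add: \<sigma>_def)
  have degb: "degree (1 - b) \<le> M"
    by (intro degree_diff_le) (auto simp: b_def intro!: degree_sum_le order.trans[OF degree_monom_le])
  \<comment> \<open>The 2n averages provide one for each factor of (1 - b)^k with k < 2n. The mean
    position of \<open>avg s ^ (2 * n)\<close> is n (s - 1), so the monomial moves the centres of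
    all these filters to \<open>J\<close>.\<close>
  define filt where "filt n s J = monom 1 (J - n * (s - 1)) * avg s ^ (2 * n) * (\<Sum>k<2*n. (1 - b) ^ k)" for n s J
  have half: "poly_l1 (avg s * (1 - b)) \<le> 1 / 2" if "s \<ge> \<sigma>" for s
  proof -
    have "poly_l1 (avg s * (1 - b)) = poly_l1 (([:-1, 1:] * avg s) * c)"
      by (simp only: c mult_ac)
    also have "\<dots> \<le> poly_l1 ([:-1, 1:] * avg s) * poly_l1 c" by (rule poly_l1_mult)
    also have "\<dots> \<le> 2 / real s * real s0"
      by (intro mult_mono poly_l1_avg_difference) (use s0 in auto)
    also have "\<dots> \<le> 1 / 2" using that by (simp add: \<sigma>_def field_simps)
    finally show ?thesis .
  qed
  have filt_l1: "poly_l1 (filt n s J) \<le> 2" if "s \<ge> \<sigma>" for n s J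
  proof -
    have "filt n s J = (\<Sum>k<2*n. monom 1 (J - n * (s - 1)) * (avg s ^ (2 * n - k) * (avg s * (1 - b)) ^ k))"
      unfolding filt_def sum_distrib_left
    proof (rule sum.cong)
      fix k assume "k \<in> {..<2*n}"
      then have "avg s ^ (2 * n) = avg s ^ (2 * n - k) * avg s ^ k" by (simp flip: power_add)
      then show "monom 1 (J - n * (s - 1)) * avg s ^ (2 * n) * (1 - b) ^ k
        = monom 1 (J - n * (s - 1)) * (avg s ^ (2 * n - k) * (avg s * (1 - b)) ^ k)"
        by (simp only: power_mult_distrib mult_ac)
    qed simp
    also have "poly_l1 \<dots> \<le> (\<Sum>k<2*n. poly_l1 (monom 1 (J - n * (s - 1)) * (avg s ^ (2 * n - k) * (avg s * (1 - b)) ^ k)))"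
      by (rule poly_l1_sum)
    also have "\<dots> \<le> (\<Sum>k<2*n. (1 / 2) ^ k)"
    proof (rule sum_mono)
      fix k
      have "poly_l1 (monom 1 (J - n * (s - 1)) * (avg s ^ (2 * n - k) * (avg s * (1 - b)) ^ k))
          \<le> poly_l1 (monom 1 (J - n * (s - 1))) * poly_l1 (avg s ^ (2 * n - k) * (avg s * (1 - b)) ^ k)"
        by (rule poly_l1_mult)
      also have "\<dots> \<le> 1 * (poly_l1 (avg s ^ (2 * n - k)) * poly_l1 ((avg s * (1 - b)) ^ k))"
        by (intro mult_mono poly_l1_mult) auto
      also have "\<dots> \<le> 1 * (1 * (1 / 2) ^ k)"
      proof (intro mult_mono)
        have "poly_l1 (avg s ^ (2 * n - k)) \<le> poly_l1 (avg s) ^ (2 * n - k)" by (rule poly_l1_power)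
        also have "\<dots> \<le> 1" by (intro power_le_one poly_l1_avg) auto
        finally show "poly_l1 (avg s ^ (2 * n - k)) \<le> 1" .
        have "poly_l1 ((avg s * (1 - b)) ^ k) \<le> poly_l1 (avg s * (1 - b)) ^ k" by (rule poly_l1_power)
        also have "\<dots> \<le> (1 / 2) ^ k" by (intro power_mono half that) auto
        finally show "poly_l1 ((avg s * (1 - b)) ^ k) \<le> (1 / 2) ^ k" .
      qed auto
      finally show "poly_l1 (monom 1 (J - n * (s - 1)) * (avg s ^ (2 * n - k) * (avg s * (1 - b)) ^ k)) \<le> (1 / 2) ^ k"
        by simp
    qed
    also have "\<dots> \<le> 2" by (rule sum_half_powers_le)
    finally show ?thesis .
  qed
  define C where "C = 128 * exp (4::real)"
  define S where "S = 2 * real \<sigma> + 2 * real M"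
  show ?thesis
  proof (rule that[of C S])
    show "C > 0" "S > 0" using \<sigma> by (auto simp: C_def S_def add_pos_nonneg)
    fix n :: nat assume n: "n \<ge> 1"
    \<comment> \<open>At least n (s - 1) for every node s that occurs, so the natural-number
      subtraction in \<open>filt\<close> is exact.\<close>
    define J where "J = n * node \<sigma> n"
    define P where "P = (\<Sum>l=1..n. smult (extrapolation_weight \<sigma> n l) (filt n (node \<sigma> l) J))"
    have node_le: "node \<sigma> l \<le> node \<sigma> n" if "l \<le> n" for l
      using node_strict_mono[of \<sigma> l n] that \<sigma> by (cases "l = n") auto
    have sq: "real n * real n \<le> real n ^ 2 * sqrt (real n)"
    proof -
      have "sqrt (real n) \<ge> 1" using n by simp
      then have "real n ^ 2 * 1 \<le> real n ^ 2 * sqrt (real n)" by (intro mult_left_mono) auto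
      then show ?thesis by (simp add: power2_eq_square)
    qed
    have J_le: "real J \<le> real \<sigma> * (real n ^ 2 * sqrt (real n))"
    proof -
      have "real J = real \<sigma> * (real n ^ 2 * real (floor_sqrt n))"
        by (simp add: J_def node_def power2_eq_square)
      then show ?thesis using floor_sqrt_le_sqrt[of n] by (auto intro!: mult_left_mono)
    qed
    have "degree P \<le> 2 * J + 2 * n * M" unfolding P_def
    proof (rule degree_sum_le)
      fix l assume l: "l \<in> {1..n}"
      have le: "n * (node \<sigma> l - 1) \<le> J"
        unfolding J_def using node_le[of l] l by (intro mult_le_mono2) auto
      have d1: "degree (avg (node \<sigma> l) ^ (2 * n)) \<le> 2 * n * (node \<sigma> l - 1)"
      proof -
        have "degree (avg (node \<sigma> l) ^ (2 * n)) \<le> degree (avg (node \<sigma> l)) * (2 * n)"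
          by (rule degree_power_le)
        also have "\<dots> \<le> (node \<sigma> l - 1) * (2 * n)" by (intro mult_le_mono1 degree_avg)
        finally show ?thesis by (simp add: mult_ac)
      qed
      have d2: "degree (\<Sum>k<2*n. (1 - b) ^ k) \<le> 2 * n * M"
      proof (rule degree_sum_le)
        fix k assume k: "k \<in> {..<2*n}"
        have "degree ((1 - b) ^ k) \<le> degree (1 - b) * k" by (rule degree_power_le)
        also have "\<dots> \<le> M * (2 * n)" using k degb by (intro mult_le_mono) auto
        finally show "degree ((1 - b) ^ k) \<le> 2 * n * M" by (simp add: mult_ac)
      qed simp
      have "degree (filt n (node \<sigma> l) J) \<le> degree (monom (1::real) (J - n * (node \<sigma> l - 1)) * avg (node \<sigma> l) ^ (2 * n)) + degree (\<Sum>k<2*n. (1 - b) ^ k)"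
        unfolding filt_def by (rule degree_mult_le)
      also have "\<dots> \<le> (J - n * (node \<sigma> l - 1)) + 2 * n * (node \<sigma> l - 1) + 2 * n * M"
        using degree_mult_le[of "monom (1::real) (J - n * (node \<sigma> l - 1))" "avg (node \<sigma> l) ^ (2 * n)"]
          degree_monom_le[of "1::real" "J - n * (node \<sigma> l - 1)"] d1 d2 by linarith
      also have "\<dots> \<le> 2 * J + 2 * n * M" using le by (simp add: mult.assoc)
      finally show "degree (smult (extrapolation_weight \<sigma> n l) (filt n (node \<sigma> l) J)) \<le> 2 * J + 2 * n * M"
        using degree_smult_le order.trans by blast
    qed simp
    then have "real (degree P) \<le> real (2 * J + 2 * n * M)" by (simp only: of_nat_le_iff)
    also have "\<dots> = 2 * real J + 2 * real M * real n" by simp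
    also have "real n \<le> real n * real n" using n by simp
    then have "2 * real J + 2 * real M * real n \<le> 2 * (real \<sigma> * (real n ^ 2 * sqrt (real n))) + 2 * real M * (real n ^ 2 * sqrt (real n))"
      using J_le sq by (intro add_mono mult_left_mono) auto
    finally have deg: "real (degree P) \<le> S * (real n ^ 2 * sqrt (real n))"
      by (simp only: S_def distrib_right mult.assoc)
    have J: "real J \<le> S * (real n ^ 2 * sqrt (real n))"
      by (rule order.trans[OF J_le]) (auto simp: S_def intro!: mult_right_mono)
    have "poly_l1 P \<le> (\<Sum>l=1..n. poly_l1 (smult (extrapolation_weight \<sigma> n l) (filt n (node \<sigma> l) J)))"
      unfolding P_def by (rule poly_l1_sum)
    also have "\<dots> \<le> (\<Sum>l=1..n. \<bar>extrapolation_weight \<sigma> n l\<bar> * 2)"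
      unfolding poly_l1_smult by (intro sum_mono mult_left_mono filt_l1 node_ge) auto
    also have "\<dots> \<le> C"
      using sum_extrapolation_weight_le[OF \<sigma>, of n] by (simp add: C_def flip: sum_distrib_right)
    finally have l1: "(\<Sum>j\<le>degree P. \<bar>coeff P j\<bar>) \<le> C" by (simp add: poly_l1_def)

    define Z where "Z = poly_exp (1 - b)"
    define X where "X = (\<Sum>l=1..n. fps_const (extrapolation_weight \<sigma> n l) * centred_avg (node \<sigma> l) ^ (2 * n))"
    have filt_exp: "fps_exp (- real J) * poly_exp (filt n (node \<sigma> l) J)
        = centred_avg (node \<sigma> l) ^ (2 * n) * (\<Sum>k<2*n. Z ^ k)" if l: "l \<in> {1..n}" for l
    proof -
      have le: "n * (node \<sigma> l - 1) \<le> J"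
        unfolding J_def using node_le[of l] l by (intro mult_le_mono2) auto
      have pos: "node \<sigma> l \<ge> 1" using node_ge[of l \<sigma>] l \<sigma> by auto
      \<comment> \<open>The even power 2n turns the half-integral recentring into an integral
        shift.\<close>
      have "fps_exp (- real J) * fps_exp (real (J - n * (node \<sigma> l - 1))) = fps_exp (- ((real (node \<sigma> l) - 1) / 2)) ^ (2 * n)"
        using le pos by (simp add: fps_exp_add_mult[symmetric] fps_exp_power_mult of_nat_diff field_simps)
      then show ?thesis
        unfolding filt_def poly_exp_mult poly_exp_power poly_exp_sum poly_exp_monom centred_avg_def
          power_mult_distrib Z_def by (simp add: mult_ac)
    qed
    have "fps_exp (- real J) * poly_exp P = X * (\<Sum>k<2*n. Z ^ k)"
      unfolding P_def poly_exp_sum poly_exp_smult X_def sum_distrib_left[of "fps_exp _"] sum_distrib_right[of _ _ "\<Sum>k<2*n. Z ^ k"]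
      by (rule sum.cong) (simp_all add: mult.left_commute[of "fps_exp _"] filt_exp mult.assoc)
    moreover have "poly_exp b = 1 - Z" by (simp add: Z_def)
    ultimately have "(fps_exp (- real J) * poly_exp P) * poly_exp b = X * ((1 - Z) * (\<Sum>k<2*n. Z ^ k))"
      by (simp only: mult_ac)
    also have "\<dots> = X * (1 - Z ^ (2 * n))" by (simp only: one_diff_power_eq[symmetric])
    \<comment> \<open>\<open>Z\<close> has no constant term, so the subtracted product starts at
      order 2n, while \<open>X\<close> agrees with 1 below order 2n by extrapolation.\<close>
    finally have prod: "(fps_exp (- real J) * poly_exp P) * poly_exp b = X - X * Z ^ (2 * n)"
      by (simp add: algebra_simps)
    have Z0: "fps_nth Z 0 = 0" using \<open>poly (1 - b) 1 = 0\<close> by (simp only: Z_def poly_exp_nth_0)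
    have main: "fps_nth ((fps_exp (- real J) * poly_exp P) * poly_exp b) k = of_bool (k = 0)" if k: "k < 2 * n" for k
    proof -
      have "fps_nth (X * Z ^ (2 * n)) k = 0"
        unfolding fps_mult_nth by (rule sum.neutral) (use Z0 k in \<open>auto simp: fps_power_nth_less\<close>)
      moreover have "fps_nth X k = of_bool (k = 0)"
        using extrapolation_centred_avg[OF \<sigma> k, of "2 * n"] by (simp add: X_def fps_sum_nth)
      ultimately show ?thesis by (simp add: prod)
    qed
    have e1: "fps_exp (- real J) * poly_exp P = (\<Sum>j\<le>degree P. fps_const (coeff P j) * fps_exp (real j - real J))"
      unfolding poly_exp_altdef sum_distrib_left
      by (rule sum.cong) (simp_all add: mult.left_commute[of "fps_exp _"] fps_exp_add_mult[symmetric])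
    have e2: "poly_exp b = (\<Sum>m\<le>M. fps_const (\<beta> m) * fps_exp (real m))"
      by (simp add: b_def)
    show "\<exists>P J d. real d \<le> S * (real n ^ 2 * sqrt (real n)) \<and> real J \<le> S * (real n ^ 2 * sqrt (real n)) \<and>
       (\<Sum>j\<le>d. \<bar>P j\<bar>) \<le> C \<and>
       (\<forall>k<2*n. fps_nth ((\<Sum>j\<le>d. fps_const (P j) * fps_exp (real j - real J)) *
           (\<Sum>m\<le>M. fps_const (\<beta> m) * fps_exp (real m))) k = of_bool (k = 0))"
      using deg J l1 main unfolding e1 e2 by blast
  qed
qed

subsection \<open>The \<open>\<ell>\<^sub>1\<close>-norm\<close>

lemma l1_norm_nonneg [simp]: "l1_norm x \<ge> 0"
  by (simp add: l1_norm_def sum_nonneg)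

lemma l1_norm_0 [simp]: "l1_norm 0 = 0"
  by (simp add: l1_norm_def)

lemma l1_norm_triangle: "l1_norm (x + y) \<le> l1_norm x + l1_norm y"
  by (simp add: l1_norm_def sum.distrib[symmetric] sum_mono norm_triangle_ineq)

lemma l1_norm_scaleR: "l1_norm (c *\<^sub>R x) = \<bar>c\<bar> * l1_norm x"
  by (simp add: l1_norm_def sum_distrib_left)

lemma l1_norm_sum: "l1_norm (\<Sum>i\<in>A. f i) \<le> (\<Sum>i\<in>A. l1_norm (f i))"
proof (induction A rule: infinite_finite_induct)
  case (insert x F)
  then show ?case using l1_norm_triangle[of "f x" "sum f F"] by simp
qed auto

lemma l1_norm_sum_list: "l1_norm (\<Sum>p\<leftarrow>ps. f p) \<le> (\<Sum>p\<leftarrow>ps. l1_norm (f p))"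
proof (induction ps)
  case (Cons p ps)
  then show ?case using l1_norm_triangle[of "f p" "\<Sum>p\<leftarrow>ps. f p"] by simp
qed simp

lemma norm_le_l1_norm: "norm x \<le> l1_norm x"
  unfolding norm_vec_def l1_norm_def by (rule L2_set_le_sum) simp

lemma l1_norm_le_norm: "l1_norm (x :: 'a::real_normed_vector ^ 'n) \<le> real CARD('n) * norm x"
proof -
  have "(\<Sum>i\<in>UNIV. norm (x $ i)) \<le> (\<Sum>i\<in>(UNIV::'n set). norm x)"
    by (rule sum_mono) (rule Finite_Cartesian_Product.norm_nth_le)
  then show ?thesis by (simp add: l1_norm_def)
qed

lemma l1_norm_axis [simp]: "l1_norm (axis i (1::real)) = 1"
proof -
  have "(\<Sum>j\<in>UNIV. norm (axis i (1::real) $ j)) = (\<Sum>j\<in>UNIV. if j = i then 1 else 0)"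
    by (rule sum.cong) (auto simp: axis_def)
  then show ?thesis by (simp add: l1_norm_def)
qed

lemma continuous_on_l1_norm: "continuous_on S l1_norm"
  unfolding l1_norm_def[abs_def] by (intro continuous_intros)

lemma tendsto_l1_norm: "(f \<longlongrightarrow> l) F \<Longrightarrow> ((\<lambda>x. l1_norm (f x)) \<longlongrightarrow> l1_norm l) F"
  unfolding l1_norm_def by (intro tendsto_intros)

subsection \<open>Partial derivatives of Lie derivatives\<close>

text \<open>Coordinate directions suffice for Lie derivatives: expanding the vector field in the
  standard basis gives weights that sum to its l1-norm, so no factor of the dimension
  enters.\<close>

definition partials :: "(real ^ 'n \<Rightarrow> 'b::real_normed_vector) \<Rightarrow> 'n list \<Rightarrow> real ^ 'n \<Rightarrow> 'b" where
  "partials g js = iterated_deriv g (map (\<lambda>j. axis j 1) js)"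

definition partials_differentiable ::
  "nat \<Rightarrow> (real ^ 'n) set \<Rightarrow> (real ^ 'n \<Rightarrow> 'b::real_normed_vector) \<Rightarrow> bool" where
  "partials_differentiable n \<Omega> g \<longleftrightarrow>
     (\<forall>js. length js < n \<longrightarrow> (\<forall>x\<in>\<Omega>. partials g js differentiable (at x)))"

lemma partials_Nil [simp]: "partials g [] = g"
  by (simp add: partials_def)

lemma partials_Cons: "partials g (j # js) x = frechet_derivative (partials g js) (at x) (axis j 1)"
  by (simp add: partials_def)

lemma times_differentiable_imp_partials:
  "times_differentiable_on n \<Omega> g \<Longrightarrow> partials_differentiable n \<Omega> g"
  by (simp add: times_differentiable_on_def partials_differentiable_def partials_def)

lemma lie_deriv_eq_partials:
  assumes "u differentiable (at y)"
  shows "lie_deriv f u y = (\<Sum>i\<in>UNIV. (f y $ i) *\<^sub>R partials u [i] y)"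
proof -
  have lin: "linear (frechet_derivative u (at y))"
    using assms by (rule linear_frechet_derivative)
  have e: "f y = (\<Sum>i\<in>UNIV. (f y $ i) *\<^sub>R axis i 1)"
    using basis_expansion[of "f y"] by (simp add: scalar_mult_eq_scaleR)
  have "frechet_derivative u (at y) (\<Sum>i\<in>UNIV. (f y $ i) *\<^sub>R axis i 1)
    = (\<Sum>i\<in>UNIV. (f y $ i) *\<^sub>R frechet_derivative u (at y) (axis i 1))"
    by (simp add: linear_sum[OF lin] linear_cmul[OF lin])
  then show ?thesis unfolding lie_deriv_def partials_Cons partials_Nil using e by simp
qed

text \<open>All ways to distribute the directions of a mixed derivative over the two factors of a product.\<close>

fun splits :: "'a list \<Rightarrow> ('a list \<times> 'a list) list" where
  "splits [] = [([], [])]"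
| "splits (v # vs) = map (\<lambda>(S, T). (v # S, T)) (splits vs) @ map (\<lambda>(S, T). (S, v # T)) (splits vs)"

lemma length_splits: "(S, T) \<in> set (splits vs) \<Longrightarrow> length S + length T = length vs"
  by (induction vs arbitrary: S T) auto

text \<open>The Chu-Vandermonde identity; its binomial coefficients are hidden in the multiplicity
  with which \<open>splits\<close> produces pairs of given lengths.\<close>

lemma sum_splits_pochhammer:
  "(\<Sum>(S, T)\<leftarrow>splits vs. pochhammer (a::real) (length S) * pochhammer b (length T))
     = pochhammer (a + b) (length vs)"
proof (induction vs arbitrary: a b)
  case (Cons v vs)
  have "(\<Sum>(S, T)\<leftarrow>splits (v # vs). pochhammer a (length S) * pochhammer b (length T))
    = (\<Sum>(S, T)\<leftarrow>splits vs. a * (pochhammer (a + 1) (length S) * pochhammer b (length T)))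
    + (\<Sum>(S, T)\<leftarrow>splits vs. b * (pochhammer a (length S) * pochhammer (b + 1) (length T)))"
    by (simp add: comp_def case_prod_unfold pochhammer_rec mult_ac)
  also have "\<dots> = a * pochhammer (a + b + 1) (length vs) + b * pochhammer (a + b + 1) (length vs)"
    using Cons[of "a + 1" b] Cons[of a "b + 1"]
    by (simp add: case_prod_unfold sum_list_const_mult add_ac)
  also have "\<dots> = pochhammer (a + b) (length (v # vs))"
    by (simp add: pochhammer_rec algebra_simps)
  finally show ?case .
qed simp

lemma has_derivative_sum_list:
  "(\<And>p. p \<in> set ps \<Longrightarrow> (F p has_derivative F' p) (at y)) \<Longrightarrow>
    ((\<lambda>y. \<Sum>p\<leftarrow>ps. F p y) has_derivative (\<lambda>v. \<Sum>p\<leftarrow>ps. F' p v)) (at y)"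
  by (induction ps) (auto intro!: has_derivative_add)

context
  fixes f :: "real ^ 'n \<Rightarrow> real ^ 'n" and u :: "real ^ 'n \<Rightarrow> real ^ 'm"
    and \<Omega> :: "(real ^ 'n) set" and n :: nat
  assumes \<Omega>: "open \<Omega>"
    and f_diff: "partials_differentiable n \<Omega> f"
    and u_diff: "partials_differentiable (Suc n) \<Omega> u"
begin

text \<open>The direction \<open>i\<close> of the Lie derivative acts on \<open>u\<close> first and
  so stands at the end of the list; the directions distributed by the product rule are added in
  front.\<close>

definition leibniz :: "'n list \<Rightarrow> real ^ 'n \<Rightarrow> real ^ 'm" where
  "leibniz js y = (\<Sum>(S, T)\<leftarrow>splits js. \<Sum>i\<in>UNIV. (partials f S y $ i) *\<^sub>R partials u (T @ [i]) y)"

lemma leibniz_has_derivative: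
  assumes y: "y \<in> \<Omega>" and len: "length js < n"
  obtains L where "(leibniz js has_derivative L) (at y)" "\<And>j. L (axis j 1) = leibniz (j # js) y"
proof -
  define F where "F p y = (\<Sum>i\<in>UNIV. (partials f (fst p) y $ i) *\<^sub>R partials u (snd p @ [i]) y)" for p y
  define F' where "F' p v = (\<Sum>i\<in>UNIV. (partials f (fst p) y $ i) *\<^sub>R frechet_derivative (partials u (snd p @ [i])) (at y) v
      + (frechet_derivative (partials f (fst p)) (at y) v $ i) *\<^sub>R partials u (snd p @ [i]) y)" for p v
  have l: "leibniz js = (\<lambda>y. \<Sum>p\<leftarrow>splits js. F p y)" for js
    by (simp add: leibniz_def[abs_def] F_def case_prod_unfold)
  have "((\<lambda>y. \<Sum>p\<leftarrow>splits js. F p y) has_derivative (\<lambda>v. \<Sum>p\<leftarrow>splits js. F' p v)) (at y)"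
  proof (rule has_derivative_sum_list)
    fix p assume "p \<in> set (splits js)"
    then have le: "length (fst p) < n" "length (snd p) < n"
      using length_splits[of "fst p" "snd p" js] len by auto
    have 1: "(partials f (fst p) has_derivative frechet_derivative (partials f (fst p)) (at y)) (at y)"
      using f_diff le y by (simp add: partials_differentiable_def frechet_derivative_works[symmetric])
    have 2: "(partials u (snd p @ [i]) has_derivative frechet_derivative (partials u (snd p @ [i])) (at y)) (at y)" for i
      using u_diff le y by (simp add: partials_differentiable_def frechet_derivative_works[symmetric])
    show "(F p has_derivative F' p) (at y)"
      unfolding F_def[abs_def] F'_def[abs_def]
      by (intro has_derivative_sum has_derivative_scaleR 2 bounded_linear.has_derivative[OF bounded_linear_vec_nth 1])
  qed
  moreover have "(\<Sum>p\<leftarrow>splits js. F' p (axis j 1)) = leibniz (j # js) y" for j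
  proof -
    have e: "F' p (axis j 1) = F (j # fst p, snd p) y + F (fst p, j # snd p) y" for p
      by (simp add: F'_def F_def partials_Cons sum.distrib add.commute)
    show ?thesis unfolding e by (simp add: l sum_list_addf comp_def case_prod_unfold)
  qed
  ultimately show ?thesis using that unfolding l by blast
qed

text \<open>Both sides agree on an open set, so each further derivative of the left side can be read
  off from the right, one direction at a time.\<close>

lemma partials_lie_deriv:
  assumes "y \<in> \<Omega>" "length js \<le> n"
  shows "partials (lie_deriv f u) js y = leibniz js y"
  using assms
proof (induction js arbitrary: y)
  case Nil
  then have "u differentiable (at y)"
    using u_diff unfolding partials_differentiable_def by (metis partials_Nil length_0_conv zero_less_Suc)
  then show ?case by (simp add: lie_deriv_eq_partials leibniz_def)
next
  case (Cons j js)
  obtain L where L: "(leibniz js has_derivative L) (at y)" "\<And>j. L (axis j 1) = leibniz (j # js) y"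
    using leibniz_has_derivative[of y js] Cons.prems by auto
  have "(partials (lie_deriv f u) js has_derivative L) (at y)"
    by (rule has_derivative_transform_within_open[OF L(1) \<Omega>]) (use Cons in auto)
  then show ?case by (simp add: partials_Cons L(2) frechet_derivative_at[symmetric])
qed

lemma partials_differentiable_lie_deriv: "partials_differentiable n \<Omega> (lie_deriv f u)"
  unfolding partials_differentiable_def
proof (intro allI impI ballI)
  fix js y assume len: "length (js :: 'n list) < n" and y: "y \<in> \<Omega>"
  obtain L where L: "(leibniz js has_derivative L) (at y)"
    using leibniz_has_derivative[OF y len] by metis
  have "(partials (lie_deriv f u) js has_derivative L) (at y)"
    by (rule has_derivative_transform_within_open[OF L(1) \<Omega> y]) (use partials_lie_deriv len in auto)
  then show "partials (lie_deriv f u) js differentiable (at y)"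
    by (rule differentiableI)
qed

text \<open>Majorants \<open>(1 - t/r) powr (-a)\<close>: the Lie derivative raises the exponent \<open>a\<close> by \<open>2\<close>, and its
  factor of \<open>1\<close> more from \<open>f\<close> enters through the Vandermonde convolution of rising factorials.\<close>

lemma l1_norm_partials_lie_deriv_le:
  assumes r: "r > 0" and QE: "Q \<ge> 0" "E \<ge> 0" and a: "a > 0"
    and f_le: "\<And>S y. y \<in> \<Omega> \<Longrightarrow> length S \<le> n \<Longrightarrow>
      l1_norm (partials f S y) \<le> Q * pochhammer 1 (length S) / r ^ length S"
    and u_le: "\<And>T y. y \<in> \<Omega> \<Longrightarrow> length T \<le> Suc n \<Longrightarrow>
      l1_norm (partials u T y) \<le> E * pochhammer a (length T) / r ^ length T"
    and y: "y \<in> \<Omega>" and len: "length js \<le> n"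
  shows "l1_norm (partials (lie_deriv f u) js y)
    \<le> E * (a * (Q / r)) * pochhammer (a + 2) (length js) / r ^ length js"
proof -
  have "l1_norm (partials (lie_deriv f u) js y)
      \<le> (\<Sum>p\<leftarrow>splits js. l1_norm (\<Sum>i\<in>UNIV. (partials f (fst p) y $ i) *\<^sub>R partials u (snd p @ [i]) y))"
    unfolding partials_lie_deriv[OF y len] leibniz_def case_prod_unfold by (rule l1_norm_sum_list)
  also have "\<dots> \<le> (\<Sum>p\<leftarrow>splits js. E * (a * (Q / r)) / r ^ length js *
      (pochhammer 1 (length (fst p)) * pochhammer (a + 1) (length (snd p))))"
  proof (rule sum_list_mono)
    fix p assume p: "p \<in> set (splits js)"
    then have le: "length (fst p) + length (snd p) = length js"
      using length_splits[of "fst p" "snd p" js] by auto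
    define B where "B = E * pochhammer a (Suc (length (snd p))) / r ^ Suc (length (snd p))"
    have B0: "B \<ge> 0"
      unfolding B_def using QE r a by (intro divide_nonneg_nonneg mult_nonneg_nonneg pochhammer_nonneg) auto
    have "l1_norm (\<Sum>i\<in>UNIV. (partials f (fst p) y $ i) *\<^sub>R partials u (snd p @ [i]) y)
        \<le> (\<Sum>i\<in>UNIV. \<bar>partials f (fst p) y $ i\<bar> * l1_norm (partials u (snd p @ [i]) y))"
      by (rule order.trans[OF l1_norm_sum]) (simp add: l1_norm_scaleR)
    also have "\<dots> \<le> (\<Sum>i\<in>UNIV. \<bar>partials f (fst p) y $ i\<bar> * B)"
      unfolding B_def using u_le[OF y, of "snd p @ [_]"] le len by (intro sum_mono mult_left_mono) auto
    also have "\<dots> = l1_norm (partials f (fst p) y) * B"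
      by (simp add: l1_norm_def sum_distrib_right)
    also have "\<dots> \<le> Q * pochhammer 1 (length (fst p)) / r ^ length (fst p) * B"
      by (intro mult_right_mono f_le y B0) (use le len in auto)
    also have "\<dots> = E * (a * (Q / r)) / r ^ length js *
      (pochhammer 1 (length (fst p)) * pochhammer (a + 1) (length (snd p)))"
      using r by (simp add: B_def pochhammer_rec le[symmetric] power_add field_simps)
    finally show "l1_norm (\<Sum>i\<in>UNIV. (partials f (fst p) y $ i) *\<^sub>R partials u (snd p @ [i]) y) \<le> \<dots>" .
  qed
  also have "\<dots> = E * (a * (Q / r)) / r ^ length js * pochhammer (1 + (a + 1)) (length js)"
    using sum_splits_pochhammer[of 1 "a + 1" js]
    by (simp only: sum_list_const_mult case_prod_unfold)
  finally show ?thesis by (simp add: add_ac)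
qed

end

text \<open>The left side is the double factorial (2k - 1)!!, the product of the exponents 1, 3, 5,
  ... through which k Lie derivatives pass.\<close>

lemma prod_odd_le: "(\<Prod>i<k. 2 * real i + 1) \<le> 2 ^ k * fact k"
proof (induction k)
  case (Suc k)
  have "(\<Prod>i<Suc k. 2 * real i + 1) \<le> (2 ^ k * fact k) * (2 * real (Suc k))"
    unfolding prod.lessThan_Suc by (intro mult_mono Suc) auto
  also have "\<dots> = 2 ^ Suc k * fact (Suc k)" by (simp add: algebra_simps)
  finally show ?case .
qed simp

section \<open>Factorial growth of iterated Lie derivatives\<close>

lemma partials_differentiable_mono:
  "partials_differentiable n \<Omega> g \<Longrightarrow> m \<le> n \<Longrightarrow> partials_differentiable m \<Omega> g"
  by (auto simp: partials_differentiable_def)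

lemma partials_differentiable_lie_power:
  fixes f :: "real ^ 'n \<Rightarrow> real ^ 'n" and g :: "real ^ 'n \<Rightarrow> real ^ 'm"
  assumes "open \<Omega>" "partials_differentiable N \<Omega> f" "partials_differentiable N \<Omega> g" "k \<le> N"
  shows "partials_differentiable (N - k) \<Omega> ((lie_deriv f ^^ k) g)"
  using assms(4)
proof (induction k)
  case (Suc k)
  then have "partials_differentiable (Suc (N - Suc k)) \<Omega> ((lie_deriv f ^^ k) g)"
    by (simp add: Suc_diff_Suc)
  moreover have "partials_differentiable (N - Suc k) \<Omega> f"
    by (rule partials_differentiable_mono[OF assms(2)]) simp
  ultimately show ?case
    using partials_differentiable_lie_deriv[OF assms(1)] by simp
qed (use assms in simp)

lemma l1_norm_lie_power_le:
  fixes f :: "real ^ 'n \<Rightarrow> real ^ 'n" and g :: "real ^ 'n \<Rightarrow> real ^ 'm"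
  assumes \<Omega>: "open \<Omega>" and r: "r > 0" and Q: "Q \<ge> 0"
    and fd: "partials_differentiable N \<Omega> f" and gd: "partials_differentiable N \<Omega> g"
    and f_le: "\<And>S y. y \<in> \<Omega> \<Longrightarrow> length S \<le> N \<Longrightarrow> l1_norm (partials f S y) \<le> fact (length S) * Q / r ^ length S"
    and g_le: "\<And>S y. y \<in> \<Omega> \<Longrightarrow> length S \<le> N \<Longrightarrow> l1_norm (partials g S y) \<le> fact (length S) * Q / r ^ length S"
    and y: "y \<in> \<Omega>" and k: "k \<le> N"
  shows "l1_norm ((lie_deriv f ^^ k) g y) \<le> Q * fact k * (2 * Q / r) ^ k"
proof -
  \<comment> \<open>The induction has to carry all partial derivatives. The exponent starts at 1,
    where \<open>pochhammer 1 i\<close> is the factorial of i, and is 2k + 1 after k steps; each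
    step uses up one of the \<open>N\<close> orders of differentiability.\<close>
  have *: "l1_norm (partials ((lie_deriv f ^^ k) g) js y)
      \<le> Q * (\<Prod>i<k. (2 * real i + 1) * (Q / r)) * pochhammer (2 * real k + 1) (length js) / r ^ length js"
    if "length js + k \<le> N" "y \<in> \<Omega>" for js y
    using that
  proof (induction k arbitrary: js y)
    case 0
    then show ?case using g_le[of y js] by (simp add: pochhammer_fact mult.commute)
  next
    case (Suc k)
    have d: "partials_differentiable (Suc (length js)) \<Omega> ((lie_deriv f ^^ k) g)"
      by (rule partials_differentiable_mono[OF partials_differentiable_lie_power[OF \<Omega> fd gd, of k]])
        (use Suc.prems in auto)
    have "l1_norm (partials (lie_deriv f ((lie_deriv f ^^ k) g)) js y)
      \<le> (Q * (\<Prod>i<k. (2 * real i + 1) * (Q / r))) * ((2 * real k + 1) * (Q / r))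
          * pochhammer (2 * real k + 1 + 2) (length js) / r ^ length js"
    proof (rule l1_norm_partials_lie_deriv_le[OF \<Omega> _ d r Q])
      show "partials_differentiable (length js) \<Omega> f"
        by (rule partials_differentiable_mono[OF fd]) (use Suc.prems in simp)
      show "0 \<le> Q * (\<Prod>i<k. (2 * real i + 1) * (Q / r))"
        using Q r by (intro mult_nonneg_nonneg prod_nonneg) auto
    qed (use Suc f_le in \<open>auto simp: pochhammer_fact[symmetric] mult.commute\<close>)
    then show ?case by (simp add: mult_ac add_ac)
  qed
  have "l1_norm ((lie_deriv f ^^ k) g y) \<le> Q * (\<Prod>i<k. (2 * real i + 1) * (Q / r))"
    using *[of "[]" y] k y by simp
  also have "\<dots> = Q * ((\<Prod>i<k. 2 * real i + 1) * (Q / r) ^ k)"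
    by (simp only: prod.distrib prod_constant card_lessThan)
  also have "\<dots> \<le> Q * ((2 ^ k * fact k) * (Q / r) ^ k)"
    using Q r by (intro mult_left_mono mult_right_mono prod_odd_le) auto
  also have "\<dots> = Q * fact k * (2 * Q / r) ^ k" by (simp add: power_mult_distrib power_divide)
  finally show ?thesis .
qed

lemma analytic_bounded_upto_partials:
  fixes g :: "real ^ 'n \<Rightarrow> real ^ 'm"
  assumes g: "analytic_bounded_upto Q r N \<Omega> g" and Q: "Q \<ge> 0" and r: "r > 0"
  shows "partials_differentiable N \<Omega> g"
    and "y \<in> \<Omega> \<Longrightarrow> length S \<le> N \<Longrightarrow> l1_norm (partials g S y) \<le> fact (length S) * Q / r ^ length S"
proof -
  show "partials_differentiable N \<Omega> g"
    using g times_differentiable_imp_partials unfolding analytic_bounded_upto_def by blast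
  assume y: "y \<in> \<Omega>" and S: "length S \<le> N"
  have "ennreal (l1_norm (partials g S y)) \<le> deriv_norm g (length S) y"
    unfolding deriv_norm_def partials_def by (rule SUP_upper) auto
  also have "\<dots> \<le> (SUP x\<in>\<Omega>. deriv_norm g (length S) x)" by (rule SUP_upper[OF y])
  also have "\<dots> \<le> ennreal (fact (length S) * Q / r ^ length S)"
    using g S by (simp add: analytic_bounded_upto_def)
  finally show "l1_norm (partials g S y) \<le> fact (length S) * Q / r ^ length S"
    using Q r by (simp add: ennreal_le_iff)
qed

subsection \<open>Cauchy estimates for mixed derivatives\<close>

lemma smooth_map_iterated_deriv_differentiable: "smooth_map u \<Longrightarrow> iterated_deriv u vs differentiable (at x)"
  unfolding smooth_map_def times_differentiable_on_def by blast

lemma iterated_deriv_diff: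
  assumes "smooth_map u" "smooth_map w"
  shows "iterated_deriv (\<lambda>y. u y - w y) vs = (\<lambda>y. iterated_deriv u vs y - iterated_deriv w vs y)"
proof (induction vs)
  case (Cons v vs)
  have "frechet_derivative (\<lambda>y. iterated_deriv u vs y - iterated_deriv w vs y) (at x)
      = (\<lambda>z. frechet_derivative (iterated_deriv u vs) (at x) z - frechet_derivative (iterated_deriv w vs) (at x) z)" for x
    by (rule frechet_derivative_at[symmetric], rule has_derivative_diff)
       (use assms smooth_map_iterated_deriv_differentiable frechet_derivative_works in blast)+
  then show ?case by (simp add: Cons)
qed simp

lemma iterated_deriv_shift:
  assumes "smooth_map u"
  shows "iterated_deriv (\<lambda>y. u (y + c)) vs = (\<lambda>y. iterated_deriv u vs (y + c))"
proof (induction vs)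
  case (Cons v vs)
  have "frechet_derivative (\<lambda>y. iterated_deriv u vs (y + c)) (at x)
      = frechet_derivative (iterated_deriv u vs) (at (x + c))" for x
  proof (rule frechet_derivative_at[symmetric])
    have 1: "((\<lambda>y. y + c) has_derivative (\<lambda>y. y)) (at x)"
      by (auto intro!: derivative_eq_intros)
    have 2: "(iterated_deriv u vs has_derivative frechet_derivative (iterated_deriv u vs) (at (x + c))) (at (x + c))"
      using assms smooth_map_iterated_deriv_differentiable frechet_derivative_works by blast
    show "((\<lambda>y. iterated_deriv u vs (y + c)) has_derivative frechet_derivative (iterated_deriv u vs) (at (x + c))) (at x)"
      using has_derivative_compose[OF 1 2] by simp
  qed
  then show ?case by (simp add: Cons)
qed simp

lemma smooth_map_diff: "smooth_map u \<Longrightarrow> smooth_map w \<Longrightarrow> smooth_map (\<lambda>y. u y - w y)"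
  unfolding smooth_map_def times_differentiable_on_def
  by (auto simp: iterated_deriv_diff smooth_map_def times_differentiable_on_def intro!: differentiable_diff)

lemma smooth_map_shift:
  assumes "smooth_map u" shows "smooth_map (\<lambda>y. u (y + c))"
  unfolding smooth_map_def times_differentiable_on_def
proof (intro allI impI ballI)
  fix vs x
  have "(\<lambda>y. y + c) differentiable at x" by (simp add: differentiable_def) (auto intro!: derivative_eq_intros exI)
  then have "(\<lambda>y. iterated_deriv u vs (y + c)) differentiable at x"
    using differentiable_compose[of "iterated_deriv u vs" "\<lambda>y. y + c" x UNIV]
      smooth_map_iterated_deriv_differentiable[OF assms] by simp
  then show "iterated_deriv (\<lambda>y. u (y + c)) vs differentiable at x"
    by (simp add: iterated_deriv_shift[OF assms])
qed

definition complex_differentiable_at :: "(complex ^ 'n \<Rightarrow> complex ^ 'm) \<Rightarrow> complex ^ 'n \<Rightarrow> bool" where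
  "complex_differentiable_at H z \<longleftrightarrow> (\<exists>H'. (H has_derivative H') (at z) \<and> (\<forall>c v. H' (c *s v) = c *s H' v))"

lemma complex_differentiable_shift_diff:
  assumes "complex_differentiable_at H (z + c)" "complex_differentiable_at H z"
  shows "complex_differentiable_at (\<lambda>z. H (z + c) - H z) z"
proof -
  obtain A B where A: "(H has_derivative A) (at (z + c))" "\<And>c v. A (c *s v) = c *s A v"
    and B: "(H has_derivative B) (at z)" "\<And>c v. B (c *s v) = c *s B v"
    using assms unfolding complex_differentiable_at_def by metis
  have 1: "((\<lambda>y. y + c) has_derivative (\<lambda>y. y)) (at z)"
    by (auto intro!: derivative_eq_intros)
  have "((\<lambda>z. H (z + c) - H z) has_derivative (\<lambda>v. A v - B v)) (at z)"
    using has_derivative_diff[OF has_derivative_compose[OF 1 A(1)] B(1)] by simp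
  moreover have "A (k *s v) - B (k *s v) = k *s (A v - B v)" for k v
    by (simp add: A B vec_eq_iff algebra_simps)
  ultimately show ?thesis unfolding complex_differentiable_at_def by blast
qed

text \<open>Reduction to one complex variable: complex homogeneity of the derivative makes each
  component holomorphic along complex lines.\<close>

lemma complex_differentiable_line:
  assumes "complex_differentiable_at H (z + \<zeta> *s v)"
  shows "(\<lambda>\<zeta>. H (z + \<zeta> *s v) $ k) field_differentiable at \<zeta>"
proof -
  obtain A where A: "(H has_derivative A) (at (z + \<zeta> *s v))" "\<And>c v. A (c *s v) = c *s A v"
    using assms unfolding complex_differentiable_at_def by metis
  have "((\<lambda>\<zeta>. z + \<zeta> *s v) has_derivative (\<lambda>h. h *s v)) (at \<zeta>)"
  proof -
    have "linear (\<lambda>h. h *s v)"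
      by (rule linearI) (simp_all add: vec_eq_iff algebra_simps)
    then have "((\<lambda>h. h *s v) has_derivative (\<lambda>h. h *s v)) (at \<zeta>)"
      by (simp add: linear_conv_bounded_linear bounded_linear_imp_has_derivative)
    from has_derivative_add[OF has_derivative_const this] show ?thesis by simp
  qed
  from has_derivative_compose[OF this A(1)]
  have "((\<lambda>\<zeta>. H (z + \<zeta> *s v) $ k) has_derivative (\<lambda>h. A (h *s v) $ k)) (at \<zeta>)"
    by (rule bounded_linear.has_derivative[OF bounded_linear_vec_nth])
  then have "((\<lambda>\<zeta>. H (z + \<zeta> *s v) $ k) has_field_derivative (A v $ k)) (at \<zeta>)"
    by (rule has_derivative_imp_has_field_derivative) (simp add: A(2))
  then show ?thesis unfolding field_differentiable_def by blast
qed

lemma l1_norm_vector_scalar: "l1_norm (c *s v) = norm c * l1_norm (v :: complex ^ 'n)"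
  by (simp add: l1_norm_def norm_mult sum_distrib_left)

lemma l1_norm_complex_vec [simp]: "l1_norm (complex_vec x) = l1_norm x"
  by (simp add: l1_norm_def complex_vec_def)

lemma complex_vec_diff: "complex_vec (x - y) = complex_vec x - complex_vec y"
  and complex_vec_add: "complex_vec (x + y) = complex_vec x + complex_vec y"
  and complex_vec_scaleR: "complex_vec (s *\<^sub>R y) = complex_of_real s *s complex_vec y"
  by (simp_all add: complex_vec_def vec_eq_iff)

text \<open>On the disc of radius \<open>s\<close> the derivative along the line is at most
  \<open>B / \<delta>\<close>, by the Cauchy estimate on discs of radius \<open>\<delta>\<close>
  about its points; the mean value inequality from 0 to \<open>s\<close> adds the factor
  \<open>s\<close>.\<close>

lemma l1_norm_shift_diff_le:
  fixes H :: "complex ^ 'n \<Rightarrow> complex ^ 'm"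
  assumes d: "\<And>\<zeta>. norm \<zeta> \<le> s + \<delta> \<Longrightarrow> complex_differentiable_at H (z + \<zeta> *s v)"
    and B: "\<And>\<zeta>. norm \<zeta> \<le> s + \<delta> \<Longrightarrow> l1_norm (H (z + \<zeta> *s v)) \<le> B"
    and s: "s \<ge> 0" and \<delta>: "\<delta> > 0"
  shows "l1_norm (H (z + complex_of_real s *s v) - H z) \<le> s * B / \<delta>"
proof -
  define w where "w = H (z + complex_of_real s *s v) - H z"
  \<comment> \<open>Weights of modulus at most 1 dual to \<open>w\<close>: the scalar function
    \<open>h\<close> stays bounded by \<open>B\<close> and its increment is exactly the l1-norm of
    \<open>w\<close>, so vector values cost no factor of the dimension.\<close>
  define \<epsilon> where "\<epsilon> k = cnj (sgn (w $ k))" for k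
  have \<epsilon>: "norm (\<epsilon> k) \<le> 1" for k by (simp add: \<epsilon>_def norm_sgn)
  define h where "h \<zeta> = (\<Sum>k\<in>UNIV. \<epsilon> k * H (z + \<zeta> *s v) $ k)" for \<zeta>
  have hd: "h field_differentiable at \<zeta>" if "norm \<zeta> \<le> s + \<delta>" for \<zeta>
    unfolding h_def[abs_def] using d[OF that]
    by (intro field_differentiable_sum field_differentiable_mult field_differentiable_const complex_differentiable_line)
  have hB: "norm (h \<zeta>) \<le> B" if "norm \<zeta> \<le> s + \<delta>" for \<zeta>
  proof -
    have "norm (h \<zeta>) \<le> (\<Sum>k\<in>UNIV. norm (\<epsilon> k) * norm (H (z + \<zeta> *s v) $ k))"
      unfolding h_def by (rule order.trans[OF norm_sum]) (simp add: norm_mult)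
    also have "\<dots> \<le> (\<Sum>k\<in>UNIV. 1 * norm (H (z + \<zeta> *s v) $ k))"
      by (intro sum_mono mult_right_mono \<epsilon>) auto
    finally show ?thesis using B[OF that] by (simp add: l1_norm_def)
  qed
  have dB: "norm (deriv h \<zeta>) \<le> B / \<delta>" if "\<zeta> \<in> cball 0 s" for \<zeta>
  proof -
    have in_ball: "norm x \<le> s + \<delta>" if "x \<in> cball \<zeta> \<delta>" for x
      using that \<open>\<zeta> \<in> cball 0 s\<close> norm_triangle_sub[of x \<zeta>] by (auto simp: dist_norm norm_minus_commute)
    have hol: "h holomorphic_on cball \<zeta> \<delta>"
      using hd in_ball by (auto simp: holomorphic_on_def field_differentiable_at_within)
    have "norm ((deriv ^^ 1) h \<zeta>) \<le> fact 1 * B / \<delta> ^ 1"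
    proof (rule Cauchy_inequality)
      show "h holomorphic_on ball \<zeta> \<delta>" using hol by (rule holomorphic_on_subset) auto
      show "continuous_on (cball \<zeta> \<delta>) h" using hol by (rule holomorphic_on_imp_continuous_on)
      show "norm (h x) \<le> B" if "norm (\<zeta> - x) = \<delta>" for x
        using that by (intro hB in_ball) (simp add: dist_norm)
    qed (use \<delta> in auto)
    then show ?thesis by simp
  qed
  have "norm (h (complex_of_real s) - h 0) \<le> B / \<delta> * norm (complex_of_real s - 0)"
  proof (rule field_differentiable_bound[where S = "cball 0 s"])
    show "(h has_field_derivative deriv h \<zeta>) (at \<zeta> within cball 0 s)" if "\<zeta> \<in> cball 0 s" for \<zeta>
    proof -
      have "h field_differentiable at \<zeta>" using that \<delta> by (intro hd) auto
      then show ?thesis by (metis field_differentiable_derivI has_field_derivative_at_within)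
    qed
  qed (use s dB in auto)
  moreover have "h (complex_of_real s) - h 0 = complex_of_real (l1_norm w)"
  proof -
    have "h (complex_of_real s) - h 0 = (\<Sum>k\<in>UNIV. \<epsilon> k * w $ k)"
      by (simp add: h_def w_def algebra_simps sum_subtractf)
    also have "\<dots> = (\<Sum>k\<in>UNIV. complex_of_real (norm (w $ k)))"
    proof (rule sum.cong)
      fix k show "\<epsilon> k * w $ k = complex_of_real (norm (w $ k))"
      proof (cases "w $ k = 0")
        case False
        have "cnj (sgn (w $ k)) * w $ k = (w $ k * cnj (w $ k)) / norm (w $ k)"
          by (simp add: sgn_div_norm scaleR_conv_of_real field_simps)
        also have "\<dots> = complex_of_real (norm (w $ k))"
          using False by (simp add: complex_norm_square[symmetric] power2_eq_square)
        finally show ?thesis by (simp add: \<epsilon>_def)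
      qed (simp add: \<epsilon>_def)
    qed simp
    finally show ?thesis by (simp add: l1_norm_def)
  qed
  ultimately show ?thesis using s by (simp add: w_def mult.commute)
qed

text \<open>Difference quotients of a holomorphic map are holomorphic on a slightly smaller ball, so that each
  differentiation costs one application of the Cauchy estimate in one variable; no holomorphy of the
  complex partial derivatives is needed.\<close>

lemma l1_norm_iterated_deriv_le_aux:
  fixes u :: "real ^ 'n \<Rightarrow> real ^ 'm" and H :: "complex ^ 'n \<Rightarrow> complex ^ 'm"
  assumes \<delta>: "\<delta> > 0"
    and "smooth_map u"
    and "\<And>z. l1_norm (z - complex_vec x) \<le> \<rho> \<Longrightarrow> complex_differentiable_at H z"
    and "\<And>y. l1_norm (y - x) \<le> \<rho> \<Longrightarrow> H (complex_vec y) = complex_vec (u y)"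
    and "\<And>z. l1_norm (z - complex_vec x) \<le> \<rho> \<Longrightarrow> l1_norm (H z) \<le> B"
    and "real (length vs) * \<delta> < \<rho>" and "\<And>v. v \<in> set vs \<Longrightarrow> l1_norm v \<le> 1"
  shows "l1_norm (iterated_deriv u vs x) \<le> B / \<delta> ^ length vs"
  using assms(2-)
proof (induction vs arbitrary: u H B \<rho>)
  case Nil
  have "complex_vec (u x) = H (complex_vec x)" using Nil(3)[of x] Nil(5) by simp
  then have "l1_norm (u x) = l1_norm (H (complex_vec x))" by (metis l1_norm_complex_vec)
  also have "\<dots> \<le> B" using Nil(5) by (intro Nil(4)) simp
  finally show ?case by simp
next
  case (Cons v vs)
  define F where "F = iterated_deriv u vs"
  define L where "L = frechet_derivative F (at x)"
  have FL: "(F has_derivative L) (at x)"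
    unfolding F_def L_def
    using smooth_map_iterated_deriv_differentiable[OF Cons(2)] frechet_derivative_works by blast
  have v: "l1_norm v \<le> 1" using Cons.prems by simp
  \<comment> \<open>The reserve beyond the radius \<open>\<delta>\<close> spent per direction. An
    increment \<open>s\<close> below it leaves the radius \<open>\<rho> - \<delta> - s\<close>,
    which still exceeds \<open>\<delta>\<close> times the number of remaining directions.\<close>
  define gap where "gap = \<rho> - real (length (v # vs)) * \<delta>"
  have gap: "gap > 0" using Cons.prems(5) by (simp add: gap_def)
  have step: "l1_norm ((1 / s) *\<^sub>R (F (x + s *\<^sub>R v) - F x)) \<le> B / \<delta> ^ length (v # vs)" if s: "0 < s" "s < gap" for s
  proof -
    define u' where "u' y = u (y + s *\<^sub>R v) - u y" for y
    define H' where "H' z = H (z + complex_vec (s *\<^sub>R v)) - H z" for z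
    define \<rho>' where "\<rho>' = \<rho> - \<delta> - s"
    have near: "l1_norm (z + \<zeta> *s complex_vec v - complex_vec x) \<le> \<rho>"
      if "l1_norm (z - complex_vec x) \<le> \<rho>'" "norm \<zeta> \<le> s + \<delta>" for z \<zeta>
    proof -
      have "l1_norm (z + \<zeta> *s complex_vec v - complex_vec x) \<le> l1_norm (z - complex_vec x) + l1_norm (\<zeta> *s complex_vec v)"
        using l1_norm_triangle[of "z - complex_vec x" "\<zeta> *s complex_vec v"] by (simp add: algebra_simps)
      also have "l1_norm (\<zeta> *s complex_vec v) \<le> (s + \<delta>) * 1"
        unfolding l1_norm_vector_scalar by (intro mult_mono) (use that v s \<delta> in auto)
      finally show ?thesis using that by (simp add: \<rho>'_def)
    qed
    have near0: "l1_norm (z + complex_vec (s *\<^sub>R v) - complex_vec x) \<le> \<rho>" "l1_norm (z - complex_vec x) \<le> \<rho>"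
      if "l1_norm (z - complex_vec x) \<le> \<rho>'" for z
      using near[OF that, of "complex_of_real s"] near[OF that, of 0] s \<delta> by (auto simp: complex_vec_scaleR)
    have "l1_norm (iterated_deriv u' vs x) \<le> (s * B / \<delta>) / \<delta> ^ length vs"
    proof (rule Cons.IH[of u' \<rho>' H'])
      show "smooth_map u'" unfolding u'_def[abs_def] by (intro smooth_map_diff smooth_map_shift Cons.prems)
      show "complex_differentiable_at H' z" if "l1_norm (z - complex_vec x) \<le> \<rho>'" for z
        unfolding H'_def[abs_def] by (intro complex_differentiable_shift_diff Cons.prems(2) near0 that)
      show "H' (complex_vec y) = complex_vec (u' y)" if y: "l1_norm (y - x) \<le> \<rho>'" for y
      proof -
        have "l1_norm (complex_vec y - complex_vec x) \<le> \<rho>'"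
          using y by (simp add: complex_vec_diff[symmetric])
        from near0[OF this] show ?thesis
          unfolding H'_def u'_def complex_vec_add[symmetric]
          by (simp add: Cons.prems(3) complex_vec_diff flip: complex_vec_add l1_norm_complex_vec)
      qed
      show "l1_norm (H' z) \<le> s * B / \<delta>" if z: "l1_norm (z - complex_vec x) \<le> \<rho>'" for z
        unfolding H'_def complex_vec_scaleR
        by (rule l1_norm_shift_diff_le) (use near[OF z] Cons.prems s \<delta> in auto)
      show "real (length vs) * \<delta> < \<rho>'" using s by (simp add: \<rho>'_def gap_def algebra_simps)
      show "l1_norm w \<le> 1" if "w \<in> set vs" for w using Cons.prems that by simp
    qed
    also have "iterated_deriv u' vs x = F (x + s *\<^sub>R v) - F x"
      unfolding u'_def[abs_def] F_def
      by (simp add: iterated_deriv_diff[OF smooth_map_shift] iterated_deriv_shift Cons.prems)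
    finally show ?thesis unfolding l1_norm_scaleR using s \<delta> by (simp add: field_simps)
  qed
  have "((\<lambda>s. (1 / s) *\<^sub>R (F (x + s *\<^sub>R v) - F x)) \<longlongrightarrow> L v) (at_right 0)"
  proof -
    have "((\<lambda>s. x + s *\<^sub>R v) has_derivative (\<lambda>s. s *\<^sub>R v)) (at 0)"
      by (auto intro!: derivative_eq_intros)
    moreover have "(F has_derivative L) (at (x + 0 *\<^sub>R v))" using FL by simp
    ultimately have "((\<lambda>s. F (x + s *\<^sub>R v)) has_derivative (\<lambda>s. L (s *\<^sub>R v))) (at 0)"
      by (rule has_derivative_compose)
    then have "((\<lambda>s. F (x + s *\<^sub>R v)) has_vector_derivative L v) (at 0)"
      unfolding has_vector_derivative_def
      using linear_cmul[OF has_derivative_linear[OF FL]] by (simp add: ext)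
    then have "((\<lambda>s. F (x + s *\<^sub>R v)) has_vector_derivative L v) (at 0 within {0<..})"
      by (rule has_vector_derivative_at_within)
    then have "((\<lambda>s. (F (x + s *\<^sub>R v) - F x - s *\<^sub>R L v) /\<^sub>R norm s) \<longlongrightarrow> 0) (at_right 0)"
      by (simp add: has_vector_derivative_def has_derivative_at_within)
    moreover have "eventually (\<lambda>s. (F (x + s *\<^sub>R v) - F x - s *\<^sub>R L v) /\<^sub>R norm s
        = (1 / s) *\<^sub>R (F (x + s *\<^sub>R v) - F x) - L v) (at_right 0)"
      using eventually_at_right_less[of "0::real"]
      by eventually_elim (auto simp: scaleR_diff_right divide_inverse)
    ultimately have "((\<lambda>s. (1 / s) *\<^sub>R (F (x + s *\<^sub>R v) - F x) - L v) \<longlongrightarrow> 0) (at_right 0)"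
      by (rule Lim_transform_eventually)
    then show ?thesis by (rule LIM_zero_cancel)
  qed
  then have "((\<lambda>s. l1_norm ((1 / s) *\<^sub>R (F (x + s *\<^sub>R v) - F x))) \<longlongrightarrow> l1_norm (L v)) (at_right 0)"
    by (rule tendsto_l1_norm)
  moreover have "eventually (\<lambda>s. l1_norm ((1 / s) *\<^sub>R (F (x + s *\<^sub>R v) - F x)) \<le> B / \<delta> ^ length (v # vs)) (at_right 0)"
    using eventually_at_right_real[OF gap] by eventually_elim (use step in auto)
  ultimately have "l1_norm (L v) \<le> B / \<delta> ^ length (v # vs)"
    by (intro tendsto_upperbound[of _ _ "at_right (0::real)"]) auto
  then show ?case by (simp add: L_def F_def)
qed

text \<open>A crude Stirling bound; the inductive step uses (1 + 1/m)^m \<le> e \<le> 3. This 3 is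
  the loss from \<open>\<rho>\<close> to \<open>\<rho> / 3\<close> in the Cauchy estimates.\<close>

lemma power_Suc_self_le: "(real i + 1) ^ i \<le> 3 ^ i * fact i"
proof (induction i)
  case (Suc i)
  have "(1 + 1 / real (Suc i)) ^ Suc i \<le> exp 1"
    by (rule exp_ge_one_plus_x_over_n_power_n) auto
  also have "\<dots> \<le> 3" by (rule exp_le)
  finally have *: "(1 + 1 / real (Suc i)) ^ Suc i \<le> 3" .
  have "real (Suc i) + 1 = real (Suc i) * (1 + 1 / real (Suc i))"
    by (simp add: field_simps)
  then have "(real (Suc i) + 1) ^ Suc i = (real (Suc i) * (1 + 1 / real (Suc i))) ^ Suc i"
    by (simp only:)
  also have "\<dots> = real (Suc i) * (real i + 1) ^ i * (1 + 1 / real (Suc i)) ^ Suc i"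
    unfolding power_mult_distrib by (simp add: add.commute)
  also have "\<dots> \<le> real (Suc i) * (3 ^ i * fact i) * 3"
    by (intro mult_mono Suc *) auto
  finally show ?case by (simp add: mult_ac)
qed simp

text \<open>\<open>\<rho>\<close> is the complex radius left around a point \<open>x\<close> that
  may lie outside \<Omega>. It will be \<open>r\<close> at points of \<Omega> and
  \<open>r / 2\<close> or \<open>r / 4\<close> at nearby points.\<close>

lemma analytic_bounded_iterated_deriv_le:
  fixes f :: "real ^ 'n \<Rightarrow> real ^ 'm"
  assumes sm: "smooth_map f" and an: "analytic_bounded Q r \<Omega> f" and Q: "Q \<ge> 0"
    and \<rho>: "\<rho> > 0" and x0: "x0 \<in> \<Omega>" and x: "l1_norm (x - x0) + \<rho> \<le> r"
    and vs: "\<And>v. v \<in> set vs \<Longrightarrow> l1_norm v \<le> 1"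
  shows "l1_norm (iterated_deriv f vs x) \<le> fact (length vs) * Q / (\<rho> / 3) ^ length vs"
proof -
  obtain G where G: "complex_analytic_on G (complex_nbhd \<Omega> r)"
    "\<And>x. complex_vec x \<in> complex_nbhd \<Omega> r \<Longrightarrow> G (complex_vec x) = complex_vec (f x)"
    "sup_norm (complex_nbhd \<Omega> r) G \<le> ennreal Q"
    using an unfolding analytic_bounded_def by blast
  have near: "z \<in> complex_nbhd \<Omega> r" if "l1_norm (z - complex_vec x) \<le> \<rho>" for z
  proof -
    have "l1_norm (z - complex_vec x0) \<le> l1_norm (z - complex_vec x) + l1_norm (complex_vec x - complex_vec x0)"
      using l1_norm_triangle[of "z - complex_vec x" "complex_vec x - complex_vec x0"] by simp
    also have "\<dots> \<le> r" using that x by (simp flip: complex_vec_diff)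
    finally show ?thesis using x0 by (auto simp: complex_nbhd_def)
  qed
  define n where "n = length vs"
  \<comment> \<open>n + 1 equal parts for n derivatives: the extra one is the strict reserve
    demanded by the auxiliary estimate.\<close>
  define \<delta> where "\<delta> = \<rho> / (real n + 1)"
  have \<delta>: "\<delta> > 0" using \<rho> by (simp add: \<delta>_def)
  have "l1_norm (iterated_deriv f vs x) \<le> Q / \<delta> ^ length vs"
  proof (rule l1_norm_iterated_deriv_le_aux[where H = G and \<rho> = \<rho>, OF \<delta> sm])
    show "complex_differentiable_at G z" if z: "l1_norm (z - complex_vec x) \<le> \<rho>" for z
    proof -
      obtain e where "e > 0" "\<forall>w\<in>ball z e. \<exists>G'. (G has_derivative G') (at w) \<and> (\<forall>c v. G' (c *s v) = c *s G' v)"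
        using near[OF z] G(1) unfolding complex_analytic_on_def by blast
      then show ?thesis unfolding complex_differentiable_at_def by (meson centre_in_ball)
    qed
    show "G (complex_vec y) = complex_vec (f y)" if "l1_norm (y - x) \<le> \<rho>" for y
      by (intro G(2) near) (use that in \<open>simp flip: complex_vec_diff\<close>)
    show "l1_norm (G z) \<le> Q" if "l1_norm (z - complex_vec x) \<le> \<rho>" for z
    proof -
      have "ennreal (l1_norm (G z)) \<le> sup_norm (complex_nbhd \<Omega> r) G"
        unfolding sup_norm_def by (rule SUP_upper[OF near[OF that]])
      also note G(3)
      finally show ?thesis using Q by (simp add: ennreal_le_iff)
    qed
    show "real (length vs) * \<delta> < \<rho>" using \<rho> by (simp add: \<delta>_def n_def field_simps)
  qed (rule vs)
  also have "\<dots> = Q / \<rho> ^ n * (real n + 1) ^ n" by (simp add: \<delta>_def n_def power_divide)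
  also have "\<dots> \<le> Q / \<rho> ^ n * (3 ^ n * fact n)"
    using Q \<rho> by (intro mult_left_mono power_Suc_self_le) auto
  finally show ?thesis by (simp add: n_def power_divide mult_ac)
qed

subsection \<open>Local flows\<close>

lemma norm_diff_le_vector_derivative:
  fixes G :: "real \<Rightarrow> 'a::real_normed_vector"
  assumes "convex S" "\<And>s. s \<in> S \<Longrightarrow> (G has_vector_derivative g s) (at s within S)"
    and "\<And>s. s \<in> S \<Longrightarrow> norm (g s) \<le> B" "a \<in> S" "b \<in> S"
  shows "norm (G b - G a) \<le> B * \<bar>b - a\<bar>"
proof -
  have "norm (G b - G a) \<le> B * norm (b - a)"
  proof (rule differentiable_bound[OF assms(1)])
    show "(G has_derivative (\<lambda>h. h *\<^sub>R g s)) (at s within S)" if "s \<in> S" for s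
      using assms(2)[OF that] by (simp add: has_vector_derivative_def)
    show "onorm (\<lambda>h. h *\<^sub>R g s) \<le> B" if "s \<in> S" for s
    proof (rule onorm_le)
      show "norm (h *\<^sub>R g s) \<le> B * norm h" for h
        using mult_right_mono[OF assms(3)[OF that], of "\<bar>h\<bar>"] by (simp add: mult.commute)
    qed
  qed (use assms in auto)
  then show ?thesis by simp
qed

section \<open>Short-time existence and uniqueness\<close>

definition solves :: "('a::real_normed_vector \<Rightarrow> 'a) \<Rightarrow> real set \<Rightarrow> (real \<Rightarrow> 'a) \<Rightarrow> bool" where
  "solves f S y \<longleftrightarrow> (\<forall>s\<in>S. (y has_vector_derivative f (y s)) (at s within S))"

lemma solves_subset: "solves f S y \<Longrightarrow> R \<subseteq> S \<Longrightarrow> solves f R y"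
  unfolding solves_def using has_vector_derivative_within_subset by blast

lemma solves_continuous_on: "solves f S y \<Longrightarrow> continuous_on S y"
  unfolding solves_def by (meson continuous_on_eq_continuous_within has_vector_derivative_continuous)

lemma solves_shift:
  assumes "solves f S y" "(\<lambda>s. s + a) ` R \<subseteq> S"
  shows "solves f R (\<lambda>s. y (s + a))"
  unfolding solves_def
proof
  fix s assume s: "s \<in> R"
  have 1: "((\<lambda>s. s + a) has_derivative (\<lambda>h. h)) (at s within R)"
    by (auto intro!: derivative_eq_intros)
  have "(y has_derivative (\<lambda>h. h *\<^sub>R f (y (s + a)))) (at (s + a) within (\<lambda>s. s + a) ` R)"
    using assms s unfolding solves_def has_vector_derivative_def by (meson has_derivative_subset image_subset_iff)
  from has_derivative_in_compose[OF 1 this]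
  show "((\<lambda>s. y (s + a)) has_vector_derivative f (y (s + a))) (at s within R)"
    by (simp add: has_vector_derivative_def)
qed

lemma closed_segment_0_subset: "\<bar>t\<bar> \<le> T \<Longrightarrow> closed_segment 0 t \<subseteq> {-T..T::real}"
  by (auto simp: closed_segment_eq_real_ivl split: if_splits)

lemma picard_existence:
  fixes f :: "'a::euclidean_space \<Rightarrow> 'a"
  assumes \<rho>: "\<rho> > 0" and Q: "\<And>y. y \<in> cball x \<rho> \<Longrightarrow> norm (f y) \<le> Q"
    and L: "L-lipschitz_on (cball x \<rho>) f"
    and T: "T > 0" "Q * T \<le> \<rho>" "L * T \<le> 1 / 2"
  obtains y where "y 0 = x" "solves f {-T..T} y" "y ` {-T..T} \<subseteq> cball x \<rho>"
proof -
  \<comment> \<open>Clamping time to [-T, T] makes the iterates bounded and continuous on the whole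
    line, hence elements of a complete space.\<close>
  define c where "c t = max (-T) (min T t)" for t :: real
  have c: "c t \<in> {-T..T}" "\<bar>c t\<bar> \<le> T" for t using T by (auto simp: c_def)
  have c_id: "c t = t" if "t \<in> {-T..T}" for t using that by (auto simp: c_def)
  \<comment> \<open>The integral starts at -T, so that one formula serves both signs of
    \<open>t\<close>; subtracting its value at 0 gives the integral from 0.\<close>
  define F where "F y t = integral {-T..t} (\<lambda>s. f (apply_bcontfun y s))" for y t
  define \<Phi> where "\<Phi> y t = x + (F y (c t) - F y 0)" for y t
  define S where "S = {y :: real \<Rightarrow>\<^sub>C 'a. \<forall>t. apply_bcontfun y t \<in> cball x \<rho>}"
  have cf: "continuous_on (cball x \<rho>) f" using L by (rule lipschitz_on_continuous_on)
  have Fd: "(F y has_vector_derivative f (apply_bcontfun y t)) (at t within {-T..T})"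
    if y: "y \<in> S" and t: "t \<in> {-T..T}" for y t
  proof -
    have "continuous_on {-T..T} (\<lambda>s. f (apply_bcontfun y s))"
      by (rule continuous_on_compose2[OF cf]) (use y in \<open>auto simp: S_def intro!: continuous_intros\<close>)
    from integral_has_vector_derivative[OF this t] show ?thesis by (simp add: F_def[abs_def])
  qed
  have Q0: "Q \<ge> 0" using Q[of x] \<rho> by (meson centre_in_cball less_imp_le norm_ge_zero order_trans)
  have F_le: "norm (F y (c t) - F y 0) \<le> \<rho>" if y: "y \<in> S" for y t
  proof -
    have "norm (F y (c t) - F y 0) \<le> Q * \<bar>c t - 0\<bar>"
      by (rule norm_diff_le_vector_derivative[OF convex_real_interval(5) Fd[OF y]])
         (use y Q c T in \<open>auto simp: S_def\<close>)
    also have "\<dots> \<le> Q * T" using c[of t] Q0 by (intro mult_left_mono) auto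
    finally show ?thesis using T by simp
  qed
  have \<Phi>b: "\<Phi> y \<in> bcontfun" if y: "y \<in> S" for y
  proof (rule bcontfun_normI)
    have "continuous_on {-T..T} (F y)"
      using Fd[OF y] by (meson continuous_on_eq_continuous_within has_vector_derivative_continuous)
    then have "continuous_on UNIV (\<lambda>t. F y (c t))"
      by (rule continuous_on_compose2) (use c in \<open>auto simp: c_def[abs_def] intro!: continuous_intros\<close>)
    then show "continuous_on UNIV (\<Phi> y)"
      unfolding \<Phi>_def[abs_def] by (intro continuous_intros)
    show "norm (\<Phi> y t) \<le> norm x + \<rho>" for t
      unfolding \<Phi>_def using F_le[OF y, of t] norm_triangle_ineq[of x "F y (c t) - F y 0"] by linarith
  qed
  have ap: "apply_bcontfun (Bcontfun (\<Phi> y)) = \<Phi> y" if "y \<in> S" for y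
    by (rule Bcontfun_inverse[OF \<Phi>b[OF that]])
  have "\<exists>!y\<in>S. Bcontfun (\<Phi> y) = y"
  proof (rule Banach_fix[where c = "1/2"])
    have "S = PiC UNIV (\<lambda>_. cball x \<rho>)" by (auto simp: S_def mem_PiC_iff Pi_def)
    then have "closed S" by (simp add: closed_PiC)
    then show "complete S" by (simp add: complete_eq_closed)
    have "const_bcontfun x \<in> S" using \<rho> by (simp add: S_def)
    then show "S \<noteq> {}" by blast
    show "(\<lambda>y. Bcontfun (\<Phi> y)) ` S \<subseteq> S"
    proof (rule image_subsetI)
      fix y assume y: "y \<in> S"
      show "Bcontfun (\<Phi> y) \<in> S"
        unfolding S_def using F_le[OF y] by (simp add: ap[OF y] \<Phi>_def dist_norm norm_minus_commute)
    qed
    show "dist (Bcontfun (\<Phi> y)) (Bcontfun (\<Phi> z)) \<le> 1 / 2 * dist y z" if y: "y \<in> S" and z: "z \<in> S" for y z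
    proof (rule dist_bound)
      fix t
      have "norm ((F y (c t) - F z (c t)) - (F y 0 - F z 0)) \<le> (L * dist y z) * \<bar>c t - 0\<bar>"
      proof (rule norm_diff_le_vector_derivative[OF convex_real_interval(5)])
        show "((\<lambda>t. F y t - F z t) has_vector_derivative f (apply_bcontfun y s) - f (apply_bcontfun z s)) (at s within {-T..T})"
          if "s \<in> {-T..T}" for s
          by (intro has_vector_derivative_diff Fd y z that)
        show "norm (f (apply_bcontfun y s) - f (apply_bcontfun z s)) \<le> L * dist y z" for s
        proof -
          have "norm (f (apply_bcontfun y s) - f (apply_bcontfun z s)) \<le> L * norm (apply_bcontfun y s - apply_bcontfun z s)"
            using lipschitz_on_normD[OF L] y z by (simp add: S_def)
          also have "\<dots> \<le> L * dist y z"
            using dist_bounded[of y s z] lipschitz_on_nonneg[OF L] by (intro mult_left_mono) (auto simp: dist_norm)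
          finally show ?thesis .
        qed
      qed (use c T in auto)
      also have "\<dots> \<le> (L * dist y z) * T"
        using c[of t] lipschitz_on_nonneg[OF L] by (intro mult_left_mono) auto
      also have "\<dots> = (L * T) * dist y z" by simp
      also have "\<dots> \<le> 1 / 2 * dist y z" by (intro mult_right_mono T) auto
      finally show "dist (apply_bcontfun (Bcontfun (\<Phi> y)) t) (apply_bcontfun (Bcontfun (\<Phi> z)) t) \<le> 1 / 2 * dist y z"
        by (simp add: ap y z \<Phi>_def dist_norm algebra_simps)
    qed
  qed auto
  then obtain y where y: "y \<in> S" "Bcontfun (\<Phi> y) = y" by blast
  have eq: "apply_bcontfun y t = x + (F y (c t) - F y 0)" for t
    using ap[OF y(1)] y(2) by (simp add: \<Phi>_def fun_eq_iff)
  show ?thesis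
  proof (rule that[of "apply_bcontfun y"])
    show "apply_bcontfun y 0 = x" using T by (simp add: eq c_def)
    show "apply_bcontfun y ` {- T..T} \<subseteq> cball x \<rho>" using y(1) by (auto simp: S_def)
    show "solves f {- T..T} (apply_bcontfun y)" unfolding solves_def
    proof
      fix t assume t: "t \<in> {-T..T}"
      have "((\<lambda>t. x + (F y t - F y 0)) has_vector_derivative (0 + (f (apply_bcontfun y t) - 0))) (at t within {-T..T})"
        by (intro has_vector_derivative_add has_vector_derivative_diff has_vector_derivative_const Fd y t)
      then have "((\<lambda>t. x + (F y t - F y 0)) has_vector_derivative f (apply_bcontfun y t)) (at t within {-T..T})"
        by simp
      then show "(apply_bcontfun y has_vector_derivative f (apply_bcontfun y t)) (at t within {-T..T})"
        by (rule has_vector_derivative_transform[OF t, rotated]) (simp add: eq c_id)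
    qed
  qed
qed

text \<open>First-exit argument: until the distance \<rho> is first reached the speed is at most
  \<open>Q\<close>, so the distance covered is at most \<open>Q * \<bar>t\<bar> < \<rho>\<close>.
  Time is written as \<open>u * t\<close> with u in [0, 1] to treat both signs of \<open>t\<close>
  at once.\<close>

lemma solution_stays:
  fixes f :: "'a::real_normed_vector \<Rightarrow> 'a"
  assumes y: "solves f (closed_segment 0 t) y"
    and Q: "\<And>z. z \<in> cball (y 0) \<rho> \<Longrightarrow> norm (f z) \<le> Q" and t: "Q * \<bar>t\<bar> < \<rho>" and \<rho>: "\<rho> > 0"
    and s: "s \<in> closed_segment 0 t"
  shows "y s \<in> cball (y 0) \<rho>"
proof (rule ccontr)
  assume "y s \<notin> cball (y 0) \<rho>"
  then have gt: "norm (y s - y 0) > \<rho>" by (simp add: dist_norm norm_minus_commute)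
  have Q0: "Q \<ge> 0" using Q[of "y 0"] \<rho> by (meson centre_in_cball less_imp_le norm_ge_zero order_trans)
  obtain u1 where u1: "0 \<le> u1" "u1 \<le> 1" "s = u1 * t"
    using s by (auto simp: closed_segment_def)
  define k where "k u = norm (y (u * t) - y 0)" for u
  have seg: "u * t \<in> closed_segment 0 t" if "0 \<le> u" "u \<le> 1" for u
    using that unfolding closed_segment_def by (auto intro!: exI[of _ u])
  have cont: "continuous_on {0..1} k" unfolding k_def[abs_def]
    by (intro continuous_intros continuous_on_compose2[OF solves_continuous_on[OF y]]) (auto intro: seg)
  define A where "A = {u\<in>{0..1}. k u = \<rho>}"
  have ivt: "\<exists>v. 0 \<le> v \<and> v \<le> u \<and> v \<in> A" if "0 \<le> u" "u \<le> 1" "k u \<ge> \<rho>" for u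
  proof -
    have "\<exists>v\<ge>0. v \<le> u \<and> k v = \<rho>"
    proof (rule IVT'[of k])
      show "continuous_on {0..u} k" by (rule continuous_on_subset[OF cont]) (use that in auto)
    qed (use that \<rho> in \<open>auto simp: k_def\<close>)
    then show ?thesis using that by (auto simp: A_def)
  qed
  have "closed A"
    unfolding A_def using cont by (intro continuous_closed_preimage_constant) auto
  moreover have "bounded A" by (rule bounded_subset[of "{0..1}"]) (auto simp: A_def)
  ultimately have "compact A" by (simp add: compact_eq_bounded_closed)
  moreover have "A \<noteq> {}" using ivt[of u1] u1 gt by (auto simp: k_def)
  ultimately obtain u0 where u0: "u0 \<in> A" "\<And>u. u \<in> A \<Longrightarrow> u0 \<le> u"
    using compact_attains_inf[of A] by metis
  have u01: "0 \<le> u0" "u0 \<le> 1" "k u0 = \<rho>" using u0 by (auto simp: A_def)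
  have below: "k u \<le> \<rho>" if u: "0 \<le> u" "u \<le> u0" for u
  proof (rule ccontr)
    assume "\<not> k u \<le> \<rho>"
    then obtain v where "0 \<le> v" "v \<le> u" "v \<in> A" using ivt[of u] u u01 by auto
    then have "u = u0" using u0(2)[of v] u by simp
    then show False using u01 \<open>\<not> k u \<le> \<rho>\<close> by simp
  qed
  have sub: "closed_segment 0 (u0 * t) \<subseteq> closed_segment 0 t"
    by (rule closed_segment_subset) (use seg u01 in auto)
  have "norm (y (u0 * t) - y 0) \<le> Q * \<bar>u0 * t - 0\<bar>"
  proof (rule norm_diff_le_vector_derivative[OF convex_closed_segment])
    show "(y has_vector_derivative f (y s)) (at s within closed_segment 0 (u0 * t))"
      if "s \<in> closed_segment 0 (u0 * t)" for s
      using solves_subset[OF y sub] that by (simp add: solves_def)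
    show "norm (f (y s)) \<le> Q" if s: "s \<in> closed_segment 0 (u0 * t)" for s
    proof (rule Q)
      obtain w where "0 \<le> w" "w \<le> 1" "s = (w * u0) * t"
        using s by (auto simp: closed_segment_def)
      then show "y s \<in> cball (y 0) \<rho>"
        using below[of "w * u0"] u01 by (auto simp: k_def dist_norm norm_minus_commute mult_left_le_one_le)
    qed
  qed auto
  also have "\<dots> \<le> Q * \<bar>t\<bar>"
    using u01 Q0 by (intro mult_left_mono) (auto simp: abs_mult mult_left_le_one_le)
  also note t
  finally show False using u01 by (simp add: k_def)
qed

text \<open>The largest distance \<open>N\<close> of the two solutions satisfies N \<le> |y 0 - z 0|
  + L |t| N, and L |t| \<le> 1/2 absorbs the last term, with the factor 2 in place of an
  exponential.\<close>

lemma solutions_close: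
  fixes f :: "'a::real_normed_vector \<Rightarrow> 'a"
  assumes y: "solves f (closed_segment 0 t) y" and z: "solves f (closed_segment 0 t) z"
    and U: "y ` closed_segment 0 t \<subseteq> U" "z ` closed_segment 0 t \<subseteq> U"
    and L: "L-lipschitz_on U f" and t: "L * \<bar>t\<bar> \<le> 1 / 2" and s: "s \<in> closed_segment 0 t"
  shows "norm (y s - z s) \<le> 2 * norm (y 0 - z 0)"
proof -
  have L0: "L \<ge> 0" by (rule lipschitz_on_nonneg[OF L])
  have "continuous_on (closed_segment 0 t) (\<lambda>s. norm (y s - z s))"
    using y z by (intro continuous_intros) (auto intro: solves_continuous_on)
  then obtain m where m: "m \<in> closed_segment 0 t"
    "\<And>s. s \<in> closed_segment 0 t \<Longrightarrow> norm (y s - z s) \<le> norm (y m - z m)"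
    using continuous_attains_sup[of "closed_segment 0 t" "\<lambda>s. norm (y s - z s)"] by auto
  define N where "N = norm (y m - z m)"
  have "norm ((y m - z m) - (y 0 - z 0)) \<le> (L * N) * \<bar>m - 0\<bar>"
  proof (rule norm_diff_le_vector_derivative[OF convex_closed_segment])
    show "((\<lambda>s. y s - z s) has_vector_derivative f (y s) - f (z s)) (at s within closed_segment 0 t)"
      if "s \<in> closed_segment 0 t" for s
      using y z that by (auto simp: solves_def intro!: has_vector_derivative_diff)
    show "norm (f (y s) - f (z s)) \<le> L * N" if s: "s \<in> closed_segment 0 t" for s
    proof -
      have "norm (f (y s) - f (z s)) \<le> L * norm (y s - z s)"
        using U s by (intro lipschitz_on_normD[OF L]) auto
      also have "\<dots> \<le> L * N" unfolding N_def by (intro mult_left_mono m s L0)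
      finally show ?thesis .
    qed
  qed (use m in auto)
  also have "\<dots> \<le> (L * N) * \<bar>t\<bar>"
    using m(1) L0 by (intro mult_left_mono)
      (auto simp: N_def closed_segment_def abs_mult mult_left_le_one_le)
  also have "\<dots> = (L * \<bar>t\<bar>) * N" by simp
  also have "\<dots> \<le> 1 / 2 * N" by (intro mult_right_mono t) (simp add: N_def)
  finally have "norm ((y m - z m) - (y 0 - z 0)) \<le> 1 / 2 * N" .
  then have "N \<le> norm (y 0 - z 0) + 1 / 2 * N"
    unfolding N_def using norm_triangle_sub[of "y m - z m" "y 0 - z 0"] by linarith
  then show ?thesis using m(2)[OF s] by (simp add: N_def)
qed

text \<open>Initial points come from \<open>\<Omega>\<close>, while \<open>f\<close> is controlled
  on the larger set \<open>U\<close>; the margin \<open>\<rho>\<close> between them yields one time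
  \<open>T\<close> valid for all initial points.\<close>

locale local_flow =
  fixes f :: "'a::euclidean_space \<Rightarrow> 'a" and \<Omega> U :: "'a set" and \<rho> Q L T :: real
  assumes \<rho>: "\<rho> > 0" and T: "T > 0" "Q * T < \<rho>" "L * T \<le> 1 / 2"
    and cball_subset: "\<And>x. x \<in> \<Omega> \<Longrightarrow> cball x \<rho> \<subseteq> U"
    and f_le: "\<And>y. y \<in> U \<Longrightarrow> norm (f y) \<le> Q"
    and L: "L-lipschitz_on U f" and Q: "Q \<ge> 0"
begin

lemma Q_t_less: "\<bar>t\<bar> \<le> T \<Longrightarrow> Q * \<bar>t\<bar> < \<rho>"
  using Q T(2) mult_left_mono[of "\<bar>t\<bar>" T Q] by linarith

lemma L_t_le: "\<bar>t\<bar> \<le> T \<Longrightarrow> L * \<bar>t\<bar> \<le> 1 / 2"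
  using lipschitz_on_nonneg[OF L] T(3) mult_left_mono[of "\<bar>t\<bar>" T L] by linarith

lemma solution_in_U:
  assumes "y 0 \<in> \<Omega>" "solves f (closed_segment 0 t) y" "\<bar>t\<bar> \<le> T"
  shows "y ` closed_segment 0 t \<subseteq> U"
proof -
  have "y s \<in> cball (y 0) \<rho>" if "s \<in> closed_segment 0 t" for s
    by (rule solution_stays[OF assms(2) _ Q_t_less[OF assms(3)] \<rho> that])
       (use cball_subset[OF assms(1)] f_le in auto)
  then show ?thesis using cball_subset[OF assms(1)] by auto
qed

text \<open>Justifies the definite description in \<open>flow\<close>: a competing solution also
  stays in \<open>U\<close>, and by \<open>solutions_close\<close> equal initial values force equal
  solutions.\<close>

lemma flow_eq:
  assumes y: "y 0 \<in> \<Omega>" "solves f (closed_segment 0 t) y" "\<bar>t\<bar> \<le> T"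
  shows "flow f t (y 0) = y t"
  unfolding flow_def
proof (rule the_equality)
  show "\<exists>ya. ya 0 = y 0 \<and> (\<forall>s\<in>closed_segment 0 t. (ya has_vector_derivative f (ya s)) (at s within closed_segment 0 t)) \<and> ya t = y t"
    using y unfolding solves_def by blast
next
  fix z assume "\<exists>ya. ya 0 = y 0 \<and> (\<forall>s\<in>closed_segment 0 t. (ya has_vector_derivative f (ya s)) (at s within closed_segment 0 t)) \<and> ya t = z"
  then obtain w where w: "w 0 = y 0" "solves f (closed_segment 0 t) w" "w t = z"
    unfolding solves_def by blast
  have "norm (w t - y t) \<le> 2 * norm (w 0 - y 0)"
    by (rule solutions_close[OF w(2) y(2) _ _ L L_t_le[OF y(3)]])
       (use w y solution_in_U in auto)
  then show "z = y t" using w by simp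
qed

lemma flow_solution:
  assumes x: "x \<in> \<Omega>"
  shows "flow f 0 x = x" and "solves f {-T..T} (\<lambda>t. flow f t x)"
    and "t \<in> {-T..T} \<Longrightarrow> flow f t x \<in> U"
    and "t \<in> {-T..T} \<Longrightarrow> norm (flow f t x - x) \<le> Q * \<bar>t\<bar>"
proof -
  obtain y where y: "y 0 = x" "solves f {-T..T} y" "y ` {-T..T} \<subseteq> cball x \<rho>"
  proof (rule picard_existence[OF \<rho>])
    show "norm (f y) \<le> Q" if "y \<in> cball x \<rho>" for y using cball_subset[OF x] f_le that by blast
    show "L-lipschitz_on (cball x \<rho>) f" by (rule lipschitz_on_subset[OF L cball_subset[OF x]])
  qed (use T in auto)
  have eq: "flow f t x = y t" if "t \<in> {-T..T}" for t
  proof -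
    have t: "\<bar>t\<bar> \<le> T" using that by auto
    show ?thesis
      using flow_eq[of y t] x y(1) t solves_subset[OF y(2) closed_segment_0_subset[OF t]] by simp
  qed
  show "flow f 0 x = x" using eq[of 0] T y by simp
  show "solves f {-T..T} (\<lambda>t. flow f t x)"
    unfolding solves_def
  proof
    fix t assume t: "t \<in> {-T..T}"
    have "(y has_vector_derivative f (y t)) (at t within {-T..T})" using y t by (simp add: solves_def)
    then have "((\<lambda>t. flow f t x) has_vector_derivative f (y t)) (at t within {-T..T})"
      by (rule has_vector_derivative_transform[OF t, rotated]) (rule eq)
    then show "((\<lambda>t. flow f t x) has_vector_derivative f (flow f t x)) (at t within {-T..T})"
      by (simp only: eq[OF t])
  qed
  have in_U: "y s \<in> U" if "s \<in> {-T..T}" for s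
    using y(3) cball_subset[OF x] that by blast
  show "flow f t x \<in> U" if "t \<in> {-T..T}" using eq[OF that] in_U[OF that] by simp
  show "norm (flow f t x - x) \<le> Q * \<bar>t\<bar>" if t: "t \<in> {-T..T}"
  proof -
    have "norm (y t - y 0) \<le> Q * \<bar>t - 0\<bar>"
    proof (rule norm_diff_le_vector_derivative[where S = "{-T..T}" and g = "\<lambda>s. f (y s)"])
      show "norm (f (y s)) \<le> Q" if "s \<in> {-T..T}" for s
        by (rule f_le[OF in_U[OF that]])
    qed (use y t T in \<open>auto simp: solves_def\<close>)
    then show ?thesis using eq[OF t] y by simp
  qed
qed

lemma flow_has_vector_derivative:
  assumes "x \<in> \<Omega>" "\<bar>t\<bar> < T"
  shows "((\<lambda>t. flow f t x) has_vector_derivative f (flow f t x)) (at t)"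
proof -
  have "((\<lambda>t. flow f t x) has_vector_derivative f (flow f t x)) (at t within {-T..T})"
    using flow_solution(2)[OF assms(1)] assms(2) by (simp add: solves_def abs_less_iff)
  moreover have "at t within {-T..T} = at t"
    using assms(2) by (intro at_within_interior) (auto simp: interior_atLeastAtMost_real)
  ultimately show ?thesis by simp
qed

text \<open>The shifted trajectory solves the equation from the intermediate point. That point has
  to lie in \<open>\<Omega>\<close>, where \<open>flow_eq\<close> identifies this solution with the
  flow.\<close>

lemma flow_flow:
  assumes "x \<in> \<Omega>" "\<bar>a\<bar> \<le> T" "\<bar>b\<bar> \<le> T" "\<bar>a + b\<bar> \<le> T" "flow f a x \<in> \<Omega>"
  shows "flow f b (flow f a x) = flow f (a + b) x"
proof -
  define y where "y s = flow f (s + a) x" for s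
  have sub: "(\<lambda>s. s + a) ` closed_segment 0 b \<subseteq> {-T..T}"
    using assms by (auto simp: closed_segment_eq_real_ivl split: if_splits)
  have "solves f (closed_segment 0 b) y"
    unfolding y_def[abs_def] by (rule solves_shift[OF flow_solution(2)[OF assms(1)] sub])
  then show ?thesis
    using flow_eq[of y b] assms by (simp add: y_def add.commute)
qed

lemma flow_lipschitz:
  assumes "x \<in> \<Omega>" "x' \<in> \<Omega>" "\<bar>t\<bar> \<le> T"
  shows "norm (flow f t x - flow f t x') \<le> 2 * norm (x - x')"
proof -
  have "norm (flow f t x - flow f t x') \<le> 2 * norm (flow f 0 x - flow f 0 x')"
  proof (rule solutions_close[where U = U])
    show "solves f (closed_segment 0 t) (\<lambda>t. flow f t x)" "solves f (closed_segment 0 t) (\<lambda>t. flow f t x')"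
      using assms by (auto intro: solves_subset[OF flow_solution(2) closed_segment_0_subset])
    show "(\<lambda>t. flow f t x) ` closed_segment 0 t \<subseteq> U" "(\<lambda>t. flow f t x') ` closed_segment 0 t \<subseteq> U"
      using flow_solution(3) closed_segment_0_subset[OF assms(3)] assms by blast+
  qed (use L L_t_le assms in auto)
  then show ?thesis by (simp add: flow_solution assms)
qed

end

subsection \<open>Integrals along expanding maps\<close>

text \<open>Two points of the preimage are at distance at most \<open>\<Lambda>\<close> times DIM
  times \<open>w\<close>, so the preimage fits into a cube of twice that side around any of its
  points. The right side is an open box so that cubes with disjoint interiors can be summed.\<close>

lemma emeasure_preimage_cube_le:
  fixes \<phi> :: "'a::euclidean_space \<Rightarrow> 'a"
  assumes expand: "\<And>x x'. x \<in> S \<Longrightarrow> x' \<in> S \<Longrightarrow> norm (x - x') \<le> \<Lambda> * norm (\<phi> x - \<phi> x')"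
    and \<Lambda>: "\<Lambda> \<ge> 0" and w: "w > 0" and cube: "\<And>i. i \<in> Basis \<Longrightarrow> v \<bullet> i - u \<bullet> i = w"
  shows "emeasure lborel {x \<in> S. \<phi> x \<in> cbox u v}
    \<le> ennreal ((2 * \<Lambda> * DIM('a)) ^ DIM('a)) * emeasure lborel (box u v)"
proof (cases "{x \<in> S. \<phi> x \<in> cbox u v} = {}")
  case False
  then obtain x0 where x0: "x0 \<in> S" "\<phi> x0 \<in> cbox u v" by auto
  define c where "c = \<Lambda> * (real DIM('a) * w)"
  have c0: "c \<ge> 0" using \<Lambda> w by (simp add: c_def)
  define l h where "l = x0 - c *\<^sub>R One" and "h = x0 + c *\<^sub>R One"
  have li: "l \<bullet> i = x0 \<bullet> i - c" "h \<bullet> i = x0 \<bullet> i + c" if "i \<in> Basis" for i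
    using that by (auto simp: l_def h_def inner_diff_left inner_add_left)
  have "{x \<in> S. \<phi> x \<in> cbox u v} \<subseteq> cbox l h"
  proof
    fix x assume "x \<in> {x \<in> S. \<phi> x \<in> cbox u v}"
    then have x: "x \<in> S" "\<phi> x \<in> cbox u v" by auto
    have "norm (\<phi> x - \<phi> x0) \<le> (\<Sum>i\<in>Basis. \<bar>(\<phi> x - \<phi> x0) \<bullet> i\<bar>)" by (rule norm_le_l1)
    also have "\<dots> \<le> (\<Sum>i\<in>(Basis::'a set). w)"
    proof (rule sum_mono)
      fix i :: 'a assume i: "i \<in> Basis"
      then have "u \<bullet> i \<le> \<phi> x \<bullet> i" "\<phi> x \<bullet> i \<le> v \<bullet> i" "u \<bullet> i \<le> \<phi> x0 \<bullet> i" "\<phi> x0 \<bullet> i \<le> v \<bullet> i"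
        using x x0 by (auto simp: mem_box)
      then show "\<bar>(\<phi> x - \<phi> x0) \<bullet> i\<bar> \<le> w"
        using cube[OF i] unfolding inner_diff_left by linarith
    qed
    finally have "norm (\<phi> x - \<phi> x0) \<le> real DIM('a) * w" by simp
    then have nc: "norm (x - x0) \<le> c"
      unfolding c_def using order.trans[OF expand[OF x(1) x0(1)] mult_left_mono[OF _ \<Lambda>]] by blast
    show "x \<in> cbox l h" unfolding mem_box
    proof
      fix i :: 'a assume i: "i \<in> Basis"
      have "\<bar>(x - x0) \<bullet> i\<bar> \<le> c" using Basis_le_norm[OF i, of "x - x0"] nc by linarith
      then show "l \<bullet> i \<le> x \<bullet> i \<and> x \<bullet> i \<le> h \<bullet> i"
        unfolding li[OF i] inner_diff_left by linarith
    qed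
  qed
  then have "emeasure lborel {x \<in> S. \<phi> x \<in> cbox u v} \<le> emeasure lborel (cbox l h)"
    by (rule emeasure_mono) simp
  also have "\<dots> = ennreal (\<Prod>i\<in>(Basis::'a set). 2 * c)"
    using c0 by (subst emeasure_lborel_cbox) (auto simp: li inner_diff_left intro!: arg_cong[where f = ennreal] prod.cong)
  also have "(\<Prod>i\<in>(Basis::'a set). 2 * c) = (2 * \<Lambda> * DIM('a)) ^ DIM('a) * w ^ DIM('a)"
    by (simp add: c_def power_mult_distrib mult_ac)
  also have "ennreal ((2 * \<Lambda> * DIM('a)) ^ DIM('a) * w ^ DIM('a))
     = ennreal ((2 * \<Lambda> * DIM('a)) ^ DIM('a)) * ennreal (w ^ DIM('a))"
    using \<Lambda> w by (intro ennreal_mult) auto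
  also have "ennreal (w ^ DIM('a)) = emeasure lborel (box u v)"
  proof -
    have uv: "u \<bullet> b \<le> v \<bullet> b" if "b \<in> Basis" for b using cube[OF that] w by linarith
    have "(\<Prod>b\<in>Basis. (v - u) \<bullet> b) = (\<Prod>b\<in>(Basis::'a set). w)"
      by (rule prod.cong) (simp_all add: inner_diff_left cube)
    then show ?thesis by (simp add: emeasure_lborel_box[OF uv])
  qed
  finally show ?thesis .
next
  case True
  then show ?thesis by (simp only: emeasure_empty zero_le)
qed

text \<open>\<open>B\<close> is a countable union of cubes with disjoint interiors, and the cube
  estimate adds up over them. The gauge of balls inside \<open>B\<close> keeps every cube of the
  covering within \<open>B\<close>.\<close>

lemma emeasure_preimage_open_le:
  fixes \<phi> :: "'a::euclidean_space \<Rightarrow> 'a"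
  assumes expand: "\<And>x x'. x \<in> S \<Longrightarrow> x' \<in> S \<Longrightarrow> norm (x - x') \<le> \<Lambda> * norm (\<phi> x - \<phi> x')"
    and \<Lambda>: "\<Lambda> \<ge> 0" and meas: "\<And>B. B \<in> sets borel \<Longrightarrow> {x \<in> S. \<phi> x \<in> B} \<in> sets borel"
    and B: "open B" "bounded B"
  shows "emeasure lborel {x \<in> S. \<phi> x \<in> B} \<le> ennreal ((2 * \<Lambda> * DIM('a)) ^ DIM('a)) * emeasure lborel B"
proof -
  let ?C = "ennreal ((2 * \<Lambda> * DIM('a)) ^ DIM('a))"
  obtain c0 where c0: "\<And>x. x \<in> B \<Longrightarrow> norm x \<le> c0" using B by (meson bounded_iff)
  define c where "c = max c0 1"
  define a b where "a = - (c *\<^sub>R One :: 'a)" and "b = (c *\<^sub>R One :: 'a)"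
  have ab: "a \<bullet> i = - c" "b \<bullet> i = c" if "i \<in> Basis" for i using that by (auto simp: a_def b_def)
  have Bsub: "B \<subseteq> cbox a b"
  proof
    fix x assume x: "x \<in> B"
    have "\<bar>x \<bullet> i\<bar> \<le> c" if "i \<in> Basis" for i
      using Basis_le_norm[OF that, of x] c0[OF x] by (simp add: c_def)
    then show "x \<in> cbox a b" unfolding mem_box by (force simp: ab)
  qed
  have box: "box a b \<noteq> {}" unfolding box_ne_empty by (auto simp: ab c_def)
  have "\<exists>r>0. x \<in> B \<longrightarrow> ball x r \<subseteq> B" for x
    using B(1) open_contains_ball by (metis zero_less_one)
  then obtain r where r: "\<And>x. r x > 0" "\<And>x. x \<in> B \<Longrightarrow> ball x (r x) \<subseteq> B" by metis
  have ga: "gauge (\<lambda>x. ball x (r x))" using r by (auto simp: gauge_def)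
  obtain \<D> where \<D>: "countable \<D>"
    and int: "\<And>K. K \<in> \<D> \<Longrightarrow> interior K \<noteq> {} \<and> (\<exists>c d. K = cbox c d)"
    and disj: "pairwise (\<lambda>A B. interior A \<inter> interior B = {}) \<D>"
    and near: "\<And>K. K \<in> \<D> \<Longrightarrow> \<exists>x \<in> B \<inter> K. K \<subseteq> ball x (r x)"
    and cube: "\<And>u v. cbox u v \<in> \<D> \<Longrightarrow> \<exists>n. \<forall>i \<in> Basis. v \<bullet> i - u \<bullet> i = (b \<bullet> i - a \<bullet> i) / 2^n"
    and cov: "B \<subseteq> \<Union>\<D>"
    by (rule covering_lemma[OF Bsub box ga]) blast
  have KB: "K \<subseteq> B" if "K \<in> \<D>" for K using near[OF that] r(2) by blast
  define X where "X n = (if n \<in> to_nat_on \<D> ` \<D> then from_nat_into \<D> n else {})" for n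
  have X: "X n \<in> \<D> \<or> X n = {}" for n
    unfolding X_def using \<D> by auto
  have UX: "B = (\<Union>n. X n)"
  proof
    show "B \<subseteq> (\<Union>n. X n)"
    proof
      fix x assume "x \<in> B"
      then obtain K where K: "K \<in> \<D>" "x \<in> K" using cov by auto
      then have "X (to_nat_on \<D> K) = K" using \<D> by (simp add: X_def)
      then show "x \<in> (\<Union>n. X n)" using K by blast
    qed
    show "(\<Union>n. X n) \<subseteq> B" using X KB by blast
  qed
  have le: "emeasure lborel {x \<in> S. \<phi> x \<in> X n} \<le> ?C * emeasure lborel (interior (X n))" for n
  proof (cases "X n = {}")
    case False
    then have XD: "X n \<in> \<D>" using X by blast
    then obtain u v where uv: "X n = cbox u v" using int by blast
    obtain k where k: "\<forall>i \<in> Basis. v \<bullet> i - u \<bullet> i = (b \<bullet> i - a \<bullet> i) / 2^k"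
      using cube XD uv by metis
    have "emeasure lborel {x \<in> S. \<phi> x \<in> cbox u v} \<le> ?C * emeasure lborel (box u v)"
    proof (rule emeasure_preimage_cube_le[where w = "2 * c / 2 ^ k", OF expand \<Lambda>])
      show "v \<bullet> i - u \<bullet> i = 2 * c / 2 ^ k" if "i \<in> Basis" for i using k ab that by simp
    qed (simp_all add: c_def)
    then show ?thesis by (simp add: uv interior_cbox)
  qed simp
  have dis: "disjoint_family (\<lambda>n. interior (X n))"
    unfolding disjoint_family_on_def
  proof (intro ballI impI)
    fix m n :: nat assume mn: "m \<noteq> n"
    show "interior (X m) \<inter> interior (X n) = {}"
    proof (cases "m \<in> to_nat_on \<D> ` \<D> \<and> n \<in> to_nat_on \<D> ` \<D>")
      case True
      then obtain K K' where K: "K \<in> \<D>" "K' \<in> \<D>" "m = to_nat_on \<D> K" "n = to_nat_on \<D> K'" by blast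
      then have "X m = K" "X n = K'" using \<D> by (auto simp: X_def)
      moreover have "K \<noteq> K'" using K mn by blast
      ultimately show ?thesis using disj K by (auto simp: pairwise_def)
    qed (auto simp: X_def)
  qed
  have Xb: "X n \<in> sets borel" for n using X[of n] int by (metis cbox_borel sets.empty_sets)
  have "emeasure lborel {x \<in> S. \<phi> x \<in> B} = emeasure lborel (\<Union>n. {x \<in> S. \<phi> x \<in> X n})"
    by (subst UX) (auto intro!: arg_cong[where f = "emeasure lborel"])
  also have "\<dots> \<le> (\<Sum>n. emeasure lborel {x \<in> S. \<phi> x \<in> X n})"
    by (rule emeasure_subadditive_countably) (use meas Xb in auto)
  also have "\<dots> \<le> (\<Sum>n. ?C * emeasure lborel (interior (X n)))"
    by (intro suminf_le le) auto
  also have "\<dots> = ?C * (\<Sum>n. emeasure lborel (interior (X n)))" by simp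
  also have "(\<Sum>n. emeasure lborel (interior (X n))) = emeasure lborel (\<Union>n. interior (X n))"
    by (rule suminf_emeasure[OF _ dis]) auto
  also have "?C * \<dots> \<le> ?C * emeasure lborel B"
  proof (rule mult_left_mono[OF emeasure_mono])
    show "(\<Union>n. interior (X n)) \<subseteq> B" unfolding UX using interior_subset by blast
  qed (use B in auto)
  finally show ?thesis .
qed

text \<open>Outer regularity passes from open to Borel sets; intersecting with \<open>V\<close>
  keeps the open superset bounded.\<close>

lemma emeasure_preimage_le:
  fixes \<phi> :: "'a::euclidean_space \<Rightarrow> 'a"
  assumes expand: "\<And>x x'. x \<in> S \<Longrightarrow> x' \<in> S \<Longrightarrow> norm (x - x') \<le> \<Lambda> * norm (\<phi> x - \<phi> x')"
    and \<Lambda>: "\<Lambda> \<ge> 0" and meas: "\<And>B. B \<in> sets borel \<Longrightarrow> {x \<in> S. \<phi> x \<in> B} \<in> sets borel"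
    and V: "open V" "bounded V" "\<phi> ` S \<subseteq> V" and B: "B \<in> sets borel"
  shows "emeasure lborel {x \<in> S. \<phi> x \<in> B} \<le> ennreal ((2 * \<Lambda> * DIM('a)) ^ DIM('a)) * emeasure lborel B"
proof -
  let ?C = "ennreal ((2 * \<Lambda> * DIM('a)) ^ DIM('a))"
  have le: "emeasure lborel {x \<in> S. \<phi> x \<in> B} \<le> ?C * emeasure lborel B + ?C * ennreal e" if e: "e > 0" for e :: real
  proof -
    obtain W where W: "open W" "B \<subseteq> W" "emeasure lborel (W - B) < e"
      using outer_regular_lborel[OF B e] by blast
    have "emeasure lborel {x \<in> S. \<phi> x \<in> B} \<le> emeasure lborel {x \<in> S. \<phi> x \<in> W \<inter> V}"
    proof (rule emeasure_mono)
      show "{x \<in> S. \<phi> x \<in> W \<inter> V} \<in> sets lborel" using meas[of "W \<inter> V"] W V by simp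
    qed (use W V in auto)
    also have "\<dots> \<le> ?C * emeasure lborel (W \<inter> V)"
      by (rule emeasure_preimage_open_le[OF expand \<Lambda> meas]) (use W V in auto)
    also have "\<dots> \<le> ?C * (emeasure lborel B + emeasure lborel (W - B))"
    proof (rule mult_left_mono)
      have "emeasure lborel (W \<inter> V) \<le> emeasure lborel (B \<union> (W - B))"
        using W V B by (intro emeasure_mono) auto
      also have "\<dots> \<le> emeasure lborel B + emeasure lborel (W - B)"
        using W B by (intro emeasure_subadditive) auto
      finally show "emeasure lborel (W \<inter> V) \<le> emeasure lborel B + emeasure lborel (W - B)" .
    qed simp
    also have "\<dots> \<le> ?C * (emeasure lborel B + ennreal e)"
      using W by (intro mult_left_mono add_left_mono) auto
    finally show ?thesis by (simp add: distrib_left)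
  qed
  define C where "C = (2 * \<Lambda> * DIM('a)) ^ DIM('a)"
  have C0: "C \<ge> 0" using \<Lambda> by (simp add: C_def)
  show ?thesis
  proof (rule ennreal_le_epsilon)
    fix e :: real assume e: "e > 0"
    have "emeasure lborel {x \<in> S. \<phi> x \<in> B} \<le> ?C * emeasure lborel B + ?C * ennreal (e / (C + 1))"
      using e C0 by (intro le) auto
    also have "?C * ennreal (e / (C + 1)) = ennreal (C * (e / (C + 1)))"
      using C0 e by (simp add: C_def ennreal_mult[symmetric])
    also have "C * (e / (C + 1)) \<le> e" using C0 e by (simp add: field_simps)
    finally show "emeasure lborel {x \<in> S. \<phi> x \<in> B} \<le> ?C * emeasure lborel B + ennreal e"
      by (metis add_left_mono ennreal_leI order.trans)
  qed
qed

text \<open>Takes the place of a change of variables for a map of which only a Lipschitz inverse is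
  known: the preimage estimate says that the image measure is at most a multiple of Lebesgue
  measure, and this passes to integrals of nonnegative functions.\<close>

lemma set_integral_expanding_map:
  fixes \<phi> :: "'a::euclidean_space \<Rightarrow> 'a" and w :: "'a \<Rightarrow> real"
  assumes expand: "\<And>x x'. x \<in> S \<Longrightarrow> x' \<in> S \<Longrightarrow> norm (x - x') \<le> \<Lambda> * norm (\<phi> x - \<phi> x')"
    and \<Lambda>: "\<Lambda> \<ge> 0" and S: "open S" and \<phi>: "continuous_on S \<phi>" "\<phi> ` S \<subseteq> \<Omega>"
    and \<Omega>: "open \<Omega>" "bounded \<Omega>"
    and w: "set_integrable lborel \<Omega> w" "\<And>x. x \<in> \<Omega> \<Longrightarrow> 0 \<le> w x"
  shows "set_integrable lborel S (\<lambda>x. w (\<phi> x))"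
    and "(LINT x:S|lborel. w (\<phi> x)) \<le> (2 * \<Lambda> * DIM('a)) ^ DIM('a) * (LINT x:\<Omega>|lborel. w x)"
proof -
  let ?C = "(2 * \<Lambda> * DIM('a)) ^ DIM('a)"
  define w' where "w' x = indicator \<Omega> x * w x" for x
  have w'int: "integrable lborel w'" using w by (simp add: set_integrable_def w'_def[abs_def])
  then have w'b: "w' \<in> borel_measurable borel" by auto
  have w'0: "w' x \<ge> 0" for x using w by (auto simp: w'_def indicator_def)
  have Sb: "S \<in> sets borel" using S by auto
  have \<phi>m: "\<phi> \<in> measurable (restrict_space borel S) borel"
    by (rule borel_measurable_continuous_on_restrict[OF \<phi>(1)])
  have meas: "{x \<in> S. \<phi> x \<in> B} \<in> sets borel" if "B \<in> sets borel" for B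
  proof -
    have "\<phi> -` B \<inter> space (restrict_space borel S) \<in> sets (restrict_space borel S)"
      by (rule measurable_sets[OF \<phi>m that])
    moreover have "\<phi> -` B \<inter> space (restrict_space borel S) = {x \<in> S. \<phi> x \<in> B}"
      by (auto simp: space_restrict_space)
    ultimately show ?thesis using Sb by (auto simp: sets_restrict_space_iff)
  qed
  have \<phi>ml: "\<phi> \<in> measurable (restrict_space lborel S) borel"
    using \<phi>m by (simp cong: measurable_cong_sets sets_restrict_space_cong)
  define \<mu> where "\<mu> = distr (restrict_space lborel S) borel \<phi>"
  have "\<mu> \<le> scale_measure (ennreal ?C) lborel"
  proof (subst le_measure, simp add: \<mu>_def, intro ballI)
    fix B assume "B \<in> sets \<mu>"
    then have B: "B \<in> sets borel" by (simp add: \<mu>_def)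
    have "emeasure \<mu> B = emeasure (restrict_space lborel S) {x \<in> S. \<phi> x \<in> B}"
      unfolding \<mu>_def using B \<phi>ml
      by (subst emeasure_distr) (auto simp: space_restrict_space intro!: arg_cong2[where f = emeasure])
    also have "\<dots> = emeasure lborel {x \<in> S. \<phi> x \<in> B}"
      using Sb by (intro emeasure_restrict_space) auto
    also have "\<dots> \<le> ennreal ?C * emeasure lborel B"
      by (rule emeasure_preimage_le[OF expand \<Lambda> meas \<Omega> \<phi>(2) B])
    finally show "emeasure \<mu> B \<le> emeasure (scale_measure (ennreal ?C) lborel) B" by simp
  qed
  then have "nn_integral \<mu> (\<lambda>x. ennreal (w' x)) \<le> nn_integral (scale_measure (ennreal ?C) lborel) (\<lambda>x. ennreal (w' x))"
    by (intro nn_integral_mono_measure) (auto simp: \<mu>_def)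
  also have "\<dots> = ennreal ?C * (\<integral>\<^sup>+x. ennreal (w' x) \<partial>lborel)"
    using w'b by (intro nn_integral_scale_measure) auto
  also have "(\<integral>\<^sup>+x. ennreal (w' x) \<partial>lborel) = ennreal (integral\<^sup>L lborel w')"
    using w'0 by (intro nn_integral_eq_integral w'int) auto
  also have "nn_integral \<mu> (\<lambda>x. ennreal (w' x)) = (\<integral>\<^sup>+x. ennreal (w' (\<phi> x)) \<partial>restrict_space lborel S)"
    unfolding \<mu>_def using w'b by (intro nn_integral_distr \<phi>ml) auto
  also have "\<dots> = (\<integral>\<^sup>+x. ennreal (w' (\<phi> x)) * indicator S x \<partial>lborel)"
    using Sb by (intro nn_integral_restrict_space) auto
  also have "\<dots> = (\<integral>\<^sup>+x. ennreal (indicator S x * w (\<phi> x)) \<partial>lborel)"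
    using \<phi>(2) by (intro nn_integral_cong) (auto simp: w'_def indicator_def split: if_splits)
  finally have le: "(\<integral>\<^sup>+x. ennreal (indicator S x * w (\<phi> x)) \<partial>lborel) \<le> ennreal (?C * integral\<^sup>L lborel w')"
    using \<Lambda> by (simp add: ennreal_mult' integral_nonneg w'0)
  have nn: "0 \<le> indicator S x * w (\<phi> x)" for x
    using \<phi>(2) w(2) by (auto simp: indicator_def)
  have bm: "(\<lambda>x. indicator S x * w (\<phi> x)) \<in> borel_measurable lborel"
  proof -
    have "(\<lambda>x. w' (\<phi> x)) \<in> borel_measurable (restrict_space borel S)"
      using measurable_compose[OF \<phi>m w'b] .
    then have "(\<lambda>x. w' (\<phi> x) * indicator S x) \<in> borel_measurable borel"
      using Sb by (subst (asm) borel_measurable_restrict_space_iff) (auto simp: mult.commute)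
    moreover have "w' (\<phi> x) * indicator S x = indicator S x * w (\<phi> x)" for x
      using \<phi>(2) by (auto simp: w'_def indicator_def)
    ultimately show ?thesis by simp
  qed
  have int: "integrable lborel (\<lambda>x. indicator S x * w (\<phi> x))"
  proof (rule integrableI_nonneg[OF bm])
    show "(\<integral>\<^sup>+x. ennreal (indicator S x * w (\<phi> x)) \<partial>lborel) < \<infinity>"
      by (rule order.strict_trans1[OF le]) simp
  qed (use nn in auto)
  then show "set_integrable lborel S (\<lambda>x. w (\<phi> x))"
    by (simp add: set_integrable_def)
  have "ennreal (\<integral>x. indicator S x * w (\<phi> x) \<partial>lborel) \<le> ennreal (?C * integral\<^sup>L lborel w')"
    using le nn by (subst nn_integral_eq_integral[OF int, symmetric]) auto
  moreover have "?C * integral\<^sup>L lborel w' \<ge> 0" using \<Lambda> w'0 by (simp add: integral_nonneg)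
  ultimately have "(\<integral>x. indicator S x * w (\<phi> x) \<partial>lborel) \<le> ?C * integral\<^sup>L lborel w'"
    by (simp add: ennreal_le_iff)
  then show "(LINT x:S|lborel. w (\<phi> x)) \<le> ?C * (LINT x:\<Omega>|lborel. w x)"
    by (simp add: set_lebesgue_integral_def w'_def[abs_def])
qed

section \<open>Integrals over bounded open sets\<close>

lemma set_integral_continuous_bounded:
  fixes w :: "'a::euclidean_space \<Rightarrow> real"
  assumes "open \<Omega>" "bounded \<Omega>" "continuous_on \<Omega> w" "\<And>x. x \<in> \<Omega> \<Longrightarrow> \<bar>w x\<bar> \<le> B"
  shows "set_integrable lborel \<Omega> w"
  unfolding set_integrable_def
proof (rule Bochner_Integration.integrable_bound)
  have "emeasure lborel \<Omega> < \<infinity>" using assms by (intro emeasure_bounded_finite)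
  then show "integrable lborel (\<lambda>x. indicator \<Omega> x * B)"
    using assms by (intro integrable_mult_left) (auto simp: integrable_indicator_iff)
  have "w \<in> borel_measurable (restrict_space borel \<Omega>)"
    by (rule borel_measurable_continuous_on_restrict[OF assms(3)])
  then show "(\<lambda>x. indicator \<Omega> x *\<^sub>R w x) \<in> borel_measurable lborel"
    using assms by (subst (asm) borel_measurable_restrict_space_iff) (auto simp: mult.commute)
  show "AE x in lborel. norm (indicator \<Omega> x *\<^sub>R w x) \<le> norm (indicator \<Omega> x * B)"
  proof (rule AE_I2)
    fix x show "norm (indicator \<Omega> x *\<^sub>R w x) \<le> norm (indicator \<Omega> x * B)"
      using assms(4)[of x] by (cases "x \<in> \<Omega>") auto
  qed
qed

text \<open>Discriminant argument: 2 k w \<le> w^2 + k^2 integrates to 2 k A \<le> B + V k^2 for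
  every k, and k = A / V is optimal.\<close>

lemma set_integral_Cauchy_Schwarz:
  fixes w :: "'a::euclidean_space \<Rightarrow> real"
  assumes \<Omega>: "open \<Omega>" "bounded \<Omega>" and w: "set_integrable lborel \<Omega> w"
    and w2: "set_integrable lborel \<Omega> (\<lambda>x. (w x)\<^sup>2)"
  shows "(LINT x:\<Omega>|lborel. w x) \<le> sqrt (measure lborel \<Omega>) * sqrt (LINT x:\<Omega>|lborel. (w x)\<^sup>2)"
proof -
  define V where "V = measure lborel \<Omega>"
  define A where "A = (LINT x:\<Omega>|lborel. w x)"
  define B where "B = (LINT x:\<Omega>|lborel. (w x)\<^sup>2)"
  have fin: "emeasure lborel \<Omega> < \<infinity>" using \<Omega> by (intro emeasure_bounded_finite)
  have c: "set_integrable lborel \<Omega> (\<lambda>x. k)" for k :: real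
    using fin \<Omega> by (simp add: set_integrable_def integrable_indicator_iff)
  have one: "(LINT x:\<Omega>|lborel. k) = V * k" for k :: real
    using fin by (simp add: set_lebesgue_integral_def V_def)
  have B0: "B \<ge> 0" unfolding B_def set_lebesgue_integral_def
    by (intro Bochner_Integration.integral_nonneg) auto
  have V0: "V \<ge> 0" by (simp add: V_def)
  have q: "2 * k * A \<le> B + V * k\<^sup>2" for k
  proof -
    have i1: "set_integrable lborel \<Omega> (\<lambda>x. (w x)\<^sup>2 + k\<^sup>2)" by (intro set_integral_add w2 c)
    have i2: "set_integrable lborel \<Omega> (\<lambda>x. (2 * k) * w x)" using w by (intro set_integrable_mult_right)
    have "(LINT x:\<Omega>|lborel. (2 * k) * w x) \<le> (LINT x:\<Omega>|lborel. (w x)\<^sup>2 + k\<^sup>2)"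
    proof (rule set_integral_mono[OF i2 i1])
      show "2 * k * w x \<le> (w x)\<^sup>2 + k\<^sup>2" for x using sum_squares_bound[of "w x" k] by (simp add: mult_ac)
    qed
    also have "\<dots> = B + V * k\<^sup>2" using w2 c by (subst set_integral_add) (auto simp: one B_def)
    finally show ?thesis by (simp add: A_def)
  qed
  have "A \<le> sqrt (V * B)"
  proof (cases "A \<le> 0")
    case True
    then show ?thesis using V0 B0 by (meson mult_nonneg_nonneg order_trans real_sqrt_ge_zero)
  next
    case False
    have Vpos: "V > 0"
    proof (rule ccontr)
      assume "\<not> V > 0"
      then have "V = 0" using V0 by simp
      \<comment> \<open>For V = 0 the inequality is linear in k, and this k makes its left side B +
        1.\<close>
      then have "2 * ((B + 1) / (2 * A)) * A \<le> B" using q[of "(B + 1) / (2 * A)"] by simp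
      then show False using False by simp
    qed
    have "2 * (A / V) * A \<le> B + V * (A / V)\<^sup>2" by (rule q)
    then have "A\<^sup>2 \<le> V * B" using Vpos by (simp add: power2_eq_square field_simps)
    then show ?thesis by (rule real_le_rsqrt)
  qed
  then show ?thesis by (simp add: A_def B_def V_def real_sqrt_mult)
qed

subsection \<open>Coefficients of the inverse modified equation\<close>

context
  fixes M :: nat and \<alpha> \<beta> :: "nat \<Rightarrow> real"
begin

definition alpha_moment :: "nat \<Rightarrow> real" where
  "alpha_moment k = (\<Sum>m\<le>M. \<alpha> m * (real m ^ (k + 1) / fact (k + 1)))"

definition beta_moment :: "nat \<Rightarrow> real" where
  "beta_moment k = (\<Sum>m\<le>M. \<beta> m * (real m ^ k / fact k))"

text \<open>The Cauchy product equation between the two moment series, solved for its last unknown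
  under the normalisation that the \<beta> moment of order 0 is 1.\<close>

fun imde_coeff :: "nat \<Rightarrow> real" where
  "imde_coeff k = alpha_moment k - (\<Sum>j\<in>{1..k}. beta_moment j * imde_coeff (k - j))"

declare imde_coeff.simps [simp del]

text \<open>Order p means that the two moment series agree below order p, so their quotient is 1 +
  O(z^p).\<close>

lemma imde_coeff_eq_0:
  assumes ord: "has_order M \<alpha> \<beta> p" and \<beta>: "(\<Sum>m\<le>M. \<beta> m) = 1"
  shows "imde_coeff 0 = 1" and "1 \<le> k \<Longrightarrow> k < p \<Longrightarrow> imde_coeff k = 0"
proof -
  have ab: "alpha_moment k = beta_moment k" if "k < p" for k
    using ord that unfolding has_order_def alpha_moment_def beta_moment_def by (simp add: mult.commute)
  have b0: "beta_moment 0 = 1" using \<beta> by (simp add: beta_moment_def)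
  have "p \<ge> 1" using ord by (simp add: has_order_def)
  then show c0: "imde_coeff 0 = 1" using ab[of 0] b0 by (subst imde_coeff.simps) simp
  show "imde_coeff k = 0" if "1 \<le> k" "k < p"
    using that
  proof (induction k rule: less_induct)
    case (less k)
    have "(\<Sum>j\<in>{1..k}. beta_moment j * imde_coeff (k - j)) = (\<Sum>j\<in>{1..k}. if j = k then beta_moment k else 0)"
    proof (rule sum.cong)
      fix j assume "j \<in> {1..k}"
      then have "j \<noteq> k \<Longrightarrow> imde_coeff (k - j) = 0"
        using less.prems by (intro less.IH) auto
      then show "beta_moment j * imde_coeff (k - j) = (if j = k then beta_moment k else 0)"
        using c0 by simp
    qed simp
    also have "\<dots> = beta_moment k" using less.prems by simp
    finally show ?case using ab[of k] less.prems by (subst imde_coeff.simps) (simp only: diff_self)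
  qed
qed

lemma power_div_fact_le_exp: "x \<ge> 0 \<Longrightarrow> x ^ k / fact k \<le> exp (x::real)"
proof -
  assume x: "x \<ge> 0"
  have "(\<Sum>n\<in>{k}. x ^ n /\<^sub>R fact n) \<le> (\<Sum>n. x ^ n /\<^sub>R fact n)"
    by (rule sum_le_suminf[OF summable_exp_generic]) (use x in auto)
  then show ?thesis by (simp add: exp_def divide_inverse mult.commute)
qed

text \<open>A power series with constant term 1 and bounded coefficients has a reciprocal of
  geometric coefficient growth. In the induction, B \<Sum> (1 + B)^i = (1 + B)^k - 1 absorbs the
  inhomogeneity \<open>A\<close> exactly.\<close>

lemma abs_imde_coeff_le:
  "\<exists>A B. A > 0 \<and> B \<ge> 1 \<and> (\<forall>k. \<bar>imde_coeff k\<bar> \<le> A * B ^ k)"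
proof -
  define A where "A = (\<Sum>m\<le>M. \<bar>\<alpha> m\<bar> * exp (real m)) + 1"
  define B where "B = (\<Sum>m\<le>M. \<bar>\<beta> m\<bar> * exp (real m))"
  have A: "A > 0" unfolding A_def by (intro add_nonneg_pos sum_nonneg) auto
  have B: "B \<ge> 0" unfolding B_def by (intro sum_nonneg) auto
  have a: "\<bar>alpha_moment k\<bar> \<le> A" for k
  proof -
    have "\<bar>alpha_moment k\<bar> \<le> (\<Sum>m\<le>M. \<bar>\<alpha> m\<bar> * (real m ^ (k + 1) / fact (k + 1)))"
      unfolding alpha_moment_def by (rule order.trans[OF sum_abs]) (simp add: abs_mult)
    also have "\<dots> \<le> (\<Sum>m\<le>M. \<bar>\<alpha> m\<bar> * exp (real m))"
      by (intro sum_mono mult_left_mono power_div_fact_le_exp) auto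
    finally show ?thesis by (simp add: A_def)
  qed
  have b: "\<bar>beta_moment k\<bar> \<le> B" for k
  proof -
    have "\<bar>beta_moment k\<bar> \<le> (\<Sum>m\<le>M. \<bar>\<beta> m\<bar> * (real m ^ k / fact k))"
      unfolding beta_moment_def by (rule order.trans[OF sum_abs]) (simp add: abs_mult)
    also have "\<dots> \<le> B"
      unfolding B_def by (intro sum_mono mult_left_mono power_div_fact_le_exp) auto
    finally show ?thesis .
  qed
  have "\<bar>imde_coeff k\<bar> \<le> A * (1 + B) ^ k" for k
  proof (induction k rule: less_induct)
    case (less k)
    have "\<bar>imde_coeff k\<bar> \<le> \<bar>alpha_moment k\<bar> + (\<Sum>j\<in>{1..k}. \<bar>beta_moment j\<bar> * \<bar>imde_coeff (k - j)\<bar>)"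
      unfolding imde_coeff.simps[of k]
      using sum_abs[of "\<lambda>j. beta_moment j * imde_coeff (k - j)" "{1..k}"] by (simp add: abs_mult)
    also have "\<dots> \<le> A + (\<Sum>j\<in>{1..k}. B * (A * (1 + B) ^ (k - j)))"
      by (intro add_mono a sum_mono mult_mono b less.IH) (use B in auto)
    also have "(\<Sum>j\<in>{1..k}. B * (A * (1 + B) ^ (k - j))) = (\<Sum>i<k. B * (A * (1 + B) ^ i))"
      by (rule sum.reindex_bij_witness[of _ "\<lambda>i. k - i" "\<lambda>j. k - j"]) auto
    also have "\<dots> = A * (B * (\<Sum>i<k. (1 + B) ^ i))"
      by (simp add: sum_distrib_left mult_ac)
    also have "B * (\<Sum>i<k. (1 + B) ^ i) = (1 + B) ^ k - 1"
      using power_diff_1_eq[of "1 + B" k] by simp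
    finally show ?case by (simp add: algebra_simps)
  qed
  then show ?thesis using A B by (intro exI[of _ A] exI[of _ "1 + B"]) auto
qed

section \<open>Filters acting on Taylor polynomials\<close>

definition filter_fps :: "nat \<Rightarrow> (nat \<Rightarrow> real) \<Rightarrow> nat \<Rightarrow> real fps" where
  "filter_fps d P J = (\<Sum>j\<le>d. fps_const (P j) * fps_exp (real j - real J))"

lemma fps_nth_filter_mult:
  "fps_nth (filter_fps d P J * (\<Sum>m\<le>M. fps_const (\<gamma> m) * fps_exp (real m))) k
     = (\<Sum>j\<le>d. \<Sum>m\<le>M. P j * \<gamma> m * ((real j + real m - real J) ^ k / fact k))"
proof -
  have "filter_fps d P J * (\<Sum>m\<le>M. fps_const (\<gamma> m) * fps_exp (real m))
    = (\<Sum>j\<le>d. \<Sum>m\<le>M. fps_const (P j * \<gamma> m) * fps_exp (real j + real m - real J))"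
  proof -
    have "(fps_const (P j) * fps_exp (real j - real J)) * (fps_const (\<gamma> m) * fps_exp (real m))
        = fps_const (P j * \<gamma> m) * fps_exp (real j + real m - real J)" for j m
    proof -
      have "(fps_const (P j) * fps_exp (real j - real J)) * (fps_const (\<gamma> m) * fps_exp (real m))
          = (fps_const (P j) * fps_const (\<gamma> m)) * (fps_exp (real j - real J) * fps_exp (real m))"
        by (simp only: mult_ac)
      then show ?thesis by (simp add: fps_exp_add_mult[symmetric])
    qed
    then show ?thesis by (simp only: filter_fps_def sum_product)
  qed
  then show ?thesis by (simp add: fps_sum_nth)
qed

text \<open>A combination of shifts sees the monomial of degree k only through its k-th moment,
  scaled by \<open>h ^ k\<close>. This carries identities of power series over to Taylor
  polynomials.\<close>

lemma filter_polynomial: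
  "(\<Sum>j\<le>d. \<Sum>m\<le>M. P j * \<gamma> m * (\<Sum>k<N. c k / fact k * ((real j + real m - real J) * h) ^ k))
     = (\<Sum>k<N. c k * h ^ k * fps_nth (filter_fps d P J * (\<Sum>m\<le>M. fps_const (\<gamma> m) * fps_exp (real m))) k)"
proof -
  have "(\<Sum>j\<le>d. \<Sum>m\<le>M. P j * \<gamma> m * (\<Sum>k<N. c k / fact k * ((real j + real m - real J) * h) ^ k))
     = (\<Sum>j\<le>d. \<Sum>m\<le>M. \<Sum>k<N. c k * h ^ k * (P j * \<gamma> m * ((real j + real m - real J) ^ k / fact k)))"
  proof -
    have "P j * \<gamma> m * (c k / fact k * (x * h) ^ k) = c k * h ^ k * (P j * \<gamma> m * (x ^ k / fact k))" for j m k x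
      by (simp add: power_mult_distrib)
    then show ?thesis by (simp only: sum_distrib_left)
  qed
  also have "\<dots> = (\<Sum>k<N. \<Sum>j\<le>d. \<Sum>m\<le>M. c k * h ^ k * (P j * \<gamma> m * ((real j + real m - real J) ^ k / fact k)))"
    by (subst sum.swap[of _ "{..<N}"], subst sum.swap[of _ "{..<N}"]) simp
  finally show ?thesis unfolding fps_nth_filter_mult unfolding sum_distrib_left .
qed

text \<open>The \<alpha> series is \<open>fps_X * A\<close> and \<open>A = B * C\<close>. Below
  order \<open>N\<close> the filter cancels \<open>B\<close> and leaves \<open>fps_X * C\<close>;
  the factor \<open>fps_X\<close> is the shift of the index by one.\<close>

lemma filter_alpha_nth:
  assumes \<alpha>: "(\<Sum>m\<le>M. \<alpha> m) = 0" and \<beta>: "(\<Sum>m\<le>M. \<beta> m) = 1"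
    and P: "\<And>k. k < N \<Longrightarrow> fps_nth (filter_fps d P J * (\<Sum>m\<le>M. fps_const (\<beta> m) * fps_exp (real m))) k = of_bool (k = 0)"
  shows "fps_nth (filter_fps d P J * (\<Sum>m\<le>M. fps_const (\<alpha> m) * fps_exp (real m))) 0 = 0"
    and "k < N \<Longrightarrow> fps_nth (filter_fps d P J * (\<Sum>m\<le>M. fps_const (\<alpha> m) * fps_exp (real m))) (Suc k) = imde_coeff k"
proof -
  define A B C where "A = Abs_fps alpha_moment" and "B = Abs_fps beta_moment" and "C = Abs_fps imde_coeff"
  define E where "E = (\<Sum>m\<le>M. fps_const (\<alpha> m) * fps_exp (real m))"
  define \<phi> where "\<phi> = filter_fps d P J"
  have E: "E = fps_X * A"
  proof (rule fps_ext)
    fix k show "fps_nth E k = fps_nth (fps_X * A) k"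
      using \<alpha> by (cases k) (auto simp: E_def A_def fps_sum_nth alpha_moment_def simp del: fact_Suc power_Suc)
  qed
  have B: "(\<Sum>m\<le>M. fps_const (\<beta> m) * fps_exp (real m)) = B"
    by (rule fps_ext) (simp add: fps_sum_nth B_def beta_moment_def)
  have BC: "B * C = A"
  proof (rule fps_ext)
    fix k
    have "fps_nth (B * C) k = (\<Sum>j\<in>{0..k}. beta_moment j * imde_coeff (k - j))"
      by (simp add: fps_mult_nth B_def C_def)
    also have "\<dots> = beta_moment 0 * imde_coeff k + (\<Sum>j\<in>{1..k}. beta_moment j * imde_coeff (k - j))"
      by (simp add: sum.atLeast_Suc_atMost)
    also have "\<dots> = alpha_moment k"
      using \<beta> imde_coeff.simps[of k] by (simp add: beta_moment_def[of 0])
    finally show "fps_nth (B * C) k = fps_nth A k" by (simp add: A_def)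
  qed
  have "fps_nth (\<phi> * E) 0 = 0" by (simp add: E)
  then show "fps_nth (filter_fps d P J * (\<Sum>m\<le>M. fps_const (\<alpha> m) * fps_exp (real m))) 0 = 0"
    by (simp only: \<phi>_def E_def)
  assume k: "k < N"
  have "\<phi> * E = fps_X * ((\<phi> * B) * C)" by (simp only: E BC[symmetric] mult_ac)
  then have "fps_nth (\<phi> * E) (Suc k) = fps_nth (fps_X * ((\<phi> * B) * C)) (Suc k)" by (simp only:)
  also have "\<dots> = fps_nth ((\<phi> * B) * C) k" by simp
  also have "\<dots> = (\<Sum>i=0..k. of_bool (i = 0) * imde_coeff (k - i))"
    unfolding fps_mult_nth[of "\<phi> * B"] using P k by (intro sum.cong) (auto simp: \<phi>_def B C_def)
  also have "\<dots> = imde_coeff k" by (simp add: sum.atLeast_Suc_atMost)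
  finally show "fps_nth (filter_fps d P J * (\<Sum>m\<le>M. fps_const (\<alpha> m) * fps_exp (real m))) (Suc k) = imde_coeff k"
    by (simp only: \<phi>_def E_def)
qed

lemma lie_power_differentiable:
  fixes f g :: "real ^ 'n \<Rightarrow> real ^ 'n"
  assumes "open \<Omega>" "partials_differentiable N \<Omega> f" "partials_differentiable N \<Omega> g" "k < N" "y \<in> \<Omega>"
  shows "(lie_deriv f ^^ k) g differentiable (at y)"
proof -
  have "partials_differentiable (N - k) \<Omega> ((lie_deriv f ^^ k) g)"
    by (rule partials_differentiable_lie_power) (use assms in auto)
  moreover have "length ([] :: 'n list) < N - k" using assms(4) by simp
  ultimately have "partials ((lie_deriv f ^^ k) g) [] differentiable (at y)"
    using assms(5) unfolding partials_differentiable_def by blast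
  then show ?thesis by simp
qed

lemma smooth_map_partials: "smooth_map f \<Longrightarrow> partials_differentiable N \<Omega> f"
  unfolding partials_differentiable_def partials_def
  by (auto intro: smooth_map_iterated_deriv_differentiable)

lemma imde_term_eq:
  fixes f :: "real ^ 'n \<Rightarrow> real ^ 'n"
  assumes sm: "smooth_map f"
  shows "imde_term M \<alpha> \<beta> f k = (\<lambda>y. imde_coeff k *\<^sub>R (lie_deriv f ^^ k) f y)"
proof (induction k rule: less_induct)
  case (less k)
  have diff: "(lie_deriv f ^^ i) f differentiable (at y)" for i y
    by (rule lie_power_differentiable[OF open_UNIV smooth_map_partials[OF sm] smooth_map_partials[OF sm], of i "Suc i"]) auto
  \<comment> \<open>Lie derivatives of a multiple of an iterate are multiples of a later iterate, so
    every summand of the recursion is a multiple of the same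
    \<open>(lie_deriv f ^^ k) f\<close>.\<close>
  have scale: "(lie_deriv f ^^ j) (\<lambda>y. c *\<^sub>R (lie_deriv f ^^ i) f y) = (\<lambda>y. c *\<^sub>R (lie_deriv f ^^ (j + i)) f y)" for c i j
  proof (induction j)
    case (Suc j)
    have "lie_deriv f (\<lambda>y. c *\<^sub>R (lie_deriv f ^^ (j + i)) f y) y = c *\<^sub>R lie_deriv f ((lie_deriv f ^^ (j + i)) f) y" for y
    proof -
      have "((lie_deriv f ^^ (j + i)) f has_derivative frechet_derivative ((lie_deriv f ^^ (j + i)) f) (at y)) (at y)"
        using diff frechet_derivative_works by blast
      from frechet_derivative_at[OF has_derivative_scaleR_right[OF this, of c], symmetric]
      show ?thesis by (simp add: lie_deriv_def)
    qed
    then show ?case unfolding funpow.simps o_apply Suc add_Suc by (rule ext)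
  qed simp
  have "imde_term M \<alpha> \<beta> f k y = imde_coeff k *\<^sub>R (lie_deriv f ^^ k) f y" for y
  proof -
    have "(\<Sum>m\<le>M. \<beta> m *\<^sub>R (\<Sum>j\<in>{1..k}. (real m ^ j / fact j) *\<^sub>R (lie_deriv f ^^ j) (imde_term M \<alpha> \<beta> f (k - j)) y))
        = (\<Sum>m\<le>M. \<Sum>j\<in>{1..k}. (\<beta> m * (real m ^ j / fact j) * imde_coeff (k - j)) *\<^sub>R (lie_deriv f ^^ k) f y)"
      unfolding scaleR_sum_right
      by (intro sum.cong refl) (simp add: less.IH scale)
    also have "\<dots> = (\<Sum>j\<in>{1..k}. beta_moment j * imde_coeff (k - j)) *\<^sub>R (lie_deriv f ^^ k) f y"
      by (subst sum.swap) (simp add: beta_moment_def sum_distrib_right scaleR_sum_left)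
    finally show ?thesis
      by (simp add: imde_term.simps[of _ _ _ _ k] imde_coeff.simps[of k] alpha_moment_def scaleR_sum_left scaleR_diff_left)
  qed
  then show ?case by (rule ext)
qed

end

subsection \<open>Taylor expansion along trajectories\<close>

text \<open>Along a trajectory the time derivative of \<open>u k\<close> is
  \<open>u (Suc k)\<close>, so this is the Taylor formula with Lagrange remainder, one component at
  a time. The sequence \<open>u\<close> is left general to cover both a vector field and the state
  itself.\<close>

lemma taylor_along_solution:
  fixes f :: "real ^ 'n \<Rightarrow> real ^ 'n" and u :: "nat \<Rightarrow> real ^ 'n \<Rightarrow> real ^ 'n"
  assumes Y: "\<And>t. \<bar>t\<bar> \<le> \<tau> \<Longrightarrow> (Y has_vector_derivative f (Y t)) (at t)" "\<And>t. \<bar>t\<bar> \<le> \<tau> \<Longrightarrow> Y t \<in> \<Omega>"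
    and u: "\<And>k y. k < N \<Longrightarrow> y \<in> \<Omega> \<Longrightarrow> u k differentiable (at y)"
      "\<And>k y. k < N \<Longrightarrow> y \<in> \<Omega> \<Longrightarrow> u (Suc k) y = lie_deriv f (u k) y"
    and B: "\<And>y. y \<in> \<Omega> \<Longrightarrow> l1_norm (u N y) \<le> fact N * B" and N: "N > 0" and t: "\<bar>t\<bar> \<le> \<tau>"
  shows "\<bar>u 0 (Y t) $ i - (\<Sum>k<N. u k (Y 0) $ i / fact k * t ^ k)\<bar> \<le> B * \<bar>t\<bar> ^ N"
proof -
  have B0: "B \<ge> 0"
  proof -
    have "0 \<le> l1_norm (u N (Y t))" by simp
    also have "\<dots> \<le> fact N * B" by (rule B) (use Y t in auto)
    finally show ?thesis
      using fact_gt_zero[of N, where ?'a = real] by (auto simp: zero_le_mult_iff)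
  qed
  show ?thesis
  proof (cases "t = 0")
    case True
    have "(\<Sum>k<N. u k (Y 0) $ i / fact k * t ^ k) = (\<Sum>k<N. if k = 0 then u 0 (Y 0) $ i else 0)"
      by (rule sum.cong) (auto simp: True)
    then show ?thesis using N True B0 by simp
  next
    case False
    define w where "w k t = u k (Y t) $ i" for k t
    have "\<exists>s. (if t < 0 then t < s \<and> s < 0 else 0 < s \<and> s < t) \<and>
      w 0 t = (\<Sum>k<N. w k 0 / fact k * (t - 0) ^ k) + w N s / fact N * (t - 0) ^ N"
    proof (rule Taylor[of _ _ _ "- \<tau>" \<tau>])
      show "\<forall>m s. m < N \<and> - \<tau> \<le> s \<and> s \<le> \<tau> \<longrightarrow> DERIV (w m) s :> w (Suc m) s"
      proof (intro allI impI, elim conjE)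
        fix m s assume m: "m < N" and s: "- \<tau> \<le> s" "s \<le> \<tau>"
        have sa: "\<bar>s\<bar> \<le> \<tau>" using s by simp
        define L where "L = frechet_derivative (u m) (at (Y s))"
        have L: "(u m has_derivative L) (at (Y s))"
          unfolding L_def using u(1)[OF m Y(2)[OF sa]] frechet_derivative_works by blast
        have "((\<lambda>t. u m (Y t)) has_derivative (\<lambda>h. L (h *\<^sub>R f (Y s)))) (at s)"
          using has_derivative_compose[OF Y(1)[OF sa, unfolded has_vector_derivative_def] L] .
        then have "(w m has_derivative (\<lambda>h. L (h *\<^sub>R f (Y s)) $ i)) (at s)"
          unfolding w_def[abs_def] by (rule bounded_linear.has_derivative[OF bounded_linear_vec_nth])
        moreover have "L (h *\<^sub>R f (Y s)) $ i = h * w (Suc m) s" for h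
          using linear_cmul[OF has_derivative_linear[OF L], of h "f (Y s)"] u(2)[OF m Y(2)[OF sa]]
          by (simp add: w_def L_def lie_deriv_def)
        ultimately show "DERIV (w m) s :> w (Suc m) s"
          by (intro has_derivative_imp_has_field_derivative) auto
      qed
    qed (use N t False in auto)
    then obtain s where st: "if t < 0 then t < s \<and> s < 0 else 0 < s \<and> s < t"
      and s2: "w 0 t = (\<Sum>k<N. w k 0 / fact k * t ^ k) + w N s / fact N * t ^ N"
      unfolding diff_0_right by blast
    have s: "\<bar>s\<bar> \<le> \<bar>t\<bar>" using st by (auto split: if_splits)
    have "\<bar>w N s\<bar> \<le> l1_norm (u N (Y s))"
      unfolding w_def l1_norm_def real_norm_def[symmetric] by (rule member_le_sum) auto
    also have "\<dots> \<le> fact N * B" by (rule B) (use Y s t in auto)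
    finally have "\<bar>w N s / fact N\<bar> \<le> B" by (simp add: field_simps)
    then have "\<bar>w N s / fact N * t ^ N\<bar> \<le> B * \<bar>t\<bar> ^ N"
      unfolding abs_mult power_abs by (rule mult_right_mono) simp
    then show ?thesis using s2 by (simp add: w_def)
  qed
qed

text \<open>Continuity on the whole space is what the network structure contributes: the residual
  evaluates the network at flow images that may lie outside the set on which its derivatives are
  bounded.\<close>

lemma feedforward_network_continuous:
  assumes "g \<in> feedforward_networks"
  shows "continuous_on UNIV (g :: real ^ 'n \<Rightarrow> real ^ 'm)"
proof -
  have hid: "continuous_on UNIV (\<lambda>x. z x i)" if "hidden_layer w z" for w i and z :: "real ^ 'n \<Rightarrow> nat \<Rightarrow> real"
    using that
  proof (induction arbitrary: i)
    case (first_layer \<sigma> w W b)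
    show ?case by (rule continuous_on_compose2[OF first_layer]) (auto intro!: continuous_intros)
  next
    case (deeper_layer v z \<sigma> w W b)
    show ?case
      by (rule continuous_on_compose2[OF deeper_layer(2)]) (auto intro!: continuous_intros deeper_layer.IH)
  qed
  obtain w z W b where wz: "hidden_layer w z" "g = (\<lambda>x. \<chi> i. (\<Sum>j<w. W i j * z x j) + b i)"
    using assms unfolding feedforward_networks_def by blast
  show ?thesis unfolding wz(2)
    by (intro continuous_on_vec_lambda continuous_intros hid[OF wz(1)])
qed

subsection \<open>Learning from an analytic vector field\<close>

lemma nbhd_eq_Un: "nbhd K R = (\<Union>v\<in>{v. l1_norm v \<le> R}. (\<lambda>x. v + x) ` K)"
proof (intro set_eqI iffI)
  fix y assume "y \<in> nbhd K R"
  then obtain x where "x \<in> K" "l1_norm (y - x) \<le> R" by (auto simp: nbhd_def)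
  then show "y \<in> (\<Union>v\<in>{v. l1_norm v \<le> R}. (\<lambda>x. v + x) ` K)"
    by (intro UN_I[of "y - x"]) (auto intro!: image_eqI[of _ _ x])
next
  fix y assume "y \<in> (\<Union>v\<in>{v. l1_norm v \<le> R}. (\<lambda>x. v + x) ` K)"
  then obtain v x where "l1_norm v \<le> R" "x \<in> K" "y = v + x" by blast
  then show "y \<in> nbhd K R" unfolding nbhd_def by (intro UN_I[of x]) auto
qed

lemma open_nbhd: "open K \<Longrightarrow> open (nbhd K R)"
  unfolding nbhd_eq_Un by (intro open_UN ballI open_translation)

lemma bounded_nbhd: "bounded K \<Longrightarrow> bounded (nbhd K R)"
proof -
  assume "bounded K"
  then obtain B where B: "\<And>x. x \<in> K \<Longrightarrow> norm x \<le> B" by (meson bounded_iff)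
  have "norm y \<le> R + B" if y: "y \<in> nbhd K R" for y
  proof -
    obtain x where "x \<in> K" "l1_norm (y - x) \<le> R" using y by (auto simp: nbhd_def)
    then show ?thesis
      using B[of x] norm_le_l1_norm[of "y - x"] norm_triangle_sub[of y x] by linarith
  qed
  then show ?thesis by (meson bounded_iff)
qed

text \<open>The l1-ball of radius \<open>R\<close> contains a cube of half-side R / D, where D is
  the dimension. Read backwards, a prescribed volume bounds \<open>R\<close> from above.\<close>

lemma measure_nbhd_ge:
  fixes K :: "(real ^ 'n) set"
  assumes "K \<noteq> {}" "open K" "bounded K" "R > 0"
  shows "(2 * R / real CARD('n)) ^ CARD('n) \<le> measure lborel (nbhd K R)"
proof -
  obtain x where x: "x \<in> K" using assms by blast
  define c where "c = R / real CARD('n)"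
  have c: "c > 0" using assms by (simp add: c_def)
  define a b where "a = x - c *\<^sub>R One" and "b = x + c *\<^sub>R One"
  have ab: "a \<bullet> i = x \<bullet> i - c" "b \<bullet> i = x \<bullet> i + c" if "i \<in> Basis" for i
    using that by (auto simp: a_def b_def inner_diff_left inner_add_left)
  have "cbox a b \<subseteq> nbhd K R"
  proof
    fix y assume y: "y \<in> cbox a b"
    have "norm ((y - x) $ i) \<le> c" for i
    proof -
      have B: "axis i 1 \<in> (Basis :: (real ^ 'n) set)" by simp
      have "a \<bullet> axis i 1 \<le> y \<bullet> axis i 1" "y \<bullet> axis i 1 \<le> b \<bullet> axis i 1"
        using y B unfolding mem_box by blast+
      then show ?thesis unfolding ab[OF B] by (simp add: inner_axis)
    qed
    then have "l1_norm (y - x) \<le> (\<Sum>i\<in>(UNIV::'n set). c)"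
      unfolding l1_norm_def by (intro sum_mono)
    then show "y \<in> nbhd K R" using x by (auto simp: nbhd_def c_def)
  qed
  then have "measure lborel (cbox a b) \<le> measure lborel (nbhd K R)"
    using open_nbhd[OF assms(2)] bounded_nbhd[OF assms(3), of R]
    by (intro measure_mono_fmeasurable) (auto intro!: fmeasurableI emeasure_bounded_finite)
  moreover have "measure lborel (cbox a b) = (\<Prod>i\<in>(Basis :: (real ^ 'n) set). 2 * c)"
    using c by (subst measure_lborel_cbox_eq) (auto simp: ab inner_diff_left intro!: prod.cong)
  ultimately show ?thesis by (simp add: c_def)
qed

locale lmm_learning =
  fixes M :: nat and \<alpha> \<beta> :: "nat \<Rightarrow> real" and Q R r D :: real
    and K :: "(real ^ 'n) set" and f :: "real ^ 'n \<Rightarrow> real ^ 'n"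
  assumes Q_pos: "Q > 0" and R: "R > 0" and r: "r > 0"
    and K: "open K" "bounded K"
    and smooth: "smooth_map f" and analytic: "analytic_bounded Q r (nbhd K R) f"
    and sum_\<alpha>: "(\<Sum>m\<le>M. \<alpha> m) = 0" and sum_\<beta>: "(\<Sum>m\<le>M. \<beta> m) = 1"
    and D: "D = real CARD('n)"
begin

abbreviation "\<Omega> \<equiv> nbhd K R"

text \<open>Half of the analyticity radius is spent here, which leaves \<open>r / 2\<close> for
  Cauchy estimates at the points of this set.\<close>

definition U :: "(real ^ 'n) set" where
  "U = {y. \<exists>x\<in>\<Omega>. l1_norm (y - x) \<le> r / 2}"

lemma D_pos: "D > 0"
  by (simp add: D)

lemma l1_norm_le_D: "l1_norm (x :: real ^ 'n) \<le> D * norm x"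
  unfolding D by (rule l1_norm_le_norm)

lemma f_le_Q: "y \<in> U \<Longrightarrow> l1_norm (f y) \<le> Q"
proof -
  assume "y \<in> U"
  then obtain x where x: "x \<in> \<Omega>" "l1_norm (y - x) \<le> r / 2" by (auto simp: U_def)
  have "l1_norm (iterated_deriv f [] y) \<le> fact (length ([] :: (real ^ 'n) list)) * Q / (r / 2 / 3) ^ length ([] :: (real ^ 'n) list)"
    by (rule analytic_bounded_iterated_deriv_le[OF smooth analytic _ _ x(1)]) (use Q_pos r x in auto)
  then show ?thesis by simp
qed

text \<open>\<open>U\<close> may fail to be convex. Points at l1-distance at most r/4 are joined by
  a segment within 3r/4 of a point of \<open>\<Omega>\<close>, where the Cauchy estimate with radius
  r/4 bounds the derivative by 12 Q / r; for points further apart |f u - f v| \<le> 2 Q is enough.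
  \<open>D\<close> bounds the l1-norm by the Euclidean one.\<close>

lemma f_lipschitz: "(12 * D * Q / r)-lipschitz_on U f"
proof (rule lipschitz_onI)
  fix u v assume u: "u \<in> U" and v: "v \<in> U"
  show "dist (f u) (f v) \<le> 12 * D * Q / r * dist u v"
  proof (cases "l1_norm (v - u) \<le> r / 4")
    case True
    obtain x where x: "x \<in> \<Omega>" "l1_norm (u - x) \<le> r / 2" using u by (auto simp: U_def)
    define a where "a = l1_norm (v - u)"
    have "norm (f (u + 1 *\<^sub>R (v - u)) - f (u + 0 *\<^sub>R (v - u))) \<le> (12 * Q / r * a) * \<bar>1 - 0\<bar>"
    proof (rule norm_diff_le_vector_derivative[where S = "{0..1}"])
      fix s :: real assume s: "s \<in> {0..1}"
      define w where "w = u + s *\<^sub>R (v - u)"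
      define L where "L = frechet_derivative f (at w)"
      have L: "(f has_derivative L) (at w)"
        unfolding L_def using smooth_map_iterated_deriv_differentiable[OF smooth, of "[]" w] frechet_derivative_works by auto
      have lin: "linear L" using L by (rule has_derivative_linear)
      have "((\<lambda>s. u + s *\<^sub>R (v - u)) has_derivative (\<lambda>s. s *\<^sub>R (v - u))) (at s within {0..1})"
        by (auto intro!: derivative_eq_intros)
      from has_derivative_compose[OF this L[unfolded w_def]]
      show "((\<lambda>s. f (u + s *\<^sub>R (v - u))) has_vector_derivative L (v - u)) (at s within {0..1})"
        by (simp add: has_vector_derivative_def linear_cmul[OF lin])
      show "norm (L (v - u)) \<le> 12 * Q / r * a"
      proof (cases "a = 0")
        case True
        then have "norm (v - u) \<le> 0" using norm_le_l1_norm[of "v - u"] by (simp add: a_def)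
        then show ?thesis using True linear_0[OF lin] by simp
      next
        case False
        then have a: "a > 0" unfolding a_def using l1_norm_nonneg[of "v - u"] by linarith
        define e where "e = (1 / a) *\<^sub>R (v - u)"
        have ve: "v - u = a *\<^sub>R e" using a by (simp add: e_def)
        have "l1_norm e = 1" using a by (simp add: e_def l1_norm_scaleR flip: a_def)
        moreover have "l1_norm (w - x) \<le> l1_norm (u - x) + l1_norm (s *\<^sub>R (v - u))"
          unfolding w_def using l1_norm_triangle[of "u - x" "s *\<^sub>R (v - u)"] by (simp add: algebra_simps)
        moreover have "l1_norm (s *\<^sub>R (v - u)) \<le> 1 * (r / 4)"
          unfolding l1_norm_scaleR by (rule mult_mono) (use s \<open>l1_norm (v - u) \<le> r / 4\<close> in auto)
        ultimately have "l1_norm (iterated_deriv f [e] w) \<le> fact (length [e]) * Q / (r / 4 / 3) ^ length [e]"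
          by (intro analytic_bounded_iterated_deriv_le[OF smooth analytic _ _ x(1)]) (use Q_pos r x in auto)
        then have "l1_norm (L e) \<le> 12 * Q / r" by (simp add: L_def mult.commute)
        then have "norm (L e) \<le> 12 * Q / r" using norm_le_l1_norm order.trans by blast
        then have "a * norm (L e) \<le> a * (12 * Q / r)" using a by (intro mult_left_mono) auto
        then show ?thesis unfolding ve linear_cmul[OF lin] using a by (simp add: mult.commute)
      qed
    qed auto
    then have "norm (f v - f u) \<le> 12 * Q / r * a" by simp
    also have "\<dots> \<le> 12 * Q / r * (D * norm (v - u))"
      unfolding a_def using Q_pos r by (intro mult_left_mono l1_norm_le_D) auto
    finally show ?thesis by (simp add: dist_norm norm_minus_commute mult_ac)
  next
    case False
    then have far: "r / 4 \<le> D * norm (v - u)" using l1_norm_le_D[of "v - u"] by linarith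
    have "norm (f u - f v) \<le> Q + Q"
      using norm_triangle_ineq4[of "f u" "f v"] f_le_Q[OF u] f_le_Q[OF v] norm_le_l1_norm[of "f u"] norm_le_l1_norm[of "f v"]
      by linarith
    also have "\<dots> \<le> (12 * Q / r) * (r / 4)" using Q_pos r by simp
    also have "\<dots> \<le> (12 * Q / r) * (D * norm (v - u))"
      by (rule mult_left_mono[OF far]) (use Q_pos r in simp)
    finally show ?thesis by (simp add: dist_norm norm_minus_commute mult_ac)
  qed
qed (use Q_pos r D_pos in simp)

text \<open>The Lipschitz constant times this time is exactly 1/2; moreover \<open>Q * T\<close> is
  r / (24 D), below the margin r / (2 D).\<close>

definition T :: real where "T = r / (24 * D * Q)"

lemma T_pos: "T > 0"
  using Q_pos r D_pos by (simp add: T_def)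

sublocale local_flow f \<Omega> U "r / (2 * D)" Q "12 * D * Q / r" T
proof
  show "cball x (r / (2 * D)) \<subseteq> U" if "x \<in> \<Omega>" for x
  proof
    fix y assume "y \<in> cball x (r / (2 * D))"
    then have "norm (y - x) \<le> r / (2 * D)" by (simp add: dist_norm norm_minus_commute)
    then have "D * norm (y - x) \<le> D * (r / (2 * D))"
      by (rule mult_left_mono) (use D_pos in simp)
    then have "l1_norm (y - x) \<le> r / 2" using l1_norm_le_D[of "y - x"] D_pos by simp
    then show "y \<in> U" using that by (auto simp: U_def)
  qed
  show "norm (f y) \<le> Q" if "y \<in> U" for y using f_le_Q[OF that] norm_le_l1_norm order.trans by blast
  show "Q * T < r / (2 * D)" using Q_pos r D_pos by (simp add: T_def field_simps)
  show "12 * D * Q / r * T \<le> 1 / 2" using Q_pos r D_pos by (simp add: T_def)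
qed (use T_pos f_lipschitz Q_pos r D_pos in auto)

text \<open>This is 2 Q / (r/3), the growth rate of iterated Lie derivatives, with r/3 the radius
  left by the Cauchy estimates.\<close>

definition \<kappa> :: real where "\<kappa> = 6 * Q / r"

lemma \<kappa>_pos: "\<kappa> > 0"
  unfolding \<kappa>_def using Q_pos r by (intro divide_pos_pos) auto

lemma f_partials_le:
  assumes "y \<in> \<Omega>"
  shows "l1_norm (partials f S y) \<le> fact (length S) * Q / (r / 3) ^ length S"
proof -
  have "l1_norm (iterated_deriv f (map (\<lambda>j. axis j 1) S) y) \<le>
    fact (length (map (\<lambda>j. axis j (1::real)) S :: (real ^ 'n) list)) * Q / (r / 3) ^ length (map (\<lambda>j. axis j (1::real)) S :: (real ^ 'n) list)"
    by (rule analytic_bounded_iterated_deriv_le[OF smooth analytic _ r assms]) (use Q_pos r in auto)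
  then show ?thesis by (simp add: partials_def)
qed

lemma lie_power_f_le:
  assumes "y \<in> \<Omega>"
  shows "l1_norm ((lie_deriv f ^^ k) f y) \<le> Q * fact k * \<kappa> ^ k"
proof -
  have "l1_norm ((lie_deriv f ^^ k) f y) \<le> Q * fact k * (2 * Q / (r / 3)) ^ k"
    by (rule l1_norm_lie_power_le[OF open_nbhd[OF K(1)] _ _ smooth_map_partials[OF smooth]
          smooth_map_partials[OF smooth] f_partials_le f_partials_le assms order.refl])
       (use Q_pos r in auto)
  then show ?thesis by (simp add: \<kappa>_def)
qed

lemma lie_power_g_le:
  assumes g: "analytic_bounded_upto Q r N \<Omega> g" and y: "y \<in> \<Omega>" and k: "k \<le> N"
  shows "l1_norm ((lie_deriv f ^^ k) g y) \<le> Q * fact k * \<kappa> ^ k"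
proof -
  have "l1_norm ((lie_deriv f ^^ k) g y) \<le> Q * fact k * (2 * Q / (r / 3)) ^ k"
  proof (rule l1_norm_lie_power_le[OF open_nbhd[OF K(1)] _ _ smooth_map_partials[OF smooth] _ f_partials_le _ y k])
    show "partials_differentiable N \<Omega> g" using analytic_bounded_upto_partials(1)[OF g] Q_pos r by simp
    fix S y assume y: "y \<in> \<Omega>" and S: "length (S :: 'n list) \<le> N"
    have "l1_norm (partials g S y) \<le> fact (length S) * Q / r ^ length S"
      using analytic_bounded_upto_partials(2)[OF g _ r y S] Q_pos by simp
    also have "\<dots> \<le> fact (length S) * Q / (r / 3) ^ length S"
      using Q_pos r by (intro divide_left_mono power_mono) auto
    finally show "l1_norm (partials g S y) \<le> fact (length S) * Q / (r / 3) ^ length S" .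
  qed (use Q_pos r in auto)
  then show ?thesis by (simp add: \<kappa>_def)
qed

text \<open>\<open>\<tau>\<close> is half the width of the time window: below \<open>T\<close> for
  existence of the flow, \<open>D * Q * \<tau> \<le> R\<close> so that trajectories from
  \<open>K\<close> stay in \<open>\<Omega>\<close>, and \<open>\<kappa> * \<tau> \<le> 1 / 2\<close>
  so that Taylor remainders of order N have size 2^(-N).\<close>

context
  fixes \<tau> :: real
  assumes \<tau>: "\<tau> > 0" "\<tau> < T" "D * Q * \<tau> \<le> R" "\<kappa> * \<tau> \<le> 1 / 2"
begin

lemma flow_in_\<Omega>: "x \<in> K \<Longrightarrow> \<bar>t\<bar> \<le> \<tau> \<Longrightarrow> flow f t x \<in> \<Omega>"
proof -
  assume x: "x \<in> K" and t: "\<bar>t\<bar> \<le> \<tau>"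
  have x\<Omega>: "x \<in> \<Omega>" using x R by (force simp: nbhd_def)
  have "l1_norm (flow f t x - x) \<le> D * norm (flow f t x - x)" by (rule l1_norm_le_D)
  also have "\<dots> \<le> D * (Q * \<bar>t\<bar>)"
  proof (rule mult_left_mono)
    have "t \<in> {-T..T}" using t \<tau> by auto
    then show "norm (flow f t x - x) \<le> Q * \<bar>t\<bar>" by (rule flow_solution(4)[OF x\<Omega>])
  qed (use D_pos in simp)
  also have "\<dots> \<le> D * (Q * \<tau>)" using t Q_pos D_pos by (intro mult_left_mono) auto
  also have "\<dots> \<le> R" using \<tau> by simp
  finally show ?thesis using x by (auto simp: nbhd_def)
qed

lemma K_subset: "K \<subseteq> \<Omega>"
  using R by (force simp: nbhd_def)

lemma taylor_g:
  fixes g :: "real ^ 'n \<Rightarrow> real ^ 'n"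
  assumes g: "analytic_bounded_upto Q r N \<Omega> g" and N: "N > 0" and x: "x \<in> K" and t: "\<bar>t\<bar> \<le> \<tau>"
  shows "\<bar>g (flow f t x) $ i - (\<Sum>k<N. (lie_deriv f ^^ k) g x $ i / fact k * t ^ k)\<bar> \<le> Q * (1 / 2) ^ N"
proof -
  have x\<Omega>: "x \<in> \<Omega>" using K_subset x by blast
  have "\<bar>(lie_deriv f ^^ 0) g (flow f t x) $ i - (\<Sum>k<N. (lie_deriv f ^^ k) g (flow f 0 x) $ i / fact k * t ^ k)\<bar>
      \<le> (Q * \<kappa> ^ N) * \<bar>t\<bar> ^ N"
  proof (rule taylor_along_solution[where f = f and \<Omega> = \<Omega> and \<tau> = \<tau> and u = "\<lambda>k. (lie_deriv f ^^ k) g"])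
    show "((\<lambda>t. flow f t x) has_vector_derivative f (flow f t x)) (at t)" if "\<bar>t\<bar> \<le> \<tau>" for t
      using flow_has_vector_derivative[OF x\<Omega>] that \<tau> by auto
    show "(lie_deriv f ^^ k) g differentiable at y" if "k < N" "y \<in> \<Omega>" for k y
      by (rule lie_power_differentiable[OF open_nbhd[OF K(1)] smooth_map_partials[OF smooth] _ that])
         (use analytic_bounded_upto_partials(1)[OF g] Q_pos r in auto)
    show "l1_norm ((lie_deriv f ^^ N) g y) \<le> fact N * (Q * \<kappa> ^ N)" if "y \<in> \<Omega>" for y
      using lie_power_g_le[OF g that, of N] by (simp add: mult_ac)
  qed (use flow_in_\<Omega>[OF x] N t in auto)
  also have "\<dots> = Q * (\<kappa> * \<bar>t\<bar>) ^ N" by (simp add: power_mult_distrib)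
  also have "\<dots> \<le> Q * (1 / 2) ^ N"
  proof (intro mult_left_mono power_mono)
    have "\<kappa> * \<bar>t\<bar> \<le> \<kappa> * \<tau>" using t \<kappa>_pos by (intro mult_left_mono) auto
    then show "\<kappa> * \<bar>t\<bar> \<le> 1 / 2" using \<tau> by linarith
  qed (use Q_pos \<kappa>_pos in auto)
  finally show ?thesis using flow_solution(1)[OF x\<Omega>] by simp
qed

text \<open>The successive Lie derivatives of the identity, that is, the time derivatives of the
  flow itself.\<close>

definition lie_state :: "nat \<Rightarrow> real ^ 'n \<Rightarrow> real ^ 'n" where
  "lie_state k = (case k of 0 \<Rightarrow> (\<lambda>y. y) | Suc k \<Rightarrow> (lie_deriv f ^^ k) f)"

text \<open>The N-th derivative of the state is only the (N - 1)-st Lie derivative of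
  \<open>f\<close>, so one power of \<open>\<kappa>\<close> is missing; the factors
  \<open>\<tau>\<close> and 2 stand in for it.\<close>

lemma taylor_flow:
  assumes N: "N > 0" and x: "x \<in> K" and t: "\<bar>t\<bar> \<le> \<tau>"
  shows "\<bar>flow f t x $ i - (\<Sum>k<N. lie_state k x $ i / fact k * t ^ k)\<bar> \<le> 2 * Q * \<tau> * (1 / 2) ^ N"
proof -
  have x\<Omega>: "x \<in> \<Omega>" using K_subset x by blast
  obtain N' where N': "N = Suc N'" using N by (cases N) auto
  have "\<bar>lie_state 0 (flow f t x) $ i - (\<Sum>k<N. lie_state k (flow f 0 x) $ i / fact k * t ^ k)\<bar>
      \<le> (Q * \<kappa> ^ N') * \<bar>t\<bar> ^ N"
  proof (rule taylor_along_solution[where f = f and \<Omega> = \<Omega> and \<tau> = \<tau> and u = lie_state])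
    show "((\<lambda>t. flow f t x) has_vector_derivative f (flow f t x)) (at t)" if "\<bar>t\<bar> \<le> \<tau>" for t
      using flow_has_vector_derivative[OF x\<Omega>] that \<tau> by auto
    show "lie_state k differentiable at y" if "k < N" "y \<in> \<Omega>" for k y
    proof (cases k)
      case (Suc j)
      show ?thesis unfolding Suc lie_state_def
        using lie_power_differentiable[OF open_nbhd[OF K(1)] smooth_map_partials[OF smooth] smooth_map_partials[OF smooth] _ that(2), of j "Suc j"]
        by simp
    qed (simp add: lie_state_def)
    show "lie_state (Suc k) y = lie_deriv f (lie_state k) y" for k y
      by (cases k) (simp_all add: lie_state_def lie_deriv_def frechet_derivative_ident)
    show "l1_norm (lie_state N y) \<le> fact N * (Q * \<kappa> ^ N')" if "y \<in> \<Omega>" for y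
    proof -
      have "l1_norm (lie_state N y) \<le> fact N' * (Q * \<kappa> ^ N')"
        using lie_power_f_le[OF that, of N'] by (simp add: N' lie_state_def mult_ac)
      also have "\<dots> \<le> fact N * (Q * \<kappa> ^ N')"
        using Q_pos \<kappa>_pos by (intro mult_right_mono fact_mono) (auto simp: N')
      finally show ?thesis .
    qed
  qed (use flow_in_\<Omega>[OF x] N t in auto)
  also have "\<dots> = Q * ((\<kappa> * \<bar>t\<bar>) ^ N' * \<bar>t\<bar>)" by (simp add: power_mult_distrib N')
  also have "\<dots> \<le> Q * ((1 / 2) ^ N' * \<tau>)"
  proof (intro mult_left_mono mult_mono power_mono)
    have "\<kappa> * \<bar>t\<bar> \<le> \<kappa> * \<tau>" using t \<kappa>_pos by (intro mult_left_mono) auto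
    then show "\<kappa> * \<bar>t\<bar> \<le> 1 / 2" using \<tau> by linarith
  qed (use Q_pos \<kappa>_pos t \<tau> in auto)
  finally show ?thesis using flow_solution(1)[OF x\<Omega>] by (simp add: lie_state_def N' mult_ac)
qed

text \<open>The hypothesis \<open>window\<close> keeps all sampled times (j + m - J) h within
  [-\<tau>, \<tau>]. The 1/h in the remainder stems from the scaling of the state part of the
  residual; the exponential decay will absorb it.\<close>

lemma pointwise_error:
  fixes g :: "real ^ 'n \<Rightarrow> real ^ 'n" and P :: "nat \<Rightarrow> real"
  assumes g: "analytic_bounded_upto Q r (2 * n) \<Omega> g" and n: "n \<ge> 1" and x: "x \<in> K" and h: "h > 0"
    and P: "\<And>k. k < 2 * n \<Longrightarrow> fps_nth (filter_fps d P J * (\<Sum>m\<le>M. fps_const (\<beta> m) * fps_exp (real m))) k = of_bool (k = 0)"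
    and C: "(\<Sum>j\<le>d. \<bar>P j\<bar>) \<le> C" and window: "(real d + real M) * h \<le> \<tau>" "real J * h \<le> \<tau>"
  shows "l1_norm (g x - truncated_imde M \<alpha> \<beta> f (2 * n - 2) h x)
    \<le> (\<Sum>j\<le>d. \<bar>P j\<bar> * l1_norm (lmm_residual M \<alpha> \<beta> h f g (flow f ((real j - real J) * h) x)))
      + D * (C * Q * (1 / 2) ^ (2 * n) * (2 * \<tau> * (\<Sum>m\<le>M. \<bar>\<alpha> m\<bar>) / h + (\<Sum>m\<le>M. \<bar>\<beta> m\<bar>)))"
proof -
  define N where "N = 2 * n"
  have N: "N > 0" using n by (simp add: N_def)
  have x\<Omega>: "x \<in> \<Omega>" using K_subset x by blast
  define t where "t j m = (real j + real m - real J) * h" for j m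
  have t: "\<bar>t j m\<bar> \<le> \<tau>" if "j \<le> d" "m \<le> M" for j m
  proof -
    have "(real j + real m) * h \<le> (real d + real M) * h" "0 \<le> (real j + real m) * h" "0 \<le> real J * h"
      using that h by (auto intro!: mult_right_mono add_mono)
    then show ?thesis using window by (simp add: t_def left_diff_distrib abs_le_iff)
  qed
  define A B where "A = (\<Sum>m\<le>M. \<bar>\<alpha> m\<bar>)" and "B = (\<Sum>m\<le>M. \<bar>\<beta> m\<bar>)"
  define \<epsilon> where "\<epsilon> = (1 / 2 :: real) ^ N"
  have C0: "C \<ge> 0" by (rule order.trans[OF _ C]) (simp add: sum_nonneg)
  define Y where "Y = (\<lambda>j m. flow f (t j m) x)"
  \<comment> \<open>By the flow property the residual at a shifted point samples the one trajectory
    through \<open>x\<close>.\<close>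
  have res: "lmm_residual M \<alpha> \<beta> h f g (flow f ((real j - real J) * h) x)
      = (\<Sum>m\<le>M. (\<alpha> m / h) *\<^sub>R Y j m) - (\<Sum>m\<le>M. \<beta> m *\<^sub>R g (Y j m))" if j: "j \<le> d" for j
  proof -
    have "flow f (real m * h) (flow f ((real j - real J) * h) x) = Y j m" if m: "m \<le> M" for m
    proof -
      have t0: "\<bar>(real j - real J) * h\<bar> \<le> \<tau>" using t[OF j, of 0] by (simp add: t_def)
      have "real m * h \<le> (real d + real M) * h" using m h by (intro mult_right_mono) auto
      then have "real m * h \<le> \<tau>" using window(1) by (rule order.trans)
      then have mh: "\<bar>real m * h\<bar> \<le> \<tau>" using h by simp
      have "flow f (real m * h) (flow f ((real j - real J) * h) x) = flow f ((real j - real J) * h + real m * h) x"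
        by (rule flow_flow[OF x\<Omega>])
           (use t0 mh t[OF j m] \<tau> flow_in_\<Omega>[OF x t0] in \<open>auto simp: t_def algebra_simps\<close>)
      then show ?thesis by (simp add: Y_def t_def algebra_simps)
    qed
    then show ?thesis unfolding lmm_residual_def by simp
  qed
  have comp: "\<bar>(g x - truncated_imde M \<alpha> \<beta> f (2 * n - 2) h x) $ i\<bar>
      \<le> (\<Sum>j\<le>d. \<bar>P j\<bar> * \<bar>lmm_residual M \<alpha> \<beta> h f g (flow f ((real j - real J) * h) x) $ i\<bar>)
        + C * Q * \<epsilon> * (2 * \<tau> * A / h + B)" for i
  proof -
    define TY where "TY j m = (\<Sum>k<N. lie_state k x $ i / fact k * t j m ^ k)" for j m
    define TG where "TG j m = (\<Sum>k<N. (lie_deriv f ^^ k) g x $ i / fact k * t j m ^ k)" for j m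
    define RY where "RY j m = Y j m $ i - TY j m" for j m
    define RG where "RG j m = g (Y j m) $ i - TG j m" for j m
    have RY: "\<bar>RY j m\<bar> \<le> 2 * Q * \<tau> * \<epsilon>" if "j \<le> d" "m \<le> M" for j m
      unfolding RY_def TY_def Y_def \<epsilon>_def by (rule taylor_flow[OF N x t[OF that]])
    have RG: "\<bar>RG j m\<bar> \<le> Q * \<epsilon>" if "j \<le> d" "m \<le> M" for j m
      unfolding RG_def TG_def Y_def \<epsilon>_def
      by (rule taylor_g[OF _ N x t[OF that]]) (use g in \<open>simp add: N_def\<close>)
    have sG: "(\<Sum>j\<le>d. \<Sum>m\<le>M. P j * \<beta> m * TG j m) = g x $ i"
    proof -
      have "(\<Sum>j\<le>d. \<Sum>m\<le>M. P j * \<beta> m * TG j m)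
          = (\<Sum>k<N. (lie_deriv f ^^ k) g x $ i * h ^ k * fps_nth (filter_fps d P J * (\<Sum>m\<le>M. fps_const (\<beta> m) * fps_exp (real m))) k)"
        unfolding TG_def t_def by (rule filter_polynomial)
      also have "\<dots> = (\<Sum>k<N. if k = 0 then g x $ i else 0)"
        by (rule sum.cong) (auto simp: P N_def)
      also have "\<dots> = g x $ i" using N by simp
      finally show ?thesis .
    qed
    \<comment> \<open>Off by one: of the Taylor orders k < 2n the order 0 drops out because the
      \<alpha> sum to 0, and the others move down by one; this leaves the truncation index 2n -
      2.\<close>
    have sY: "(\<Sum>j\<le>d. \<Sum>m\<le>M. P j * \<alpha> m * TY j m) = h * truncated_imde M \<alpha> \<beta> f (2 * n - 2) h x $ i"
    proof -
      obtain N' where N': "N = Suc N'" using N by (cases N) auto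
      have "(\<Sum>j\<le>d. \<Sum>m\<le>M. P j * \<alpha> m * TY j m)
          = (\<Sum>k<N. lie_state k x $ i * h ^ k * fps_nth (filter_fps d P J * (\<Sum>m\<le>M. fps_const (\<alpha> m) * fps_exp (real m))) k)"
        unfolding TY_def t_def by (rule filter_polynomial)
      also have "\<dots> = (\<Sum>k<N'. lie_state (Suc k) x $ i * h ^ Suc k * imde_coeff M \<alpha> \<beta> k)"
        unfolding N' sum.lessThan_Suc_shift using filter_alpha_nth[OF sum_\<alpha> sum_\<beta>, of N d P J] P
        by (simp add: N_def[symmetric] N')
      also have "\<dots> = h * (\<Sum>k<N'. h ^ k * (imde_coeff M \<alpha> \<beta> k * (lie_deriv f ^^ k) f x $ i))"
        by (simp add: lie_state_def sum_distrib_left mult_ac)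
      also have "{..<N'} = {..2 * n - 2}"
      proof -
        have "N' = Suc (2 * n - 2)" using N' n unfolding N_def by arith
        then show ?thesis by (simp only: lessThan_Suc_atMost)
      qed
      also have "(\<Sum>k\<le>2 * n - 2. h ^ k * (imde_coeff M \<alpha> \<beta> k * (lie_deriv f ^^ k) f x $ i))
          = truncated_imde M \<alpha> \<beta> f (2 * n - 2) h x $ i"
        by (simp add: truncated_imde_def imde_term_eq[OF smooth] mult.assoc)
      finally show ?thesis .
    qed
    have "(\<Sum>j\<le>d. P j * lmm_residual M \<alpha> \<beta> h f g (flow f ((real j - real J) * h) x) $ i)
        = (\<Sum>j\<le>d. P j * ((\<Sum>m\<le>M. \<alpha> m / h * (TY j m + RY j m)) - (\<Sum>m\<le>M. \<beta> m * (TG j m + RG j m))))"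
      by (intro sum.cong refl) (simp add: res RY_def RG_def)
    also have "\<dots> = (\<Sum>j\<le>d. \<Sum>m\<le>M. P j * \<alpha> m * TY j m) / h + (\<Sum>j\<le>d. \<Sum>m\<le>M. P j * \<alpha> m * RY j m) / h
        - (\<Sum>j\<le>d. \<Sum>m\<le>M. P j * \<beta> m * TG j m) - (\<Sum>j\<le>d. \<Sum>m\<le>M. P j * \<beta> m * RG j m)"
      by (simp add: right_diff_distrib distrib_left sum.distrib sum_subtractf sum_distrib_left sum_divide_distrib mult_ac)
    finally have "(g x - truncated_imde M \<alpha> \<beta> f (2 * n - 2) h x) $ i
        = - (\<Sum>j\<le>d. P j * lmm_residual M \<alpha> \<beta> h f g (flow f ((real j - real J) * h) x) $ i)
          + (\<Sum>j\<le>d. \<Sum>m\<le>M. P j * \<alpha> m * RY j m) / h - (\<Sum>j\<le>d. \<Sum>m\<le>M. P j * \<beta> m * RG j m)"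
      unfolding sG sY using h by simp
    moreover have "\<bar>\<Sum>j\<le>d. P j * lmm_residual M \<alpha> \<beta> h f g (flow f ((real j - real J) * h) x) $ i\<bar>
        \<le> (\<Sum>j\<le>d. \<bar>P j\<bar> * \<bar>lmm_residual M \<alpha> \<beta> h f g (flow f ((real j - real J) * h) x) $ i\<bar>)"
      by (rule order.trans[OF sum_abs]) (simp add: abs_mult)
    moreover have dbl: "\<bar>\<Sum>j\<le>d. \<Sum>m\<le>M. P j * \<gamma> m * X j m\<bar> \<le> C * (\<Sum>m\<le>M. \<bar>\<gamma> m\<bar>) * b"
      if X: "\<And>j m. j \<le> d \<Longrightarrow> m \<le> M \<Longrightarrow> \<bar>X j m\<bar> \<le> b" and b: "b \<ge> 0" for X b and \<gamma> :: "nat \<Rightarrow> real"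
    proof -
      have "\<bar>\<Sum>j\<le>d. \<Sum>m\<le>M. P j * \<gamma> m * X j m\<bar> \<le> (\<Sum>j\<le>d. \<Sum>m\<le>M. \<bar>P j\<bar> * \<bar>\<gamma> m\<bar> * b)"
      proof (rule order.trans[OF sum_abs sum_mono])
        fix j assume j: "j \<in> {..d}"
        show "\<bar>\<Sum>m\<le>M. P j * \<gamma> m * X j m\<bar> \<le> (\<Sum>m\<le>M. \<bar>P j\<bar> * \<bar>\<gamma> m\<bar> * b)"
          by (rule order.trans[OF sum_abs sum_mono]) (use X j in \<open>auto simp: abs_mult intro!: mult_left_mono\<close>)
      qed
      also have "\<dots> = (\<Sum>j\<le>d. \<bar>P j\<bar>) * ((\<Sum>m\<le>M. \<bar>\<gamma> m\<bar>) * b)"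
        by (simp only: sum_distrib_left[symmetric] sum_distrib_right[symmetric] mult.assoc)
      also have "\<dots> \<le> C * ((\<Sum>m\<le>M. \<bar>\<gamma> m\<bar>) * b)"
        using b by (intro mult_right_mono C mult_nonneg_nonneg sum_nonneg) auto
      finally show ?thesis by (simp add: mult_ac)
    qed
    have "\<bar>\<Sum>j\<le>d. \<Sum>m\<le>M. P j * \<alpha> m * RY j m\<bar> \<le> C * A * (2 * Q * \<tau> * \<epsilon>)"
      unfolding A_def by (rule dbl[OF RY]) (use Q_pos \<tau> in \<open>auto simp: \<epsilon>_def\<close>)
    then have "\<bar>(\<Sum>j\<le>d. \<Sum>m\<le>M. P j * \<alpha> m * RY j m) / h\<bar> \<le> C * A * (2 * Q * \<tau> * \<epsilon>) / h"
      using h by (simp add: abs_divide divide_right_mono)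
    moreover have "\<bar>\<Sum>j\<le>d. \<Sum>m\<le>M. P j * \<beta> m * RG j m\<bar> \<le> C * B * (Q * \<epsilon>)"
      unfolding B_def by (rule dbl[OF RG]) (use Q_pos in \<open>auto simp: \<epsilon>_def\<close>)
    moreover have "C * A * (2 * Q * \<tau> * \<epsilon>) / h + C * B * (Q * \<epsilon>) = C * Q * \<epsilon> * (2 * \<tau> * A / h + B)"
      by (simp add: algebra_simps)
    ultimately show ?thesis by linarith
  qed
  have "l1_norm (g x - truncated_imde M \<alpha> \<beta> f (2 * n - 2) h x)
      \<le> (\<Sum>i\<in>UNIV. (\<Sum>j\<le>d. \<bar>P j\<bar> * \<bar>lmm_residual M \<alpha> \<beta> h f g (flow f ((real j - real J) * h) x) $ i\<bar>)
        + C * Q * \<epsilon> * (2 * \<tau> * A / h + B))"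
    unfolding l1_norm_def real_norm_def by (intro sum_mono comp)
  also have "\<dots> = (\<Sum>j\<le>d. \<bar>P j\<bar> * l1_norm (lmm_residual M \<alpha> \<beta> h f g (flow f ((real j - real J) * h) x)))
      + D * (C * Q * \<epsilon> * (2 * \<tau> * A / h + B))"
    unfolding D sum.distrib l1_norm_def real_norm_def sum_distrib_left
    by (subst sum.swap) (simp add: mult_ac)
  finally show ?thesis by (simp add: \<epsilon>_def N_def A_def B_def)
qed


section \<open>Integrating the residual over the domain\<close>

context
  fixes h :: real and g :: "real ^ 'n \<Rightarrow> real ^ 'n"
  assumes h: "h > 0" "real M * h \<le> \<tau>" and g_cont: "continuous_on UNIV g"
begin

abbreviation "residual_norm \<equiv> (\<lambda>y. l1_norm (lmm_residual M \<alpha> \<beta> h f g y))"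

lemma step_le: "m \<le> M \<Longrightarrow> \<bar>real m * h\<bar> \<le> T"
proof -
  assume "m \<le> M"
  then have "real m * h \<le> real M * h" using h by (intro mult_right_mono) auto
  then have "real m * h \<le> T" using h \<tau> by linarith
  then show ?thesis using h by simp
qed

lemma residual_continuous: "continuous_on \<Omega> (lmm_residual M \<alpha> \<beta> h f g)"
proof -
  have fl: "continuous_on \<Omega> (flow f (real m * h))" if "m \<le> M" for m
    by (rule lipschitz_on_continuous_on[of 2], rule lipschitz_onI)
       (use flow_lipschitz[OF _ _ step_le[OF that]] in \<open>auto simp: dist_norm\<close>)
  have "continuous_on \<Omega> (\<lambda>x. g (flow f (real m * h) x))" if "m \<le> M" for m
    by (rule continuous_on_compose2[OF g_cont fl[OF that]]) auto
  then show ?thesis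
    unfolding lmm_residual_def[abs_def] using fl by (intro continuous_intros) auto
qed

text \<open>Flow images of \<open>\<Omega>\<close> stay within \<open>Q * T\<close> of it, so the
  network is evaluated in one closed ball, where continuity bounds it. The bound depends on
  \<open>g\<close> and \<open>h\<close> and serves integrability only.\<close>

lemma residual_bounded: "\<exists>B. \<forall>y\<in>\<Omega>. norm (lmm_residual M \<alpha> \<beta> h f g y) \<le> B"
proof -
  obtain b where b: "\<And>y. y \<in> \<Omega> \<Longrightarrow> norm y \<le> b"
    using bounded_nbhd[OF K(2), of R] by (meson bounded_iff)
  define b' where "b' = b + Q * T"
  have fl: "norm (flow f (real m * h) y) \<le> b'" if y: "y \<in> \<Omega>" and m: "m \<le> M" for y m
  proof -
    have "norm (flow f (real m * h) y - y) \<le> Q * \<bar>real m * h\<bar>"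
      by (rule flow_solution(4)[OF y]) (use step_le[OF m] in auto)
    also have "\<dots> \<le> Q * T" using Q_pos step_le[OF m] by (intro mult_left_mono) auto
    finally show ?thesis
      using b[OF y] norm_triangle_sub[of "flow f (real m * h) y" y] by (simp add: b'_def)
  qed
  have "bounded (g ` cball 0 b')"
    by (intro compact_imp_bounded compact_continuous_image continuous_on_subset[OF g_cont]) auto
  then obtain b'' where "\<forall>z\<in>cball 0 b'. norm (g z) \<le> b''"
    unfolding bounded_iff by blast
  then have b'': "norm (g z) \<le> b''" if "norm z \<le> b'" for z using that by simp
  have "norm (lmm_residual M \<alpha> \<beta> h f g y) \<le> (\<Sum>m\<le>M. \<bar>\<alpha> m / h\<bar> * b') + (\<Sum>m\<le>M. \<bar>\<beta> m\<bar> * b'')" if y: "y \<in> \<Omega>" for y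
  proof -
    have "norm (\<Sum>m\<le>M. (\<alpha> m / h) *\<^sub>R flow f (real m * h) y) \<le> (\<Sum>m\<le>M. \<bar>\<alpha> m / h\<bar> * b')"
      by (rule sum_norm_le) (unfold norm_scaleR, auto intro!: mult_left_mono fl[OF y] simp del: abs_divide)
    moreover have "norm (\<Sum>m\<le>M. \<beta> m *\<^sub>R g (flow f (real m * h) y)) \<le> (\<Sum>m\<le>M. \<bar>\<beta> m\<bar> * b'')"
      by (rule sum_norm_le) (unfold norm_scaleR, auto intro!: mult_left_mono b'' fl[OF y])
    ultimately show ?thesis
      unfolding lmm_residual_def using norm_triangle_ineq4 order.trans add_mono by meson
  qed
  then show ?thesis by blast
qed

lemma residual_norm_integrable:
  shows "set_integrable lborel \<Omega> residual_norm"
    and "(LINT y:\<Omega>|lborel. residual_norm y) \<le> sqrt (measure lborel \<Omega>) * D * sqrt (lmm_loss M \<alpha> \<beta> h f g \<Omega>)"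
proof -
  obtain B where B: "\<And>y. y \<in> \<Omega> \<Longrightarrow> norm (lmm_residual M \<alpha> \<beta> h f g y) \<le> B"
    using residual_bounded by blast
  have op: "open \<Omega>" by (rule open_nbhd[OF K(1)])
  have bd: "bounded \<Omega>" by (rule bounded_nbhd[OF K(2)])
  have c1: "continuous_on \<Omega> residual_norm"
    by (rule continuous_on_compose2[OF continuous_on_l1_norm residual_continuous]) auto
  have w_le: "residual_norm y \<le> D * norm (lmm_residual M \<alpha> \<beta> h f g y)" for y by (rule l1_norm_le_D)
  have wB: "residual_norm y \<le> D * B" if "y \<in> \<Omega>" for y
    using order.trans[OF w_le mult_left_mono[OF B[OF that]]] D_pos by simp
  show i1: "set_integrable lborel \<Omega> residual_norm"
    by (rule set_integral_continuous_bounded[OF op bd c1, of "D * B"]) (use wB in auto)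
  have i2: "set_integrable lborel \<Omega> (\<lambda>y. (residual_norm y)\<^sup>2)"
    by (rule set_integral_continuous_bounded[OF op bd, of _ "(D * B)\<^sup>2"])
       (use wB in \<open>auto intro!: continuous_intros c1 power_mono\<close>)
  have i3: "set_integrable lborel \<Omega> (\<lambda>y. (norm (lmm_residual M \<alpha> \<beta> h f g y))\<^sup>2)"
    by (rule set_integral_continuous_bounded[OF op bd, of _ "B\<^sup>2"])
       (use B in \<open>auto intro!: continuous_intros residual_continuous power_mono\<close>)
  have "(LINT y:\<Omega>|lborel. (residual_norm y)\<^sup>2) \<le> (LINT y:\<Omega>|lborel. D\<^sup>2 * (norm (lmm_residual M \<alpha> \<beta> h f g y))\<^sup>2)"
  proof (rule set_integral_mono[OF i2])
    show "set_integrable lborel \<Omega> (\<lambda>y. D\<^sup>2 * (norm (lmm_residual M \<alpha> \<beta> h f g y))\<^sup>2)"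
      using i3 by (rule set_integrable_mult_right)
    show "(residual_norm y)\<^sup>2 \<le> D\<^sup>2 * (norm (lmm_residual M \<alpha> \<beta> h f g y))\<^sup>2" for y
      unfolding power_mult_distrib[symmetric] by (rule power_mono[OF w_le]) simp
  qed
  also have "\<dots> = D\<^sup>2 * lmm_loss M \<alpha> \<beta> h f g \<Omega>" by (simp add: lmm_loss_def)
  finally have "sqrt (LINT y:\<Omega>|lborel. (residual_norm y)\<^sup>2) \<le> D * sqrt (lmm_loss M \<alpha> \<beta> h f g \<Omega>)"
    using D_pos by (metis real_sqrt_le_mono real_sqrt_mult real_sqrt_unique less_imp_le)
  then have "sqrt (measure lborel \<Omega>) * sqrt (LINT y:\<Omega>|lborel. (residual_norm y)\<^sup>2)
      \<le> sqrt (measure lborel \<Omega>) * (D * sqrt (lmm_loss M \<alpha> \<beta> h f g \<Omega>))"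
    by (intro mult_left_mono) auto
  then show "(LINT y:\<Omega>|lborel. residual_norm y) \<le> sqrt (measure lborel \<Omega>) * D * sqrt (lmm_loss M \<alpha> \<beta> h f g \<Omega>)"
    using set_integral_Cauchy_Schwarz[OF op bd i1 i2] by (simp add: mult.assoc)
qed

text \<open>The flow for time -t inverts that for time t and is 2-Lipschitz, so the preimage
  estimate applies with expansion constant 2 and produces the factor with base 4 D.\<close>

lemma residual_norm_flow_integral:
  assumes t: "\<bar>t\<bar> \<le> \<tau>"
  shows "set_integrable lborel K (\<lambda>x. residual_norm (flow f t x))"
    and "(LINT x:K|lborel. residual_norm (flow f t x))
      \<le> (4 * D) ^ CARD('n) * (sqrt (measure lborel \<Omega>) * D * sqrt (lmm_loss M \<alpha> \<beta> h f g \<Omega>))"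
proof -
  have tT: "\<bar>t\<bar> \<le> T" "\<bar>- t\<bar> \<le> T" using t \<tau> by auto
  have return: "flow f (- t) (flow f t x) = x" if "x \<in> K" for x
  proof -
    have x: "x \<in> \<Omega>" using that K_subset by blast
    show ?thesis
      using flow_flow[OF x tT(1) tT(2) _ flow_in_\<Omega>[OF that t]] flow_solution(1)[OF x] T_pos by simp
  qed
  have expand: "norm (x - x') \<le> 2 * norm (flow f t x - flow f t x')" if "x \<in> K" "x' \<in> K" for x x'
    using flow_lipschitz[OF flow_in_\<Omega>[OF that(1) t] flow_in_\<Omega>[OF that(2) t] tT(2)] return that by simp
  have cont: "continuous_on K (flow f t)"
    by (rule lipschitz_on_continuous_on[of 2], rule lipschitz_onI)
       (use flow_lipschitz[OF _ _ tT(1)] K_subset in \<open>auto simp: dist_norm subset_iff\<close>)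
  note * = set_integral_expanding_map[OF expand _ K(1) cont _ open_nbhd[OF K(1)] bounded_nbhd[OF K(2)]
      residual_norm_integrable(1)]
  show "set_integrable lborel K (\<lambda>x. residual_norm (flow f t x))"
    by (rule *(1)) (use flow_in_\<Omega>[OF _ t] in auto)
  have "(LINT x:K|lborel. residual_norm (flow f t x)) \<le> (2 * 2 * real DIM(real ^ 'n)) ^ DIM(real ^ 'n) * (LINT x:\<Omega>|lborel. residual_norm x)"
    by (rule *(2)) (use flow_in_\<Omega>[OF _ t] in auto)
  also have "(2 * 2 * real DIM(real ^ 'n)) ^ DIM(real ^ 'n) = (4 * D) ^ CARD('n)"
    by (simp add: D)
  also have "(4 * D) ^ CARD('n) * (LINT x:\<Omega>|lborel. residual_norm x)
      \<le> (4 * D) ^ CARD('n) * (sqrt (measure lborel \<Omega>) * D * sqrt (lmm_loss M \<alpha> \<beta> h f g \<Omega>))"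
    using D_pos by (intro mult_left_mono residual_norm_integrable(2)) auto
  finally show "(LINT x:K|lborel. residual_norm (flow f t x))
      \<le> (4 * D) ^ CARD('n) * (sqrt (measure lborel \<Omega>) * D * sqrt (lmm_loss M \<alpha> \<beta> h f g \<Omega>))" .
qed

text \<open>All shifted residuals have the same integral bound, so only the coefficient sum enters
  and not the number of shifts. The function \<open>\<psi>\<close> is arbitrary, to serve for the
  distance to the truncated equation and to \<open>f\<close> alike.\<close>

lemma integral_le_loss:
  fixes \<psi> :: "real ^ 'n \<Rightarrow> real" and P :: "nat \<Rightarrow> real"
  assumes \<psi>: "\<And>x. x \<in> K \<Longrightarrow> \<psi> x \<le> (\<Sum>j\<le>d. \<bar>P j\<bar> * residual_norm (flow f (t j) x)) + E"
    and t: "\<And>j. j \<le> d \<Longrightarrow> \<bar>t j\<bar> \<le> \<tau>" and C: "(\<Sum>j\<le>d. \<bar>P j\<bar>) \<le> C" and E: "E \<ge> 0"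
  shows "(LINT x:K|lborel. \<psi> x) \<le> C * (4 * D) ^ CARD('n) * sqrt (measure lborel \<Omega>) * D * sqrt (lmm_loss M \<alpha> \<beta> h f g \<Omega>)
    + E * measure lborel \<Omega>"
proof -
  define Z where "Z = (4 * D) ^ CARD('n) * (sqrt (measure lborel \<Omega>) * D * sqrt (lmm_loss M \<alpha> \<beta> h f g \<Omega>))"
  have "lmm_loss M \<alpha> \<beta> h f g \<Omega> \<ge> 0"
    unfolding lmm_loss_def set_lebesgue_integral_def by (intro Bochner_Integration.integral_nonneg) auto
  then have Z0: "Z \<ge> 0" unfolding Z_def using D_pos by (intro mult_nonneg_nonneg) auto
  have finK: "emeasure lborel K < \<infinity>" using K by (intro emeasure_bounded_finite)
  have c: "set_integrable lborel K (\<lambda>x. E)"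
    using finK K by (simp add: set_integrable_def integrable_indicator_iff)
  have i: "set_integrable lborel K (\<lambda>x. \<bar>P j\<bar> * residual_norm (flow f (t j) x))" if "j \<le> d" for j
    using residual_norm_flow_integral(1)[OF t[OF that]] by (intro set_integrable_mult_right)
  have isum: "set_integrable lborel K (\<lambda>x. \<Sum>j\<le>d. \<bar>P j\<bar> * residual_norm (flow f (t j) x))"
    using i unfolding set_integrable_def scaleR_sum_right by (intro Bochner_Integration.integrable_sum) auto
  have "(LINT x:K|lborel. \<psi> x) \<le> (LINT x:K|lborel. (\<Sum>j\<le>d. \<bar>P j\<bar> * residual_norm (flow f (t j) x)) + E)"
    unfolding set_lebesgue_integral_def
  \<comment> \<open>Only the larger side has to be integrable: the integral of a non-integrable
    \<open>\<psi>\<close> is 0 by convention, and the upper bound is nonnegative.\<close>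
  proof (rule integral_mono_AE')
    show "integrable lborel (\<lambda>x. indicator K x *\<^sub>R ((\<Sum>j\<le>d. \<bar>P j\<bar> * residual_norm (flow f (t j) x)) + E))"
      using set_integral_add(1)[OF isum c] by (simp add: set_integrable_def)
    show "AE x in lborel. indicator K x *\<^sub>R \<psi> x \<le> indicator K x *\<^sub>R ((\<Sum>j\<le>d. \<bar>P j\<bar> * residual_norm (flow f (t j) x)) + E)"
      using \<psi> by (intro AE_I2) (auto simp: indicator_def)
    show "AE x in lborel. 0 \<le> indicator K x *\<^sub>R ((\<Sum>j\<le>d. \<bar>P j\<bar> * residual_norm (flow f (t j) x)) + E)"
      using E by (intro AE_I2) (auto simp: indicator_def intro!: add_nonneg_nonneg sum_nonneg)
  qed
  also have "\<dots> = (\<Sum>j\<le>d. \<bar>P j\<bar> * (LINT x:K|lborel. residual_norm (flow f (t j) x))) + E * measure lborel K"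
  proof -
    have "(LINT x:K|lborel. \<Sum>j\<le>d. \<bar>P j\<bar> * residual_norm (flow f (t j) x))
        = (\<Sum>j\<le>d. (LINT x:K|lborel. \<bar>P j\<bar> * residual_norm (flow f (t j) x)))"
      using i unfolding set_integrable_def set_lebesgue_integral_def scaleR_sum_right
      by (intro Bochner_Integration.integral_sum) auto
    moreover have "(LINT x:K|lborel. E) = E * measure lborel K"
      using finK K by (simp add: set_lebesgue_integral_def)
    ultimately show ?thesis by (subst set_integral_add(2)[OF isum c]) simp
  qed
  also have "\<dots> \<le> (\<Sum>j\<le>d. \<bar>P j\<bar> * Z) + E * measure lborel \<Omega>"
  proof (intro add_mono sum_mono mult_left_mono)
    show "(LINT x:K|lborel. residual_norm (flow f (t j) x)) \<le> Z" if "j \<in> {..d}" for j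
      unfolding Z_def using that by (intro residual_norm_flow_integral(2) t) auto
    show "measure lborel K \<le> measure lborel \<Omega>"
      using K_subset K open_nbhd[OF K(1), of R] bounded_nbhd[OF K(2), of R]
      by (intro measure_mono_fmeasurable) (auto intro!: fmeasurableI emeasure_bounded_finite)
  qed (use E in auto)
  also have "(\<Sum>j\<le>d. \<bar>P j\<bar> * Z) \<le> C * Z"
    unfolding sum_distrib_right[symmetric] by (rule mult_right_mono[OF C Z0])
  finally show ?thesis by (simp add: Z_def mult_ac)
qed

end

end

text \<open>The bounds for the terms are proportional to k! z^k with z = B \<kappa> h, which
  diverges, but as long as N z \<le> 1/2 consecutive ones at least halve. Terms with 1 \<le> k < p
  vanish, so the sum is at most twice the bound at order p.\<close>

lemma truncated_imde_error:
  assumes c: "\<And>k. \<bar>imde_coeff M \<alpha> \<beta> k\<bar> \<le> A * B ^ k" and A: "A > 0" and B: "B \<ge> 1"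
    and ord: "has_order M \<alpha> \<beta> p" and x: "x \<in> \<Omega>" and h: "h > 0" and small: "real N * (B * \<kappa> * h) \<le> 1 / 2"
  shows "l1_norm (truncated_imde M \<alpha> \<beta> f N h x - f x) \<le> 2 * A * Q * fact p * (B * \<kappa> * h) ^ p"
proof -
  define z where "z = B * \<kappa> * h"
  have z: "z > 0" using B \<kappa>_pos h by (simp add: z_def)
  have p: "p \<ge> 1" using ord by (simp add: has_order_def)
  have decay: "fact k * z ^ k \<le> fact p * z ^ p * (1 / 2) ^ (k - p)" if "p \<le> k" "k \<le> N" for k
    using that
  proof (induction k rule: dec_induct)
    case (step k)
    have "real (Suc k) * z \<le> real N * z" using step z by (intro mult_right_mono) auto
    then have half: "real (Suc k) * z \<le> 1 / 2" using small by (simp add: z_def)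
    have "(fact k * z ^ k) * (real (Suc k) * z) \<le> (fact p * z ^ p * (1 / 2) ^ (k - p)) * (1 / 2)"
    proof (rule mult_mono)
      show "fact k * z ^ k \<le> fact p * z ^ p * (1 / 2) ^ (k - p)" using step by simp
    qed (use z half in auto)
    then show ?case using step.hyps by (simp add: Suc_diff_le mult_ac)
  qed simp
  have "truncated_imde M \<alpha> \<beta> f N h x = (\<Sum>k\<le>N. h ^ k *\<^sub>R imde_coeff M \<alpha> \<beta> k *\<^sub>R (lie_deriv f ^^ k) f x)"
    by (simp add: truncated_imde_def imde_term_eq[OF smooth])
  also have "\<dots> = f x + (\<Sum>k\<in>{1..N}. h ^ k *\<^sub>R imde_coeff M \<alpha> \<beta> k *\<^sub>R (lie_deriv f ^^ k) f x)"
    using imde_coeff_eq_0(1)[OF ord sum_\<beta>] by (simp add: atMost_atLeast0 sum.atLeast_Suc_atMost)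
  finally have "l1_norm (truncated_imde M \<alpha> \<beta> f N h x - f x)
      \<le> (\<Sum>k\<in>{1..N}. l1_norm (h ^ k *\<^sub>R imde_coeff M \<alpha> \<beta> k *\<^sub>R (lie_deriv f ^^ k) f x))"
    by (simp add: l1_norm_sum)
  also have "\<dots> \<le> (\<Sum>k\<in>{1..N}. if p \<le> k then A * Q * (fact p * z ^ p) * (1 / 2) ^ (k - p) else 0)"
  proof (rule sum_mono)
    fix k assume k: "k \<in> {1..N}"
    show "l1_norm (h ^ k *\<^sub>R imde_coeff M \<alpha> \<beta> k *\<^sub>R (lie_deriv f ^^ k) f x)
        \<le> (if p \<le> k then A * Q * (fact p * z ^ p) * (1 / 2) ^ (k - p) else 0)"
    proof (cases "p \<le> k")
      case True
      have "l1_norm (h ^ k *\<^sub>R imde_coeff M \<alpha> \<beta> k *\<^sub>R (lie_deriv f ^^ k) f x)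
          = h ^ k * (\<bar>imde_coeff M \<alpha> \<beta> k\<bar> * l1_norm ((lie_deriv f ^^ k) f x))"
        using h by (simp add: l1_norm_scaleR abs_mult)
      also have "\<dots> \<le> h ^ k * ((A * B ^ k) * (Q * fact k * \<kappa> ^ k))"
        using h A B by (intro mult_left_mono mult_mono c lie_power_f_le x) auto
      also have "\<dots> = A * Q * (fact k * z ^ k)" by (simp add: z_def power_mult_distrib mult_ac)
      also have "\<dots> \<le> A * Q * (fact p * z ^ p * (1 / 2) ^ (k - p))"
        using True k A Q_pos by (intro mult_left_mono decay) auto
      finally show ?thesis using True by (simp add: mult_ac)
    next
      case False
      then show ?thesis using imde_coeff_eq_0(2)[OF ord sum_\<beta>, of k] k by simp
    qed
  qed
  also have "\<dots> = A * Q * (fact p * z ^ p) * (\<Sum>k\<in>{p..N}. (1 / 2) ^ (k - p))"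
    unfolding sum_distrib_left using p by (intro sum.mono_neutral_cong_right) auto
  also have "\<dots> \<le> A * Q * (fact p * z ^ p) * 2"
  proof (rule mult_left_mono)
    have "(\<Sum>k\<in>{p..N}. (1 / 2 :: real) ^ (k - p)) \<le> (\<Sum>k<Suc N. (1 / 2) ^ k)"
    proof (rule sum_le_included[where i = "\<lambda>k. k + p"])
      show "\<forall>k\<in>{p..N}. \<exists>i\<in>{..<Suc N}. i + p = k \<and> (1 / 2 :: real) ^ (k - p) \<le> (1 / 2) ^ i"
      proof
        fix k assume "k \<in> {p..N}"
        then show "\<exists>i\<in>{..<Suc N}. i + p = k \<and> (1 / 2 :: real) ^ (k - p) \<le> (1 / 2) ^ i"
          by (intro bexI[of _ "k - p"]) auto
      qed
    qed auto
    also have "\<dots> \<le> 2" by (rule sum_half_powers_le)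
    finally show "(\<Sum>k\<in>{p..N}. (1 / 2 :: real) ^ (k - p)) \<le> 2" .
  qed (use A Q_pos z in auto)
  finally show ?thesis by (simp add: z_def mult_ac)
qed

end

text \<open>n is the largest integer with n^(5/2) h \<le> \<theta>. With \<open>X\<close> the number
  whose floor is n, 4^(-n) is at most exp(1 - X), and dividing by h costs X^(5/2) / \<theta> \<le>
  216 exp(X/2) / \<theta>, from exp(y) \<ge> (y/3)^3 at y = X/2. Half of the exponent is lost this
  way.\<close>

lemma truncation_order:
  fixes \<theta> h :: real
  assumes h: "0 < h" "h < \<theta>"
  defines "n \<equiv> nat \<lfloor>(\<theta> / h) powr (2 / 5)\<rfloor>"
  shows "n \<ge> 1" and "real n ^ 2 * sqrt (real n) * h \<le> \<theta>"
    and "(1 / 2) ^ (2 * n) / h \<le> 216 * exp 1 / \<theta> * exp (- (\<theta> powr (2 / 5) / 2) / h powr (2 / 5))"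
proof -
  define X where "X = (\<theta> / h) powr (2 / 5)"
  have \<theta>: "\<theta> > 0" using h by simp
  have X1: "X \<ge> 1" unfolding X_def by (rule ge_one_powr_ge_zero) (use h in auto)
  then show n1: "n \<ge> 1" unfolding n_def X_def by (simp add: le_nat_iff le_floor_iff)
  have nX: "real n \<le> X" "X < real n + 1"
    using X1 unfolding n_def X_def[symmetric] by (simp, linarith)
  have X52: "X powr (5 / 2) = \<theta> / h"
    unfolding X_def powr_powr using h \<theta> by simp
  have "real n ^ 2 * sqrt (real n) = real n powr (5 / 2)"
  proof -
    have "real n powr (5 / 2) = real n powr (2 + 1 / 2)" by simp
    also have "\<dots> = real n powr 2 * real n powr (1 / 2)" by (rule powr_add)
    finally show ?thesis using n1 by (simp add: powr_half_sqrt powr_numeral)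
  qed
  also have "\<dots> \<le> X powr (5 / 2)" using nX by (intro powr_mono2) auto
  finally show "real n ^ 2 * sqrt (real n) * h \<le> \<theta>"
    using h by (simp add: X52 field_simps)
  have "1 / h = X powr (5 / 2) / \<theta>" using \<theta> by (simp add: X52)
  also have "\<dots> \<le> X powr 3 / \<theta>" using X1 \<theta> by (intro divide_right_mono powr_mono) auto
  also have "X powr 3 = X ^ 3" using X1 by (simp add: powr_numeral)
  also have "X ^ 3 \<le> 216 * exp (X / 2)"
    using exp_ge_power_div[of "X / 2" 3] X1 by (simp add: power_divide)
  finally have h1: "1 / h \<le> 216 * exp (X / 2) / \<theta>" using \<theta> by (simp add: divide_right_mono)
  have "(1 / 2 :: real) ^ (2 * n) = (1 / 4) ^ n" by (simp add: power_mult power_divide)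
  also have "\<dots> \<le> exp (- 1) ^ n"
  proof (rule power_mono)
    have "exp (1 :: real) \<le> 4" using exp_le by linarith
    then show "1 / 4 \<le> exp (- 1 :: real)" by (simp add: exp_minus field_simps)
  qed simp
  also have "\<dots> = exp (- real n)" by (simp add: exp_of_nat_mult[symmetric])
  also have "\<dots> \<le> exp (1 - X)" using nX by simp
  finally have "(1 / 2) ^ (2 * n) * (1 / h) \<le> exp (1 - X) * (216 * exp (X / 2) / \<theta>)"
    using h h1 by (intro mult_mono) auto
  also have "\<dots> = 216 * exp 1 / \<theta> * exp (- (X / 2))"
  proof -
    have "exp (1 - X) * exp (X / 2) = exp 1 * exp (- (X / 2))" by (simp flip: exp_add)
    then show ?thesis by simp
  qed
  also have "- (X / 2) = - (\<theta> powr (2 / 5) / 2) / h powr (2 / 5)"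
    using h \<theta> by (simp add: X_def powr_divide)
  finally show "(1 / 2) ^ (2 * n) / h \<le> 216 * exp 1 / \<theta> * exp (- (\<theta> powr (2 / 5) / 2) / h powr (2 / 5))"
    by simp
qed

text \<open>exp(y) \<ge> (y / (3p))^(3p) with y = \<gamma> h^(-2/5) yields the power 6p/5 of h,
  which is at most h^p for h \<le> 1.\<close>

lemma exp_powr_le_power:
  fixes \<gamma> h :: real
  assumes \<gamma>: "\<gamma> > 0" and h: "0 < h" "h \<le> 1" and p: "p \<ge> 1"
  shows "exp (- \<gamma> / h powr (2 / 5)) \<le> (real (3 * p) / \<gamma>) ^ (3 * p) * h ^ p"
proof -
  define y where "y = \<gamma> / h powr (2 / 5)"
  have y: "y > 0" using \<gamma> h by (simp add: y_def)
  have "(y / real (3 * p)) ^ (3 * p) \<le> exp y" by (rule exp_ge_power_div) (use y p in auto)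
  then have "exp (- y) \<le> 1 / (y / real (3 * p)) ^ (3 * p)"
    using y p by (simp add: exp_minus inverse_eq_divide frac_le)
  also have "\<dots> = (real (3 * p) / \<gamma>) ^ (3 * p) * (h powr (2 / 5)) ^ (3 * p)"
    by (simp add: y_def power_divide power_mult_distrib)
  also have "(h powr (2 / 5)) ^ (3 * p) = h powr (2 / 5 * real (3 * p))"
  proof -
    have "(h powr (2 / 5)) ^ (3 * p) = (h powr (2 / 5)) powr real (3 * p)"
      by (rule powr_realpow[symmetric]) (use h in simp)
    then show ?thesis by (simp only: powr_powr)
  qed
  also have "\<dots> \<le> h powr real p"
    using h by (intro powr_mono') auto
  also have "\<dots> = h ^ p" using h by (simp add: powr_realpow)
  finally show ?thesis using \<gamma> by (simp add: y_def mult_left_mono)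
qed

theorem theorem4:
  fixes M p :: nat and \<alpha> \<beta> :: "nat \<Rightarrow> real"
    and r_over_Q R_over_Q vol :: real
  assumes "multistep_method M \<alpha> \<beta>"
    and "weakly_stable M \<alpha>"
    and "consistent M \<alpha> \<beta>"
    and "has_order M \<alpha> \<beta> p"
    and "(\<Sum>m\<le>M. \<beta> m) = 1"
  shows "\<exists>(\<gamma>::real) (h\<^sub>0::real) (c\<^sub>0::real) (c\<^sub>1::real) (c\<^sub>2::real)
            (K :: real \<Rightarrow> nat) (I :: real \<Rightarrow> nat).
      \<gamma> > 0 \<and> h\<^sub>0 > 0 \<and> c\<^sub>0 > 0 \<and> c\<^sub>1 > 0 \<and> c\<^sub>2 > 0 \<and>
      (\<forall>(Q::real) (R::real) (r::real) (\<K> :: (real ^ 'n) set)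
          (f :: real ^ 'n \<Rightarrow> real ^ 'n) (f\<^sub>\<theta> :: real ^ 'n \<Rightarrow> real ^ 'n) (h::real).
         Q > 0 \<and> R > 0 \<and> r > 0 \<and> r / Q = r_over_Q \<and> R / Q = R_over_Q \<and>
         open \<K> \<and> connected \<K> \<and> \<K> \<noteq> {} \<and> bounded \<K> \<and>
         measure lborel (nbhd \<K> R) = vol \<and>
         smooth_map f \<and> analytic_bounded Q r (nbhd \<K> R) f \<and>
         0 < h \<and> h < h\<^sub>0 \<and>
         f\<^sub>\<theta> \<in> feedforward_networks \<and> analytic_bounded_upto Q r (I h) (nbhd \<K> R) f\<^sub>\<theta>
         \<longrightarrow>
         (LINT x:\<K>|lborel. l1_norm (f\<^sub>\<theta> x - truncated_imde M \<alpha> \<beta> f (K h) h x))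
           \<le> c\<^sub>1 * exp (- \<gamma> / h powr (2 / 5))
             + c\<^sub>0 * sqrt (lmm_loss M \<alpha> \<beta> h f f\<^sub>\<theta> (nbhd \<K> R)) \<and>
         (LINT x:\<K>|lborel. l1_norm (f\<^sub>\<theta> x - f x))
           \<le> c\<^sub>2 * h ^ p
             + c\<^sub>0 * sqrt (lmm_loss M \<alpha> \<beta> h f f\<^sub>\<theta> (nbhd \<K> R)))"
proof (cases "r_over_Q > 0 \<and> R_over_Q > 0")
  case False
  \<comment> \<open>No admissible data have these ratios, so any constants do.\<close>
  have no: "\<not> (Q > 0 \<and> R > 0 \<and> r > 0 \<and> r / Q = r_over_Q \<and> R / Q = R_over_Q)" for Q R r :: real
    using False by auto
  show ?thesis
    by (rule exI[of _ 1], rule exI[of _ 1], rule exI[of _ 1], rule exI[of _ 1], rule exI[of _ 1],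
        rule exI[of _ "\<lambda>_. 0"], rule exI[of _ "\<lambda>_. 0"]) (use no in auto)
next
  case True
  define q s where "q = r_over_Q" and "s = R_over_Q"
  have q: "q > 0" and s: "s > 0" using True by (auto simp: q_def s_def)
  define D where "D = real CARD('n)"
  have D: "D \<ge> 1" unfolding D_def using zero_less_card_finite[where 'a = 'n] by linarith
  define \<kappa> where "\<kappa> = 6 / q"
  have \<kappa>: "\<kappa> > 0" using q by (simp add: \<kappa>_def)
  \<comment> \<open>The three conditions on the window in terms of q = r/Q and s = R/Q, so that
    \<open>Q\<close> itself does not enter: q / (24 D) is the existence time, halved for strictness;
    s / D gives D Q \<tau> \<le> R; and q / 12 gives \<kappa> \<tau> \<le> 1/2.\<close>
  define \<tau> where "\<tau> = min (q / (48 * D)) (min (s / D) (q / 12))"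
  have \<tau>: "\<tau> > 0" using q s D by (simp add: \<tau>_def)
  have sum_\<beta>: "(\<Sum>m\<le>M. \<beta> m) = 1" and ord: "has_order M \<alpha> \<beta> p" by fact+
  have sum_\<alpha>: "(\<Sum>m\<le>M. \<alpha> m) = 0" and p: "p \<ge> 1" using ord by (auto simp: has_order_def)
  obtain C S :: real where CS: "C > 0" "S > 0"
    and filt: "\<And>n. n \<ge> 1 \<Longrightarrow> \<exists>P J d. real d \<le> S * (real n ^ 2 * sqrt (real n)) \<and> real J \<le> S * (real n ^ 2 * sqrt (real n)) \<and>
       (\<Sum>j\<le>d. \<bar>P j\<bar>) \<le> C \<and>
       (\<forall>k<2*n. fps_nth ((\<Sum>j\<le>d. fps_const (P j) * fps_exp (real j - real J)) *
           (\<Sum>m\<le>M. fps_const (\<beta> m) * fps_exp (real m))) k = of_bool (k = 0))"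
    by (rule local_inverse_filter[OF sum_\<beta>]) (rule that)
  obtain A B where A: "A > 0" and B: "B \<ge> 1" and coeff: "\<And>k. \<bar>imde_coeff M \<alpha> \<beta> k\<bar> \<le> A * B ^ k"
    using abs_imde_coeff_le[of M \<alpha> \<beta>] by blast
  \<comment> \<open>In this order: h \<le> 1, the window for the filter plus the \<open>M\<close>
    steps of the method, and the range in which the terms of the modified equation decrease.\<close>
  define \<theta> where "\<theta> = min 1 (min (\<tau> / (S + real M)) (1 / (4 * (B * \<kappa>))))"
  have \<theta>: "\<theta> > 0" "\<theta> \<le> 1" "(S + real M) * \<theta> \<le> \<tau>" "4 * (B * \<kappa>) * \<theta> \<le> 1"
  proof -
    have SM: "S + real M > 0" using CS by simp
    have BK: "B * \<kappa> > 0" using B \<kappa> by simp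
    show "\<theta> > 0" using SM BK \<tau> by (simp add: \<theta>_def)
    show "\<theta> \<le> 1" by (simp add: \<theta>_def)
    have "\<theta> \<le> \<tau> / (S + real M)" by (simp add: \<theta>_def)
    then show "(S + real M) * \<theta> \<le> \<tau>" using SM by (simp add: pos_le_divide_eq mult.commute)
    have "\<theta> \<le> 1 / (4 * (B * \<kappa>))" by (simp add: \<theta>_def)
    then show "4 * (B * \<kappa>) * \<theta> \<le> 1" using BK by (simp add: pos_le_divide_eq mult.commute)
  qed
  define n where "n h = nat \<lfloor>(\<theta> / h) powr (2 / 5)\<rfloor>" for h
  \<comment> \<open>\<open>vol\<close> is an arbitrary real here; the absolute value keeps the
    constants positive even for a value that no domain attains.\<close>
  define V where "V = \<bar>vol\<bar>"
  \<comment> \<open>The errors are linear in \<open>Q\<close>, which the ratios leave free. But (2R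
    / D)^D \<le> V bounds R by V D^D once R \<ge> 1, and Q = R / s.\<close>
  define Qmax where "Qmax = max 1 (V * D ^ CARD('n)) / s"
  have Qmax: "Qmax > 0" using s by (simp add: Qmax_def)
  define A1 B1 where "A1 = (\<Sum>m\<le>M. \<bar>\<alpha> m\<bar>)" and "B1 = (\<Sum>m\<le>M. \<bar>\<beta> m\<bar>)"
  have AB1: "A1 \<ge> 0" "B1 \<ge> 0" by (auto simp: A1_def B1_def sum_nonneg)
  define E0 where "E0 = D * (C * Qmax * (2 * \<tau> * A1 + B1))"
  have E0: "E0 \<ge> 0" unfolding E0_def using D CS Qmax \<tau> AB1
    by (intro mult_nonneg_nonneg add_nonneg_nonneg) auto
  define C3 where "C3 = E0 * (216 * exp 1 / \<theta>)"
  have C3: "C3 \<ge> 0" unfolding C3_def using E0 \<theta> by simp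
  define F0 where "F0 = 2 * A * Qmax * fact p * (B * \<kappa>) ^ p"
  have F0: "F0 \<ge> 0" unfolding F0_def using A B Qmax \<kappa> by (intro mult_nonneg_nonneg) auto
  define \<gamma> where "\<gamma> = \<theta> powr (2 / 5) / 2"
  have \<gamma>: "\<gamma> > 0" using \<theta> by (simp add: \<gamma>_def)
  define G where "G = (real (3 * p) / \<gamma>) ^ (3 * p)"
  have G: "G \<ge> 0" unfolding G_def using \<gamma> by simp
  define c\<^sub>0 where "c\<^sub>0 = C * (4 * D) ^ CARD('n) * sqrt V * D + 1"
  define c\<^sub>1 where "c\<^sub>1 = C3 * V + 1"
  define c\<^sub>2 where "c\<^sub>2 = (C3 * G + F0) * V + 1"
  have V0: "V \<ge> 0" by (simp add: V_def)
  have c: "c\<^sub>0 > 0" "c\<^sub>1 > 0" "c\<^sub>2 > 0"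
    unfolding c\<^sub>0_def c\<^sub>1_def c\<^sub>2_def using CS D V0 C3 G F0
    by (auto intro!: add_nonneg_pos mult_nonneg_nonneg add_nonneg_nonneg)
  have main: "(LINT x:\<K>|lborel. l1_norm (g x - truncated_imde M \<alpha> \<beta> f (2 * n h - 2) h x))
           \<le> c\<^sub>1 * exp (- \<gamma> / h powr (2 / 5)) + c\<^sub>0 * sqrt (lmm_loss M \<alpha> \<beta> h f g (nbhd \<K> R)) \<and>
         (LINT x:\<K>|lborel. l1_norm (g x - f x))
           \<le> c\<^sub>2 * h ^ p + c\<^sub>0 * sqrt (lmm_loss M \<alpha> \<beta> h f g (nbhd \<K> R))"
    if Q: "Q > 0" "R > 0" "r > 0" "r / Q = r_over_Q" "R / Q = R_over_Q"
      and \<K>: "open \<K>" "\<K> \<noteq> {}" "bounded \<K>" "measure lborel (nbhd \<K> R) = vol"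
      and f: "smooth_map f" "analytic_bounded Q r (nbhd \<K> R) f" and h: "0 < h" "h < \<theta>"
      and g: "g \<in> feedforward_networks" "analytic_bounded_upto Q r (2 * n h) (nbhd \<K> R) g"
    for Q R r :: real and \<K> :: "(real ^ 'n) set" and f g :: "real ^ 'n \<Rightarrow> real ^ 'n" and h :: real
  proof -
    interpret L: lmm_learning M \<alpha> \<beta> Q R r D \<K> f
      by unfold_locales (use Q \<K> f sum_\<alpha> sum_\<beta> in \<open>auto simp: D_def\<close>)
    have rq: "r = q * Q" "R = s * Q" using Q by (auto simp: q_def s_def field_simps)
    have \<kappa>_eq: "L.\<kappa> = \<kappa>"
      unfolding L.\<kappa>_def unfolding \<kappa>_def rq using Q(1) by simp
    have T_eq: "L.T = q / (24 * D)"
      unfolding L.T_def unfolding rq using Q(1) by simp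
    have \<tau>T: "\<tau> < L.T"
    proof -
      have "\<tau> \<le> q / (48 * D)" by (simp add: \<tau>_def)
      also have "\<dots> < q / (24 * D)" using q D by (intro divide_strict_left_mono) auto
      finally show ?thesis by (simp add: T_eq)
    qed
    have \<tau>R: "D * Q * \<tau> \<le> R"
    proof -
      have "\<tau> \<le> s / D" by (simp add: \<tau>_def)
      then have "D * \<tau> \<le> s" using D by (simp add: pos_le_divide_eq mult.commute)
      then have "Q * (D * \<tau>) \<le> Q * s" using Q by (intro mult_left_mono) auto
      then show ?thesis by (simp add: rq mult_ac)
    qed
    have \<tau>\<kappa>: "L.\<kappa> * \<tau> \<le> 1 / 2"
    proof -
      have "\<tau> \<le> q / 12" unfolding \<tau>_def by linarith
      then have "\<kappa> * \<tau> \<le> \<kappa> * (q / 12)" using \<kappa> by (intro mult_left_mono) auto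
      moreover have "\<kappa> * (q / 12) = 1 / 2" using q by (simp add: \<kappa>_def)
      ultimately show ?thesis unfolding \<kappa>_eq by linarith
    qed
    note \<tau>s = \<tau> \<tau>T \<tau>R \<tau>\<kappa>
    have vol: "measure lborel (nbhd \<K> R) = V" using \<K>(4) by (metis V_def abs_of_nonneg measure_nonneg)
    have Q_le: "Q \<le> Qmax"
    proof -
      have "R \<le> max 1 (V * D ^ CARD('n))"
      proof (cases "R \<le> 1")
        case False
        have "R \<le> R ^ CARD('n)" using False by (intro self_le_power) auto
        also have "\<dots> \<le> (2 * R) ^ CARD('n)" using Q by (intro power_mono) auto
        also have "\<dots> = (2 * R / D) ^ CARD('n) * D ^ CARD('n)"
          using D by (simp add: power_divide)
        also have "\<dots> \<le> V * D ^ CARD('n)"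
          using measure_nbhd_ge[OF \<K>(2,1,3) Q(2)] D by (intro mult_right_mono) (auto simp: vol D_def)
        finally show ?thesis by simp
      qed simp
      then have "Q * s \<le> max 1 (V * D ^ CARD('n))" unfolding rq by (simp only: mult.commute)
      then show ?thesis unfolding Qmax_def using s by (simp only: pos_le_divide_eq)
    qed
    have n1: "n h \<ge> 1" and nh: "real (n h) ^ 2 * sqrt (real (n h)) * h \<le> \<theta>"
      and eps: "(1 / 2) ^ (2 * n h) / h \<le> 216 * exp 1 / \<theta> * exp (- \<gamma> / h powr (2 / 5))"
      using truncation_order[OF h] unfolding n_def[symmetric] \<gamma>_def by auto
    define w where "w = real (n h) ^ 2 * sqrt (real (n h))"
    have nw: "real (n h) \<le> w"
    proof -
      have "real (n h) * 1 \<le> real (n h) * (real (n h) * sqrt (real (n h)))"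
      proof (rule mult_left_mono)
        have "1 \<le> real (n h)" "1 \<le> sqrt (real (n h))" using n1 by auto
        then show "1 \<le> real (n h) * sqrt (real (n h))" by (rule mult_ge1_I)
      qed simp
      then show ?thesis by (simp add: w_def power2_eq_square)
    qed
    have w1: "w \<ge> 1" using nw n1 by linarith
    have wh: "w * h \<le> \<theta>" using nh by (simp add: w_def)
    obtain P J d where P: "real d \<le> S * w" "real J \<le> S * w" "(\<Sum>j\<le>d. \<bar>P j\<bar>) \<le> C"
      "\<forall>k<2 * n h. fps_nth (filter_fps d P J * (\<Sum>m\<le>M. fps_const (\<beta> m) * fps_exp (real m))) k = of_bool (k = 0)"
      using filt[OF n1] unfolding w_def filter_fps_def by blast
    have win1: "(real d + real M) * h \<le> \<tau>"
    proof -
      have "real d + real M \<le> S * w + real M * w"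
        using P(1) w1 mult_left_mono[OF w1, of "real M"] by linarith
      then have "(real d + real M) * h \<le> (S * w + real M * w) * h" using h by (intro mult_right_mono) auto
      also have "\<dots> = (S + real M) * (w * h)" by (simp add: algebra_simps)
      also have "\<dots> \<le> (S + real M) * \<theta>" using wh CS by (intro mult_left_mono) auto
      finally show ?thesis using \<theta> by linarith
    qed
    have win2: "real J * h \<le> \<tau>"
    proof -
      have "real J * h \<le> (S * w) * h" using P(2) h by (intro mult_right_mono) auto
      also have "\<dots> = S * (w * h)" by simp
      also have "\<dots> \<le> (S + real M) * \<theta>" using wh CS \<theta> h w1 by (intro mult_mono) auto
      finally show ?thesis using \<theta> by linarith
    qed
    have Mh: "real M * h \<le> \<tau>"
      by (rule order.trans[OF _ win1]) (use h in \<open>auto intro!: mult_right_mono\<close>)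
    define E where "E = D * (C * Q * (1 / 2) ^ (2 * n h) * (2 * \<tau> * A1 / h + B1))"
    have E_nonneg: "E \<ge> 0" unfolding E_def using D CS Q \<tau> AB1 h
      by (intro mult_nonneg_nonneg add_nonneg_nonneg divide_nonneg_nonneg) auto
    have E_le: "E \<le> C3 * exp (- \<gamma> / h powr (2 / 5))"
    proof -
      have "B1 \<le> B1 / h" using h \<theta> AB1 by (simp add: pos_le_divide_eq mult_left_le)
      then have "2 * \<tau> * A1 / h + B1 \<le> (2 * \<tau> * A1 + B1) / h" by (simp add: add_divide_distrib)
      then have "E \<le> D * (C * Qmax * (1 / 2) ^ (2 * n h) * ((2 * \<tau> * A1 + B1) / h))"
        unfolding E_def using D CS Q Q_le \<tau> AB1 h
        by (intro mult_left_mono mult_mono mult_right_mono) (auto intro!: divide_nonneg_nonneg add_nonneg_nonneg)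
      also have "\<dots> = E0 * ((1 / 2) ^ (2 * n h) / h)" by (simp add: E0_def)
      also have "\<dots> \<le> E0 * (216 * exp 1 / \<theta> * exp (- \<gamma> / h powr (2 / 5)))"
        by (rule mult_left_mono[OF eps E0])
      finally show ?thesis by (simp add: C3_def mult_ac)
    qed
    have point: "l1_norm (g x - truncated_imde M \<alpha> \<beta> f (2 * n h - 2) h x)
        \<le> (\<Sum>j\<le>d. \<bar>P j\<bar> * l1_norm (lmm_residual M \<alpha> \<beta> h f g (flow f ((real j - real J) * h) x))) + E"
      if "x \<in> \<K>" for x
      unfolding E_def A1_def B1_def
      by (rule L.pointwise_error[OF \<tau>s g(2) n1 that h(1) _ P(3) win1 win2]) (use P(4) in auto)
    have times: "\<bar>(real j - real J) * h\<bar> \<le> \<tau>" if "j \<le> d" for j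
    proof -
      have "real j * h \<le> (real d + real M) * h" using that h by (intro mult_right_mono) auto
      moreover have "0 \<le> real j * h" "0 \<le> real J * h" using h by auto
      ultimately show ?thesis using win1 win2 by (simp add: left_diff_distrib abs_le_iff)
    qed
    define Loss where "Loss = sqrt (lmm_loss M \<alpha> \<beta> h f g (nbhd \<K> R))"
    have "lmm_loss M \<alpha> \<beta> h f g (nbhd \<K> R) \<ge> 0"
      unfolding lmm_loss_def set_lebesgue_integral_def by (intro Bochner_Integration.integral_nonneg) auto
    then have Loss0: "Loss \<ge> 0" by (simp add: Loss_def)
    have bound: "(LINT x:\<K>|lborel. \<psi> x) \<le> b * V + c\<^sub>0 * Loss"
      if \<psi>: "\<And>x. x \<in> \<K> \<Longrightarrow> \<psi> x \<le> (\<Sum>j\<le>d. \<bar>P j\<bar> * l1_norm (lmm_residual M \<alpha> \<beta> h f g (flow f ((real j - real J) * h) x))) + b"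
        and b: "b \<ge> 0" for \<psi> b
    proof -
      have "(LINT x:\<K>|lborel. \<psi> x) \<le> C * (4 * D) ^ CARD('n) * sqrt (measure lborel (nbhd \<K> R)) * D * Loss
          + b * measure lborel (nbhd \<K> R)"
        unfolding Loss_def
        by (rule L.integral_le_loss[OF \<tau>s h(1) Mh feedforward_network_continuous[OF g(1)] \<psi> times P(3) b])
      also have "\<dots> \<le> b * V + c\<^sub>0 * Loss" using Loss0 by (simp add: vol c\<^sub>0_def algebra_simps)
      finally show ?thesis .
    qed
    have first: "(LINT x:\<K>|lborel. l1_norm (g x - truncated_imde M \<alpha> \<beta> f (2 * n h - 2) h x))
        \<le> E * V + c\<^sub>0 * Loss"
      by (rule bound[OF point E_nonneg])
    also have "E * V \<le> (C3 * exp (- \<gamma> / h powr (2 / 5))) * V"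
      by (rule mult_right_mono[OF E_le V0])
    also have "\<dots> \<le> c\<^sub>1 * exp (- \<gamma> / h powr (2 / 5))" by (simp add: c\<^sub>1_def algebra_simps)
    finally have est1: "(LINT x:\<K>|lborel. l1_norm (g x - truncated_imde M \<alpha> \<beta> f (2 * n h - 2) h x))
        \<le> c\<^sub>1 * exp (- \<gamma> / h powr (2 / 5)) + c\<^sub>0 * Loss" by simp
    define F where "F = 2 * A * Q * fact p * (B * \<kappa> * h) ^ p"
    have F_nonneg: "F \<ge> 0" unfolding F_def using A B Q \<kappa> h by (intro mult_nonneg_nonneg) auto
    have F_le: "F \<le> F0 * h ^ p"
    proof -
      have "F \<le> 2 * A * Qmax * fact p * (B * \<kappa> * h) ^ p"
        unfolding F_def using A B Q_le \<kappa> h by (intro mult_right_mono mult_left_mono) auto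
      then show ?thesis by (simp add: F0_def power_mult_distrib mult_ac)
    qed
    have "(LINT x:\<K>|lborel. l1_norm (g x - f x)) \<le> (E + F) * V + c\<^sub>0 * Loss"
    proof (rule bound)
      fix x assume x: "x \<in> \<K>"
      have "l1_norm (truncated_imde M \<alpha> \<beta> f (2 * n h - 2) h x - f x) \<le> 2 * A * Q * fact p * (B * L.\<kappa> * h) ^ p"
      proof (rule L.truncated_imde_error[OF coeff A B ord _ h(1)])
        show "x \<in> nbhd \<K> R" using x Q by (force simp: nbhd_def)
        \<comment> \<open>Since n \<le> n^(5/2) = w, the window bound
          \<open>w * h \<le> \<theta>\<close> also controls the truncation index.\<close>
        have "real (2 * n h - 2) * (B * L.\<kappa> * h) \<le> (2 * w) * (B * \<kappa> * h)"
          unfolding \<kappa>_eq using nw B \<kappa> h by (intro mult_right_mono) auto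
        also have "\<dots> = 2 * (B * \<kappa>) * (w * h)" by simp
        also have "\<dots> \<le> 2 * (B * \<kappa>) * \<theta>" using wh B \<kappa> by (intro mult_left_mono) auto
        also have "\<dots> \<le> 1 / 2" using \<theta> by simp
        finally show "real (2 * n h - 2) * (B * L.\<kappa> * h) \<le> 1 / 2" .
      qed
      then have "l1_norm (truncated_imde M \<alpha> \<beta> f (2 * n h - 2) h x - f x) \<le> F"
        by (simp add: F_def \<kappa>_eq)
      then show "l1_norm (g x - f x) \<le> (\<Sum>j\<le>d. \<bar>P j\<bar> * l1_norm (lmm_residual M \<alpha> \<beta> h f g (flow f ((real j - real J) * h) x))) + (E + F)"
        using point[OF x] l1_norm_triangle[of "g x - truncated_imde M \<alpha> \<beta> f (2 * n h - 2) h x"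
            "truncated_imde M \<alpha> \<beta> f (2 * n h - 2) h x - f x"] by simp
    qed (use E_nonneg F_nonneg in simp)
    also have "(E + F) * V \<le> ((C3 * G + F0) * h ^ p) * V"
    proof (rule mult_right_mono[OF _ V0])
      have "E \<le> C3 * (G * h ^ p)"
        unfolding G_def
        by (rule order.trans[OF E_le mult_left_mono[OF exp_powr_le_power[OF \<gamma> h(1) _ p] C3]])
           (use h \<theta> in linarith)
      then show "E + F \<le> (C3 * G + F0) * h ^ p" using F_le by (simp add: algebra_simps)
    qed
    also have "\<dots> \<le> c\<^sub>2 * h ^ p" using h by (simp add: c\<^sub>2_def algebra_simps)
    finally have "(LINT x:\<K>|lborel. l1_norm (g x - f x)) \<le> c\<^sub>2 * h ^ p + c\<^sub>0 * Loss" by simp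
    with est1 show ?thesis by (simp add: Loss_def)
  qed
  \<comment> \<open>The integers 2n - 2 and 2n match \<open>pointwise_error\<close>. Through n they
    depend on \<open>h\<close> and \<open>\<theta>\<close> alone, hence neither on the vector field
    nor on the network.\<close>
  show ?thesis
    by (rule exI[of _ \<gamma>], rule exI[of _ \<theta>], rule exI[of _ c\<^sub>0], rule exI[of _ c\<^sub>1], rule exI[of _ c\<^sub>2],
        rule exI[of _ "\<lambda>h. 2 * n h - 2"], rule exI[of _ "\<lambda>h. 2 * n h"], intro conjI allI impI; (elim conjE)?)
       (use \<gamma> \<theta> c main in blast)+
qed

end
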